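(* Let $2\le p<\infty$ and $f,g\in L^p(\mathbb{R}^d)$. Denote $\Phi(x):=(f(x),g(x))$ and $P_t\Phi(x):=(P_tf(x),P_tg(x))$ for $t\ge0$, $x\in\mathbb{R}^d$. Then $$\int_0^\infty\int_{\mathbb{R}^d}\int_{\mathbb{R}^d}\big|\mathcal{J}_p(P_t\Phi(x),P_t\Phi(y))\big|\,\nu(x,y)\,dx\,dy\,dt<\infty$$ and $$\int_{\mathbb{R}^d}f g^{\langle p-1\rangle}\,dx=\int_0^\infty\int_{\mathbb{R}^d}\int_{\mathbb{R}^d}\mathcal{J}_p(P_t\Phi(x),P_t\Phi(y))\,\nu(x,y)\,dx\,dy\,dt.$$
   Context: Setting. Let $d\ge 1$. Let $\nu:\mathbb{R}^d\setminus\{0\}\to(0,\infty)$ be a Borel function with $\nu(-z)=\nu(z)$ and $\int_{\mathbb{R}^d}(|z|^2\wedge 1)\nu(z)\,dz<\infty$. Put $\psi(\xi):=\int_{\mathbb{R}^d}(1-\cos(\xi\cdot x))\nu(x)\,dx$ for $\xi\in\mathbb{R}^d$, and assume $\lim_{|\xi|\to\infty}\psi(\xi)/\log|\xi|=\infty$. Let $p_t(x):=(2\pi)^{-d}\int_{\mathbb{R}^d}e^{-i\xi\cdot x}e^{-t\psi(\xi)}\,d\xi$ for $t>0$, $x\in\mathbb{R}^d$ (a convolution semigroup of probability densities), $p_t(x,y):=p_t(y-x)$ and $\nu(x,y):=\nu(y-x)$. Assume moreover that there is a constant $c$ with $p_t(x,y)/t\le c\,\nu(x,y)$ for all $t>0$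 and $x\ne y$, and that $p_t(x,y)/t\to\nu(x,y)$ as $t\to0^+$ for all $x\neq y$. For $f\in L^p(\mathbb{R}^d)$ (real-valued) let $P_tf(x):=\int_{\mathbb{R}^d}f(y)p_t(x,y)\,dy$ for $t>0$, and $P_0f:=f$. All functions are Borel. For $a\in\mathbb{R}$ and $\kappa>0$, $a^{\langle\kappa\rangle}:=|a|^\kappa\operatorname{sgn}a$ (so $0^{\langle\kappa\rangle}=0$); $0^0:=1$. For $w=(w_1,w_2)$, $z=(z_1,z_2)\in\mathbb{R}^2$, the Bregman co-divergence is $$\mathcal{J}_p(w,z):=z_1z_2^{\langle p-1\rangle}-w_1w_2^{\langle p-1\rangle}-w_2^{\langle p-1\rangle}(z_1-w_1)-(p-1)w_1|w_2|^{p-2}(z_2-w_2).$$ *)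

theory Defs
  imports "HOL-Analysis.Analysis"
begin

text \<open>The space \<open>\<real>\<^sup>d\<close> is an arbitrary type of class \<^class>\<open>euclidean_space\<close>, with
  \<open>d = DIM('a) \<ge> 1\<close>. The Levy density \<open>\<nu>\<close> is a total function, but its value at \<open>0\<close> is
  irrelevant: the origin is a null set, and \<open>\<nu> (y - x)\<close> is only ever used for \<open>x \<noteq> y\<close> or
  multiplied by a factor that vanishes for \<open>x = y\<close>.\<close>

text \<open>\<^const>\<open>powr\<close> satisfies \<open>0 powr 0 = 0\<close>, whereas the convention here is \<open>0\<^sup>0 = 1\<close>; the
  difference matters for \<open>\<bar>w\<^sub>2\<bar>\<close> to the power \<open>p - 2\<close> when \<open>p = 2\<close>.\<close>

definition abs_pow :: "real \<Rightarrow> real \<Rightarrow> real" where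
  "abs_pow a \<kappa> = (if \<kappa> = 0 then 1 else \<bar>a\<bar> powr \<kappa>)"

definition signed_pow :: "real \<Rightarrow> real \<Rightarrow> real" where
  "signed_pow a \<kappa> = abs_pow a \<kappa> * sgn a"

fun bregman_codiv :: "real \<Rightarrow> real \<times> real \<Rightarrow> real \<times> real \<Rightarrow> real" where
  "bregman_codiv p (w1, w2) (z1, z2) =
     z1 * signed_pow z2 (p - 1) - w1 * signed_pow w2 (p - 1)
     - signed_pow w2 (p - 1) * (z1 - w1)
     - (p - 1) * w1 * abs_pow w2 (p - 2) * (z2 - w2)"

definition levy_exponent :: "('a::euclidean_space \<Rightarrow> real) \<Rightarrow> 'a \<Rightarrow> real" where
  "levy_exponent \<nu> \<xi> = (LINT x|lborel. (1 - cos (\<xi> \<bullet> x)) * \<nu> x)"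

text \<open>The complex integral below is real for symmetric \<open>\<nu>\<close>; \<^const>\<open>Re\<close> is only a type
  conversion.\<close>

definition heat_kernel :: "('a::euclidean_space \<Rightarrow> real) \<Rightarrow> real \<Rightarrow> 'a \<Rightarrow> real" where
  "heat_kernel \<nu> t x = Re ((LINT \<xi>|lborel.
       exp (- (\<i> * complex_of_real (\<xi> \<bullet> x))) * complex_of_real (exp (- t * levy_exponent \<nu> \<xi>)))
     / complex_of_real ((2 * pi) ^ DIM('a)))"

definition heat_semigroup ::
    "('a::euclidean_space \<Rightarrow> real) \<Rightarrow> real \<Rightarrow> ('a \<Rightarrow> real) \<Rightarrow> 'a \<Rightarrow> real" where
  "heat_semigroup \<nu> t f x =
     (if t = 0 then f x else (LINT y|lborel. f y * heat_kernel \<nu> t (y - x)))"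

definition heat_semigroup_pair ::
    "('a::euclidean_space \<Rightarrow> real) \<Rightarrow> real \<Rightarrow> ('a \<Rightarrow> real \<times> real) \<Rightarrow> 'a \<Rightarrow> real \<times> real" where
  "heat_semigroup_pair \<nu> t \<Phi> x =
     (heat_semigroup \<nu> t (\<lambda>u. fst (\<Phi> u)) x, heat_semigroup \<nu> t (\<lambda>u. snd (\<Phi> u)) x)"

text \<open>Functions, not equivalence classes.\<close>

definition Lp_fun :: "real \<Rightarrow> ('a::euclidean_space \<Rightarrow> real) \<Rightarrow> bool" where
  "Lp_fun p f \<longleftrightarrow> f \<in> borel_measurable borel \<and> integrable lborel (\<lambda>x. \<bar>f x\<bar> powr p)"

end

theory Submission
  imports Defs "HOL-Probability.Characteristic_Functions" "HOL-Probability.Sinc_Integral"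
begin

text \<open>The mechanism is a Hardy--Stein identity for one convex function \<open>Y\<close> of two variables with Bregman
divergence \<open>B\<close>: if \<open>P\<close> is the heat semigroup and \<open>a \<ge> 0\<close>,
\<open>\<integral> Y (a, b) = \<integral>\<^sub>0\<^sup>\<infinity> \<integral> \<integral> B ((P t a, P t b) (x), (P t a, P t b) (y)) \<nu> (y - x)\<close>. As \<open>B \<ge> 0\<close>, everything on the
right makes sense in \<open>[0, \<infinity>]\<close>, and finiteness comes out of the proof. Two relations that involve the
kernel \<open>k h\<close> of \<open>P h\<close> carry it. Let \<open>G t = \<integral> Y (P t a, P t b)\<close>.

\<^item> \<open>G t - G (t + h)\<close> is the integral of \<open>B\<close> between the values at time \<open>t + h\<close> in \<open>x\<close> and at time \<open>t\<close>
  in \<open>y\<close>, against \<open>k h (y - x)\<close>. Divide by \<open>h\<close>, integrate over \<open>t\<close> and let \<open>h\<close> tend to \<open>0\<close>: since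
  \<open>k h / h\<close> tends to \<open>\<nu>\<close>, Fatou's lemma bounds the energy integral by \<open>G 0\<close>.

\<^item> If both values are taken at time \<open>t\<close>, the same integral is at least \<open>G t - G (t + h)\<close>. Its
  integrand is dominated by means of \<open>k h / h \<le> c \<nu>\<close>, with a majorant that is integrable by the first
  step. So the limit \<open>h \<rightarrow> 0\<close> may be taken, and the energy integral is at least \<open>G 0 - G T\<close> for all
  \<open>T\<close>; finally \<open>G T\<close> tends to \<open>0\<close>.

This is \<open>convex_hardy_stein\<close>. No regularity of the semigroup on \<open>L\<^sup>p\<close> beyond strong continuity at time
\<open>0\<close> and decay at infinity enters.

The function \<open>a * signed_pow b (p - 1)\<close> itself is not convex, and for \<open>2 < p < 3\<close> its co-divergence
is not even bounded by a multiple of the divergence of \<open>\<bar>z\<bar>\<^sup>p\<close>. But take a convex \<open>m\<close> with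
\<open>m b - m (- b) = signed_pow b (p - 1)\<close>. Then \<open>a * m b\<close> becomes convex on the
half-plane \<open>a \<ge> 0\<close> after adding a multiple of
\<open>\<bar>b\<bar>\<^sup>p + \<bar>a + b\<bar>\<^sup>p + \<bar>a - b\<bar>\<^sup>p\<close>, which is even in \<open>b\<close>. Hence the co-divergence is the difference
of two nonnegative divergences, at \<open>(f, g)\<close> and at \<open>(f, -g)\<close>
(\<open>gauge_bregman_nonneg\<close>, \<open>bregman_codiv_polarization\<close>). This settles \<open>f \<ge> 0\<close>, and the co-divergence is
linear in the first components, so \<open>f\<close> may be split into its positive and negative parts.

It remains to see that the inverse Fourier transform of \<open>exp (- t * \<psi>)\<close> is a convolution semigroup
of probability densities. Positivity holds because multiplication by the cosine transform of a
nonnegative function preserves the functions with nonnegative cosine transform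
(\<open>cos_transform_times_nonneg\<close>); exponentiating, and truncating \<open>\<nu>\<close> near the origin, reaches
\<open>exp (- t * \<psi>)\<close>. Mass and semigroup law follow from Fourier inversion with Gaussian cut-offs.\<close>

section \<open>Signed powers and their Bregman divergence\<close>

lemma mvt_segment:
  fixes f f' :: "real \<Rightarrow> real"
  assumes "\<And>s. (f has_real_derivative f' s) (at s)"
  shows "\<exists>\<xi>. min x y \<le> \<xi> \<and> \<xi> \<le> max x y \<and> f y - f x = f' \<xi> * (y - x)"
proof (cases x y rule: linorder_cases)
  case less
  from MVT2[OF less, of f f'] assms obtain z where "z > x" "z < y" "f y - f x = (y - x) * f' z" by blast
  with less show ?thesis by (intro exI[of _ z]) (auto simp: mult.commute)
next
  case greater
  from MVT2[OF greater, of f f'] assms obtain z where "z > y" "z < x" "f x - f y = (x - y) * f' z" by blast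
  with greater show ?thesis by (intro exI[of _ z]) (auto simp: algebra_simps)
qed auto

lemma abs_pow_nonneg [simp]: "abs_pow a q \<ge> 0"
  by (simp add: abs_pow_def)

lemma abs_pow_mono: "q \<ge> 0 \<Longrightarrow> \<bar>a\<bar> \<le> \<bar>b\<bar> \<Longrightarrow> abs_pow a q \<le> abs_pow b q"
  by (auto simp: abs_pow_def intro: powr_mono2)

lemma abs_pow_minus [simp]: "abs_pow (- a) q = abs_pow a q"
  by (simp add: abs_pow_def)

lemma signed_pow_minus [simp]: "signed_pow (- a) q = - signed_pow a q"
  by (simp add: signed_pow_def sgn_minus)

lemma signed_pow_0 [simp]: "signed_pow 0 q = 0"
  by (simp add: signed_pow_def)

lemma abs_signed_pow_le: "\<bar>signed_pow a q\<bar> \<le> abs_pow a q"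
  by (auto simp: signed_pow_def abs_mult sgn_if)

lemma signed_pow_1 [simp]: "signed_pow a 1 = a"
  by (auto simp: signed_pow_def abs_pow_def sgn_if)

lemma signed_pow_mono:
  assumes "q > 0" "a \<le> b" shows "signed_pow a q \<le> signed_pow b q"
proof (cases "a \<ge> 0")
  case True then show ?thesis using assms
    by (auto simp: signed_pow_def abs_pow_def sgn_if intro: powr_mono2)
next
  case False
  show ?thesis
  proof (cases "b \<ge> 0")
    case True then show ?thesis using False assms
      by (auto simp: signed_pow_def abs_pow_def sgn_if intro: order_trans[of _ 0])
  next
    case b: False
    have "(-b) powr q \<le> (-a) powr q" using assms b by (intro powr_mono2) auto
    then show ?thesis using False b assms by (simp add: signed_pow_def abs_pow_def)
  qed
qed

lemma continuous_on_abs_pow [continuous_intros]: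
  assumes "continuous_on S f" "q \<ge> 0" shows "continuous_on S (\<lambda>x. abs_pow (f x) q)"
proof (cases "q = 0")
  case False
  have "continuous_on S (\<lambda>x. \<bar>f x\<bar> powr q)"
    using assms False by (intro continuous_on_powr' continuous_intros) auto
  then show ?thesis using False by (simp add: abs_pow_def)
qed (simp add: abs_pow_def)

lemma signed_pow_has_derivative:
  assumes "q \<ge> 1"
  shows "((\<lambda>s. signed_pow s q) has_real_derivative q * abs_pow s (q - 1)) (at s)"
proof (cases "q = 1")
  case True then show ?thesis by (simp add: abs_pow_def)
next
  case False
  then have q: "q > 1" using assms by simp
  consider "s > 0" | "s < 0" | "s = 0" by linarith
  then show ?thesis
  proof cases
    case 1
    have "((\<lambda>s. s powr q) has_real_derivative q * s powr (q - 1)) (at s)"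
      using 1 by (auto intro!: derivative_eq_intros)
    moreover have "eventually (\<lambda>x. x > 0) (nhds s)"
      using 1 by (intro eventually_nhds_in_open[of "{0<..}", simplified]) auto
    then have ev: "eventually (\<lambda>x. signed_pow x q = x powr q) (nhds s)"
      by eventually_elim (use q in \<open>auto simp: signed_pow_def abs_pow_def\<close>)
    ultimately show ?thesis using 1 q
      by (subst DERIV_cong_ev[OF refl ev refl]) (auto simp: abs_pow_def)
  next
    case 2
    have "((\<lambda>s. - ((- s) powr q)) has_real_derivative q * (- s) powr (q - 1)) (at s)"
      using 2 by (auto intro!: derivative_eq_intros)
    moreover have "eventually (\<lambda>x. x < 0) (nhds s)"
      using 2 by (intro eventually_nhds_in_open[of "{..<0}", simplified]) auto
    then have ev: "eventually (\<lambda>x. signed_pow x q = - ((- x) powr q)) (nhds s)"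
      by eventually_elim (use q in \<open>auto simp: signed_pow_def abs_pow_def\<close>)
    ultimately show ?thesis using 2 q
      by (subst DERIV_cong_ev[OF refl ev refl]) (auto simp: abs_pow_def)
  next
    case 3
    have "((\<lambda>h. abs_pow h (q - 1)) \<longlongrightarrow> abs_pow 0 (q - 1)) (at 0)"
      using continuous_on_abs_pow[of UNIV "\<lambda>x. x" "q - 1"] q
      by (auto simp: continuous_on_def)
    moreover have "eventually (\<lambda>h. abs_pow h (q - 1) = (signed_pow (s + h) q - signed_pow s q) / h) (at 0)"
      unfolding eventually_at_filter using q 3
      by (intro always_eventually) (auto simp: signed_pow_def abs_pow_def powr_diff sgn_if divide_simps)
    ultimately show ?thesis unfolding DERIV_def using 3 q
      by (auto simp: abs_pow_def intro: Lim_transform_eventually)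
  qed
qed

lemma abs_powr_has_derivative:
  assumes "q > 1"
  shows "((\<lambda>s. \<bar>s\<bar> powr q) has_real_derivative q * signed_pow s (q - 1)) (at s)"
proof -
  consider "s > 0" | "s < 0" | "s = 0" by linarith
  then show ?thesis
  proof cases
    case 1
    have "((\<lambda>s. s powr q) has_real_derivative q * s powr (q - 1)) (at s)"
      using 1 by (auto intro!: derivative_eq_intros)
    moreover have "eventually (\<lambda>x. x > 0) (nhds s)"
      using 1 by (intro eventually_nhds_in_open[of "{0<..}", simplified]) auto
    then have ev: "eventually (\<lambda>x. \<bar>x\<bar> powr q = x powr q) (nhds s)"
      by eventually_elim auto
    ultimately show ?thesis using 1 assms
      by (subst DERIV_cong_ev[OF refl ev refl]) (auto simp: signed_pow_def abs_pow_def)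
  next
    case 2
    have "((\<lambda>s. (- s) powr q) has_real_derivative - q * (- s) powr (q - 1)) (at s)"
      using 2 by (auto intro!: derivative_eq_intros)
    moreover have "eventually (\<lambda>x. x < 0) (nhds s)"
      using 2 by (intro eventually_nhds_in_open[of "{..<0}", simplified]) auto
    then have ev: "eventually (\<lambda>x. \<bar>x\<bar> powr q = (- x) powr q) (nhds s)"
      by eventually_elim auto
    ultimately show ?thesis using 2 assms
      by (subst DERIV_cong_ev[OF refl ev refl]) (auto simp: signed_pow_def abs_pow_def)
  next
    case 3
    have "((\<lambda>h. signed_pow h (q - 1)) \<longlongrightarrow> 0) (at 0)"
    proof (rule Lim_null_comparison)
      show "((\<lambda>h. abs_pow h (q - 1)) \<longlongrightarrow> 0) (at 0)"
        using continuous_on_abs_pow[of UNIV "\<lambda>x. x" "q - 1"] assms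
        by (auto simp: continuous_on_def abs_pow_def dest: spec[of _ 0])
    qed (auto simp: abs_signed_pow_le)
    moreover have "eventually (\<lambda>h. signed_pow h (q - 1) = (\<bar>s + h\<bar> powr q - \<bar>s\<bar> powr q) / h) (at 0)"
      unfolding eventually_at_filter using assms 3
      by (intro always_eventually) (auto simp: signed_pow_def abs_pow_def powr_diff sgn_if divide_simps)
    ultimately show ?thesis unfolding DERIV_def using 3 assms
      by (auto simp: intro: Lim_transform_eventually)
  qed
qed

lemma continuous_on_signed_pow [continuous_intros]:
  assumes "continuous_on S f" "q \<ge> 1" shows "continuous_on S (\<lambda>x. signed_pow (f x) q)"
proof -
  have "continuous_on UNIV (\<lambda>s. signed_pow s q)"
    using signed_pow_has_derivative[OF assms(2)]
    by (meson DERIV_isCont continuous_at_imp_continuous_on)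
  then show ?thesis using continuous_on_compose2[OF _ assms(1), of UNIV "\<lambda>s. signed_pow s q"] by simp
qed

definition bregman_power :: "real \<Rightarrow> real \<Rightarrow> real \<Rightarrow> real" where
  "bregman_power p a b = \<bar>b\<bar> powr p - \<bar>a\<bar> powr p - p * signed_pow a (p - 1) * (b - a)"

lemma bregman_of_convex_nonneg:
  fixes q q' :: "real \<Rightarrow> real"
  assumes d: "\<And>s. (q has_real_derivative q' s) (at s)" and m: "\<And>s t. s \<le> t \<Longrightarrow> q' s \<le> q' t"
  shows "q b - q a - q' a * (b - a) \<ge> 0"
proof -
  obtain \<xi> where x: "min a b \<le> \<xi>" "\<xi> \<le> max a b" "q b - q a = q' \<xi> * (b - a)"
    using mvt_segment[of q q' a b] d by auto
  have "(q' \<xi> - q' a) * (b - a) \<ge> 0"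
    using x(1,2) m[of a \<xi>] m[of \<xi> a] by (cases "a \<le> b") (auto intro: mult_nonneg_nonneg mult_nonpos_nonpos)
  then show ?thesis using x(3) by (simp add: algebra_simps)
qed

lemma bregman_power_nonneg: "p \<ge> 2 \<Longrightarrow> bregman_power p a b \<ge> 0"
  unfolding bregman_power_def
  by (rule bregman_of_convex_nonneg[of "\<lambda>s. \<bar>s\<bar> powr p" "\<lambda>s. p * signed_pow s (p - 1)"])
     (auto intro!: abs_powr_has_derivative mult_left_mono signed_pow_mono)

definition convexity_const :: "real \<Rightarrow> real" where
  "convexity_const p = p * (p - 1) / 64 * (1/2) powr (p - 2)"

lemma convexity_const_pos: "p \<ge> 2 \<Longrightarrow> convexity_const p > 0"
  by (simp add: convexity_const_def)

text \<open>The divergence is at least \<open>(q' c - q' a) (b - c)\<close> for the derivative \<open>q'\<close> of \<open>\<bar>s\<bar>\<^sup>p\<close> and every \<open>c\<close>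
between \<open>a\<close> and \<open>b\<close>. Points within a quarter of the segment from the endpoint of larger modulus
\<open>N\<close> have modulus at least \<open>N / 2\<close>, so the second derivative is comparable to \<open>N\<^bsup>p-2\<^esup>\<close> there; \<open>c\<close> is
chosen to exploit that quarter.\<close>

lemma bregman_power_lower:
  assumes p: "p \<ge> 2" and M: "\<bar>M\<bar> \<le> max \<bar>a\<bar> \<bar>b\<bar>"
  shows "bregman_power p a b \<ge> convexity_const p * (b - a)\<^sup>2 * abs_pow M (p - 2)"
proof -
  define q' where "q' s = p * signed_pow s (p - 1)" for s
  define N where "N = max \<bar>a\<bar> \<bar>b\<bar>"
  have q'm: "q' s \<le> q' t" if "s \<le> t" for s t
    using that p by (auto simp: q'_def intro!: mult_left_mono signed_pow_mono)
  have q'd: "(q' has_real_derivative p * ((p - 1) * abs_pow s (p - 2))) (at s)" for s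
    unfolding q'_def using signed_pow_has_derivative[of "p - 1" s] p by (intro DERIV_cmult) (auto simp: algebra_simps)
  \<comment> \<open>The divergence from \<open>a\<close> to \<open>b\<close> is the sum of those from \<open>a\<close> to \<open>c\<close> and from \<open>c\<close> to \<open>b\<close> and of this term.\<close>
  have split: "bregman_power p a b \<ge> (q' c - q' a) * (b - c)" for c
    using bregman_power_nonneg[OF p, of a c] bregman_power_nonneg[OF p, of c b]
    unfolding bregman_power_def q'_def by (simp add: algebra_simps)
  have half: "abs_pow \<xi> (p - 2) \<ge> (1/2) powr (p - 2) * abs_pow M (p - 2)" if "\<bar>\<xi>\<bar> \<ge> N / 2" for \<xi>
  proof -
    have "(1/2) powr (p - 2) * abs_pow M (p - 2) = abs_pow (M / 2) (p - 2)"
      by (auto simp: abs_pow_def powr_divide)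
    also have "\<dots> \<le> abs_pow \<xi> (p - 2)" using that M p by (intro abs_pow_mono) (auto simp: N_def max_def split: if_splits)
    finally show ?thesis .
  qed
  have fin: "convexity_const p * (b - a)\<^sup>2 * abs_pow M (p - 2) \<le> p * ((p - 1) * abs_pow \<xi> (p - 2)) * (r * (b - a)\<^sup>2)"
    if "\<bar>\<xi>\<bar> \<ge> N / 2" "r \<ge> 1/64" for \<xi> r
  proof -
    have "convexity_const p * (b - a)\<^sup>2 * abs_pow M (p - 2)
       = (p * (p - 1)) * ((1/2) powr (p - 2) * abs_pow M (p - 2)) * (1/64 * (b - a)\<^sup>2)"
      by (simp add: convexity_const_def)
    also have "\<dots> \<le> (p * (p - 1)) * abs_pow \<xi> (p - 2) * (r * (b - a)\<^sup>2)"
      using that half[of \<xi>] p by (intro mult_mono) (auto intro!: mult_right_mono)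
    finally show ?thesis by (simp add: mult.assoc)
  qed
  show ?thesis
  proof (cases "\<bar>b\<bar> \<le> \<bar>a\<bar>")
    case True
    define c where "c = a + (b - a) / 4"
    obtain \<xi> where x: "min a c \<le> \<xi>" "\<xi> \<le> max a c" "q' c - q' a = p * ((p - 1) * abs_pow \<xi> (p - 2)) * (c - a)"
      using mvt_segment[OF q'd, of a c] by blast
    have "\<bar>\<xi> - a\<bar> \<le> \<bar>b - a\<bar> / 4"
      using x(1,2) by (cases "a \<le> b") (auto simp: c_def min_def max_def field_simps split: if_splits)
    moreover have "\<bar>a\<bar> \<le> \<bar>\<xi>\<bar> + \<bar>\<xi> - a\<bar>" "\<bar>b - a\<bar> \<le> \<bar>a\<bar> + \<bar>b\<bar>" "N = \<bar>a\<bar>" using True by (auto simp: N_def)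
    ultimately have "\<bar>\<xi>\<bar> \<ge> N / 2" using True [[linarith_split_limit = 0]] by linarith
    from fin[OF this, of "3/16"] split[of c] show ?thesis unfolding x(3)
      by (auto simp: c_def power2_eq_square field_simps)
  next
    case False
    define e where "e = a + 3 * (b - a) / 4"
    define c where "c = a + 7 * (b - a) / 8"
    obtain \<xi> where x: "min e c \<le> \<xi>" "\<xi> \<le> max e c" "q' c - q' e = p * ((p - 1) * abs_pow \<xi> (p - 2)) * (c - e)"
      using mvt_segment[OF q'd, of e c] by blast
    have "\<bar>b - \<xi>\<bar> \<le> \<bar>b - a\<bar> / 4"
      using x(1,2) by (cases "a \<le> b") (auto simp: c_def e_def min_def max_def field_simps split: if_splits)
    moreover have "\<bar>b\<bar> \<le> \<bar>\<xi>\<bar> + \<bar>b - \<xi>\<bar>" "\<bar>b - a\<bar> \<le> \<bar>a\<bar> + \<bar>b\<bar>" "N = \<bar>b\<bar>" using False by (auto simp: N_def)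
    ultimately have "\<bar>\<xi>\<bar> \<ge> N / 2" using False [[linarith_split_limit = 0]] by linarith
    from fin[OF this, of "1/64"] have 1: "convexity_const p * (b - a)\<^sup>2 * abs_pow M (p - 2) \<le> (q' c - q' e) * (b - c)"
      unfolding x(3) by (auto simp: c_def e_def power2_eq_square field_simps)
    have "(q' e - q' a) * (b - c) \<ge> 0"
    proof (cases "a \<le> b")
      case True
      then have "a \<le> e" "c \<le> b" by (auto simp: c_def e_def field_simps)
      then show ?thesis using q'm[of a e] by simp
    next
      case False
      then have "e \<le> a" "b \<le> c" by (auto simp: c_def e_def field_simps)
      then show ?thesis using q'm[of e a] by (simp add: mult_nonpos_nonpos)
    qed
    with 1 split[of c] show ?thesis by (simp add: algebra_simps)
  qed
qed

section \<open>A convex function with prescribed odd part\<close>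

definition bregman :: "(real \<Rightarrow> real \<Rightarrow> real) \<Rightarrow> (real \<Rightarrow> real \<Rightarrow> real) \<Rightarrow> (real \<Rightarrow> real \<Rightarrow> real) \<Rightarrow>
    real \<Rightarrow> real \<Rightarrow> real \<Rightarrow> real \<Rightarrow> real" where
  "bregman Y D1 D2 w1 w2 z1 z2 = Y z1 z2 - Y w1 w2 - D1 w1 w2 * (z1 - w1) - D2 w1 w2 * (z2 - w2)"

text \<open>Convexity is demanded on the half-plane of nonnegative first components only: the functions of
interest are not convex beyond it. The gradient has to be continuous because divergences
are passed to the limit. The growth bounds make all integrals of the identity converge in \<open>L\<^sup>p\<close>.\<close>

locale convex_gauge =
  fixes Y D1 D2 :: "real \<Rightarrow> real \<Rightarrow> real" and p C :: real
  assumes p_ge_2: "p \<ge> 2"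
    and C_nonneg: "C \<ge> 0"
    and Y_cont: "continuous_on UNIV (\<lambda>(a, b). Y a b)"
    and D1_cont: "continuous_on UNIV (\<lambda>(a, b). D1 a b)"
    and D2_cont: "continuous_on UNIV (\<lambda>(a, b). D2 a b)"
    and Y_bound: "\<bar>Y a b\<bar> \<le> C * (\<bar>a\<bar> + \<bar>b\<bar>) powr p"
    and D1_bound: "\<bar>D1 a b\<bar> \<le> C * (\<bar>a\<bar> + \<bar>b\<bar>) powr (p - 1)"
    and D2_bound: "\<bar>D2 a b\<bar> \<le> C * (\<bar>a\<bar> + \<bar>b\<bar>) powr (p - 1)"
    and bregman_nonneg: "w1 \<ge> 0 \<Longrightarrow> z1 \<ge> 0 \<Longrightarrow> bregman Y D1 D2 w1 w2 z1 z2 \<ge> 0"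

text \<open>For \<open>p > 2\<close> this is \<open>(max 0 s)\<^bsup>p-1\<^esup>\<close>. For \<open>p = 2\<close> the positive part has no continuous derivative;
\<open>s / 2\<close> has the same odd part and is convex as well.\<close>

definition half_power :: "real \<Rightarrow> real \<Rightarrow> real" where
  "half_power p s = (if p = 2 then s / 2 else (\<bar>s\<bar> powr (p - 1) + signed_pow s (p - 1)) / 2)"

definition half_power_deriv :: "real \<Rightarrow> real \<Rightarrow> real" where
  "half_power_deriv p s = (if p = 2 then 1 / 2 else (p - 1) * (signed_pow s (p - 2) + abs_pow s (p - 2)) / 2)"

lemma half_power_odd_part: "p \<ge> 2 \<Longrightarrow> half_power p s - half_power p (- s) = signed_pow s (p - 1)"
  by (simp add: half_power_def field_simps)

lemma half_power_deriv_even_part: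
  "p \<ge> 2 \<Longrightarrow> half_power_deriv p s + half_power_deriv p (- s) = (p - 1) * abs_pow s (p - 2)"
  by (cases "p = 2") (simp_all add: half_power_deriv_def field_simps, simp add: abs_pow_def)

lemma half_power_has_derivative:
  assumes "p \<ge> 2" shows "(half_power p has_real_derivative half_power_deriv p s) (at s)"
proof (cases "p = 2")
  case True
  then have "half_power p = (\<lambda>s. s / 2)" by (auto simp: half_power_def)
  then show ?thesis using True by (auto simp: half_power_deriv_def intro!: derivative_eq_intros)
next
  case False
  then have e: "half_power p = (\<lambda>s. (\<bar>s\<bar> powr (p - 1) + signed_pow s (p - 1)) / 2)" by (auto simp: half_power_def)
  have "((\<lambda>s. (\<bar>s\<bar> powr (p - 1) + signed_pow s (p - 1)) / 2) has_real_derivative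
     ((p - 1) * signed_pow s (p - 1 - 1) + (p - 1) * abs_pow s (p - 1 - 1)) / 2) (at s)"
    using assms False
    by (intro DERIV_cdivide DERIV_add abs_powr_has_derivative signed_pow_has_derivative) auto
  then show ?thesis using False unfolding e by (simp add: half_power_deriv_def algebra_simps)
qed

lemma half_power_deriv_bounds:
  assumes "p \<ge> 2" shows "0 \<le> half_power_deriv p s" "half_power_deriv p s \<le> (p - 1) * abs_pow s (p - 2)"
proof -
  have 1: "0 \<le> half_power_deriv p s" for s
    using abs_signed_pow_le[of s "p - 2"] assms by (auto simp: half_power_deriv_def)
  show "0 \<le> half_power_deriv p s" by (rule 1)
  show "half_power_deriv p s \<le> (p - 1) * abs_pow s (p - 2)"
    using 1[of "- s"] half_power_deriv_even_part[OF assms, of s] by simp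
qed

lemma half_power_deriv_mono:
  assumes "p \<ge> 2" "s \<le> t" shows "half_power_deriv p s \<le> half_power_deriv p t"
proof (cases "p = 2")
  case False
  then have p: "p > 2" using assms by simp
  have e: "signed_pow s (p - 2) + abs_pow s (p - 2) = 2 * (max 0 s) powr (p - 2)" for s
    using p by (auto simp: signed_pow_def abs_pow_def sgn_if max_def)
  have "max 0 s powr (p - 2) \<le> max 0 t powr (p - 2)" using assms p by (intro powr_mono2) auto
  then show ?thesis using p unfolding half_power_deriv_def e by simp
qed (simp add: half_power_deriv_def)

lemma half_power_continuous: "p \<ge> 2 \<Longrightarrow> continuous_on UNIV (half_power p)"
  using half_power_has_derivative by (meson DERIV_isCont continuous_at_imp_continuous_on)

lemma half_power_deriv_continuous: assumes "p \<ge> 2" shows "continuous_on UNIV (half_power_deriv p)"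
proof (cases "p = 2")
  case False
  then have p: "p > 2" using assms by simp
  have e: "half_power_deriv p = (\<lambda>s. (p - 1) * (max 0 s) powr (p - 2))"
    using p by (auto simp: half_power_deriv_def signed_pow_def abs_pow_def sgn_if max_def fun_eq_iff)
  show ?thesis unfolding e using p by (intro continuous_intros continuous_on_powr') auto
qed (simp add: half_power_deriv_def[abs_def])

lemma half_power_abs_le: "p \<ge> 2 \<Longrightarrow> \<bar>half_power p s\<bar> \<le> \<bar>s\<bar> powr (p - 1)"
  by (auto simp: half_power_def signed_pow_def abs_pow_def sgn_if)

definition gauge_const :: "real \<Rightarrow> real" where "gauge_const p = 2 * (p - 1) / convexity_const p"

text \<open>In the divergence of \<open>a * half_power p b\<close> only the mixed term
\<open>(z1 - w1) (half_power p z2 - half_power p w2)\<close> can be negative. It is at most a multiple of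
\<open>\<bar>z1 - w1\<bar> \<bar>z2 - w2\<bar> M\<^bsup>p-2\<^esup>\<close> with \<open>M = max \<bar>w2\<bar> \<bar>z2\<bar>\<close>. One power alone would not
absorb it: the divergence of \<open>\<bar>b\<bar>\<^sup>p\<close> does when \<open>\<bar>z2 - w2\<bar>\<close> is not much smaller than
\<open>\<bar>z1 - w1\<bar>\<close>, and otherwise one of the two slanted powers does.\<close>

definition gauge :: "real \<Rightarrow> real \<Rightarrow> real \<Rightarrow> real" where
  "gauge p a b = a * half_power p b + gauge_const p * (\<bar>b\<bar> powr p + \<bar>a + b\<bar> powr p + \<bar>a - b\<bar> powr p)"

definition gauge_D1 :: "real \<Rightarrow> real \<Rightarrow> real \<Rightarrow> real" where
  "gauge_D1 p a b = half_power p b + gauge_const p * p * (signed_pow (a + b) (p - 1) + signed_pow (a - b) (p - 1))"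

definition gauge_D2 :: "real \<Rightarrow> real \<Rightarrow> real \<Rightarrow> real" where
  "gauge_D2 p a b = a * half_power_deriv p b
     + gauge_const p * p * (signed_pow b (p - 1) + signed_pow (a + b) (p - 1) - signed_pow (a - b) (p - 1))"

lemma gauge_const_nonneg: "p \<ge> 2 \<Longrightarrow> gauge_const p \<ge> 0"
  using convexity_const_pos[of p] by (simp add: gauge_const_def)

lemma gauge_odd_part:
  assumes "p \<ge> 2" shows "gauge p a b - gauge p a (- b) = a * signed_pow b (p - 1)"
  unfolding gauge_def half_power_odd_part[OF assms, of b, symmetric] by (simp add: algebra_simps)

lemma bregman_codiv_polarization:
  assumes "p \<ge> 2"
  shows "bregman_codiv p (w1, w2) (z1, z2) =
     bregman (gauge p) (gauge_D1 p) (gauge_D2 p) w1 w2 z1 z2 -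
     bregman (gauge p) (gauge_D1 p) (gauge_D2 p) w1 (- w2) z1 (- z2)"
proof -
  note Y = gauge_odd_part[OF assms]
  have 1: "gauge_D1 p a b - gauge_D1 p a (- b) = signed_pow b (p - 1)" for a b
    using half_power_odd_part[OF assms, of b] unfolding gauge_D1_def by (simp add: add.commute)
  have 2: "gauge_D2 p a b + gauge_D2 p a (- b) = a * ((p - 1) * abs_pow b (p - 2))" for a b
    unfolding half_power_deriv_even_part[OF assms, of b, symmetric] gauge_D2_def by (simp add: algebra_simps)
  have "bregman (gauge p) (gauge_D1 p) (gauge_D2 p) w1 w2 z1 z2 -
     bregman (gauge p) (gauge_D1 p) (gauge_D2 p) w1 (- w2) z1 (- z2) =
     (gauge p z1 z2 - gauge p z1 (- z2)) - (gauge p w1 w2 - gauge p w1 (- w2))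
     - (gauge_D1 p w1 w2 - gauge_D1 p w1 (- w2)) * (z1 - w1)
     - (gauge_D2 p w1 w2 + gauge_D2 p w1 (- w2)) * (z2 - w2)"
    unfolding bregman_def by (simp add: algebra_simps)
  then show ?thesis unfolding Y 1 2 by (simp add: algebra_simps)
qed

text \<open>Convexity is established through the divergence and not through the Hessian, which is singular on the
axis \<open>b = 0\<close> for \<open>2 < p < 3\<close>. Of the three parts in the decomposition \<open>dec\<close>, the second is nonnegative because
\<open>half_power\<close> is convex and \<open>w1 \<ge> 0\<close>, and the third compensates the first.\<close>

lemma gauge_bregman_nonneg:
  assumes p: "p \<ge> 2" and w1: "w1 \<ge> 0"
  shows "bregman (gauge p) (gauge_D1 p) (gauge_D2 p) w1 w2 z1 z2 \<ge> 0"
proof -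
  define M where "M = max \<bar>w2\<bar> \<bar>z2\<bar>"
  define A where "A = abs_pow M (p - 2)"
  define k where "k = convexity_const p"
  have k: "k > 0" using convexity_const_pos[OF p] by (simp add: k_def)
  have A: "A \<ge> 0" by (simp add: A_def)
  define S where "S = bregman_power p w2 z2 + bregman_power p (w1 + w2) (z1 + z2) + bregman_power p (w1 - w2) (z1 - z2)"
  define R where "R = half_power p z2 - half_power p w2 - half_power_deriv p w2 * (z2 - w2)"
  have dec: "bregman (gauge p) (gauge_D1 p) (gauge_D2 p) w1 w2 z1 z2 =
     (z1 - w1) * (half_power p z2 - half_power p w2) + w1 * R + gauge_const p * S"
    unfolding bregman_def gauge_def gauge_D1_def gauge_D2_def S_def bregman_power_def R_def
    by (simp add: algebra_simps)
  have R: "R \<ge> 0" unfolding R_def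
    using bregman_of_convex_nonneg[of "half_power p" "half_power_deriv p"] half_power_has_derivative[OF p] half_power_deriv_mono[OF p] by blast
  have low: "bregman_power p a b \<ge> k * (b - a)\<^sup>2 * A" if "M \<le> max \<bar>a\<bar> \<bar>b\<bar>" for a b
    unfolding k_def A_def using that by (intro bregman_power_lower[OF p]) (auto simp: M_def)
  have nn: "bregman_power p a b \<ge> 0" for a b by (rule bregman_power_nonneg[OF p])
  have S: "S \<ge> k / 2 * (\<bar>z1 - w1\<bar> * \<bar>z2 - w2\<bar>) * A"
  proof (cases "\<bar>z1 - w1\<bar> \<le> 2 * \<bar>z2 - w2\<bar>")
    case True
    have "k / 2 * (\<bar>z1 - w1\<bar> * \<bar>z2 - w2\<bar>) * A \<le> k / 2 * (2 * \<bar>z2 - w2\<bar> * \<bar>z2 - w2\<bar>) * A"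
      using True k A by (intro mult_right_mono mult_left_mono) auto
    also have "\<dots> = k * (z2 - w2)\<^sup>2 * A" by (simp add: power2_eq_square)
    also have "\<dots> \<le> S" using low[of w2 z2] nn[of "w1 + w2" "z1 + z2"] nn[of "w1 - w2" "z1 - z2"]
      by (simp add: S_def M_def)
    finally show ?thesis .
  next
    case False
    define D where "D = \<bar>z1 - w1\<bar>"
    have sq: "x\<^sup>2 \<ge> D\<^sup>2 / 4" if "\<bar>x\<bar> \<ge> D / 2" for x
    proof -
      have "(D / 2)\<^sup>2 \<le> \<bar>x\<bar>\<^sup>2" using that by (intro power_mono) (auto simp: D_def)
      then show ?thesis by (simp add: power_divide)
    qed
    have "D \<le> \<bar>z1 + z2 - (w1 + w2)\<bar> + \<bar>z2 - w2\<bar>" "D \<le> \<bar>z1 - z2 - (w1 - w2)\<bar> + \<bar>z2 - w2\<bar>"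
      unfolding D_def by linarith+
    then have big: "D / 2 \<le> \<bar>z1 + z2 - (w1 + w2)\<bar>" "D / 2 \<le> \<bar>z1 - z2 - (w1 - w2)\<bar>"
      using False [[linarith_split_limit = 0]] unfolding D_def[symmetric] by linarith+
    have "D * (2 * \<bar>z2 - w2\<bar>) \<le> D * D" using False by (intro mult_left_mono) (auto simp: D_def)
    then have D2: "D * \<bar>z2 - w2\<bar> / 2 \<le> D\<^sup>2 / 4" by (simp add: power2_eq_square)
    \<comment> \<open>\<open>2 \<bar>w2\<bar> = \<bar>(w1 + w2) - (w1 - w2)\<bar>\<close>, and likewise for \<open>z2\<close>.\<close>
    have "M \<le> max \<bar>w1 + w2\<bar> \<bar>z1 + z2\<bar> \<or> M \<le> max \<bar>w1 - w2\<bar> \<bar>z1 - z2\<bar>"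
      unfolding M_def by linarith
    then have "S \<ge> k * (D\<^sup>2 / 4) * A"
    proof
      assume "M \<le> max \<bar>w1 + w2\<bar> \<bar>z1 + z2\<bar>"
      from low[OF this] have 1: "k * (z1 + z2 - (w1 + w2))\<^sup>2 * A \<le> bregman_power p (w1 + w2) (z1 + z2)" .
      have "k * (D\<^sup>2 / 4) * A \<le> k * (z1 + z2 - (w1 + w2))\<^sup>2 * A"
        using k A big by (intro mult_right_mono mult_left_mono sq) simp_all
      then show ?thesis using 1 nn[of w2 z2] nn[of "w1 - w2" "z1 - z2"] by (simp add: S_def)
    next
      assume "M \<le> max \<bar>w1 - w2\<bar> \<bar>z1 - z2\<bar>"
      from low[OF this] have 1: "k * (z1 - z2 - (w1 - w2))\<^sup>2 * A \<le> bregman_power p (w1 - w2) (z1 - z2)" .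
      have "k * (D\<^sup>2 / 4) * A \<le> k * (z1 - z2 - (w1 - w2))\<^sup>2 * A"
        using k A big by (intro mult_right_mono mult_left_mono sq) simp_all
      then show ?thesis using 1 nn[of w2 z2] nn[of "w1 + w2" "z1 + z2"] by (simp add: S_def)
    qed
    moreover have "k * (D * \<bar>z2 - w2\<bar> / 2) * A \<le> k * (D\<^sup>2 / 4) * A"
      using k A D2 by (intro mult_right_mono mult_left_mono) auto
    ultimately show ?thesis by (simp add: D_def algebra_simps)
  qed
  have lip: "\<bar>half_power p z2 - half_power p w2\<bar> \<le> (p - 1) * A * \<bar>z2 - w2\<bar>"
  proof -
    obtain \<xi> where x: "min w2 z2 \<le> \<xi>" "\<xi> \<le> max w2 z2" "half_power p z2 - half_power p w2 = half_power_deriv p \<xi> * (z2 - w2)"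
      using mvt_segment[OF half_power_has_derivative[OF p], of w2 z2] by blast
    have "\<bar>half_power_deriv p \<xi>\<bar> \<le> (p - 1) * abs_pow \<xi> (p - 2)"
      using half_power_deriv_bounds[OF p, of \<xi>] by simp
    also have "\<dots> \<le> (p - 1) * A" unfolding A_def
      using p x(1,2) by (intro mult_left_mono abs_pow_mono) (auto simp: M_def max_def min_def split: if_splits)
    finally show ?thesis unfolding x(3) abs_mult by (intro mult_right_mono) auto
  qed
  have "\<bar>(z1 - w1) * (half_power p z2 - half_power p w2)\<bar> \<le> \<bar>z1 - w1\<bar> * ((p - 1) * A * \<bar>z2 - w2\<bar>)"
    unfolding abs_mult by (intro mult_left_mono lip) auto
  also have "\<dots> = gauge_const p * (k / 2 * (\<bar>z1 - w1\<bar> * \<bar>z2 - w2\<bar>) * A)"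
    using k by (simp add: gauge_const_def k_def)
  also have "\<dots> \<le> gauge_const p * S" by (intro mult_left_mono S gauge_const_nonneg p)
  finally have "(z1 - w1) * (half_power p z2 - half_power p w2) + gauge_const p * S \<ge> 0" by linarith
  then show ?thesis unfolding dec using mult_nonneg_nonneg[OF w1 R] by linarith
qed

definition gauge_bound :: "real \<Rightarrow> real" where "gauge_bound p = p + 3 * p * gauge_const p"

lemma gauge_convex_gauge:
  assumes p: "p \<ge> 2"
  shows "convex_gauge (gauge p) (gauge_D1 p) (gauge_D2 p) p (gauge_bound p)"
proof
  note K = gauge_const_nonneg[OF p]
  have hp: "continuous_on UNIV (\<lambda>x::real\<times>real. half_power p (snd x))"
    using continuous_on_compose2[OF half_power_continuous[OF p], of UNIV snd] by (simp add: continuous_on_snd)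
  have hd: "continuous_on UNIV (\<lambda>x::real\<times>real. half_power_deriv p (snd x))"
    using continuous_on_compose2[OF half_power_deriv_continuous[OF p], of UNIV snd] by (simp add: continuous_on_snd)
  show "continuous_on UNIV (\<lambda>(a, b). gauge p a b)" unfolding gauge_def case_prod_unfold
    using p by (intro continuous_intros continuous_on_powr' hp) auto
  show "continuous_on UNIV (\<lambda>(a, b). gauge_D1 p a b)" unfolding gauge_D1_def case_prod_unfold
    using p by (intro continuous_intros hp) auto
  show "continuous_on UNIV (\<lambda>(a, b). gauge_D2 p a b)" unfolding gauge_D2_def case_prod_unfold
    using p by (intro continuous_intros hd) auto
  show "2 \<le> p" by (rule p)
  show "gauge_bound p \<ge> 0" using p K by (simp add: gauge_bound_def)
  show "bregman (gauge p) (gauge_D1 p) (gauge_D2 p) w1 w2 z1 z2 \<ge> 0" if "w1 \<ge> 0" for w1 w2 z1 z2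
    by (rule gauge_bregman_nonneg[OF p that])
  fix a b :: real
  define r where "r = \<bar>a\<bar> + \<bar>b\<bar>"
  have r: "r \<ge> 0" by (simp add: r_def)
  have rp: "r powr p = r * r powr (p - 1)" "r powr (p - 1) = r * abs_pow r (p - 2)"
    using r powr_mult_base[of r "p - 1"] powr_mult_base[of r "p - 2"] by (auto simp: abs_pow_def)
  have pw: "\<bar>s\<bar> powr q \<le> r powr q" if "\<bar>s\<bar> \<le> r" "q > 0" for s q
    using that by (intro powr_mono2) auto
  have sp: "\<bar>signed_pow s (p - 1)\<bar> \<le> r powr (p - 1)" if "\<bar>s\<bar> \<le> r" for s
    using abs_signed_pow_le[of s "p - 1"] pw[OF that, of "p - 1"] p by (simp add: abs_pow_def)
  have hp: "\<bar>half_power p b\<bar> \<le> r powr (p - 1)"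
    using half_power_abs_le[OF p, of b] pw[of b "p - 1"] p by (simp add: r_def)
  have le: "\<bar>a\<bar> \<le> r" "\<bar>b\<bar> \<le> r" "\<bar>a + b\<bar> \<le> r" "\<bar>a - b\<bar> \<le> r" by (auto simp: r_def)
  have hd: "\<bar>a * half_power_deriv p b\<bar> \<le> (p - 1) * r powr (p - 1)"
  proof -
    have "\<bar>a * half_power_deriv p b\<bar> \<le> r * ((p - 1) * abs_pow r (p - 2))"
      unfolding abs_mult
      using half_power_deriv_bounds[OF p, of b] abs_pow_mono[of "p - 2" b r] le p r
      by (intro mult_mono) (auto intro: order_trans[OF _ mult_left_mono[of _ _ "p - 1"]])
    then show ?thesis unfolding rp(2) by (simp add: algebra_simps)
  qed
  have fin: "x + gauge_const p * y \<le> gauge_bound p * z" if "x \<le> p * z" "y \<le> 3 * p * z" for x y z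
    using that mult_left_mono[OF that(2) K] by (simp add: gauge_bound_def algebra_simps)
  have "\<bar>gauge p a b\<bar> \<le> \<bar>a\<bar> * \<bar>half_power p b\<bar> + gauge_const p * (\<bar>b\<bar> powr p + \<bar>a + b\<bar> powr p + \<bar>a - b\<bar> powr p)"
    unfolding gauge_def using K by (intro order_trans[OF abs_triangle_ineq]) (auto simp: abs_mult)
  also have "\<dots> \<le> gauge_bound p * r powr p"
  proof (rule fin)
    have "\<bar>a\<bar> * \<bar>half_power p b\<bar> \<le> r * r powr (p - 1)" using le hp r by (intro mult_mono) auto
    also have "\<dots> \<le> p * r powr p" unfolding rp(1)[symmetric] using p by (simp add: mult_le_cancel_right1)
    finally show "\<bar>a\<bar> * \<bar>half_power p b\<bar> \<le> p * r powr p" .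
    have "\<bar>b\<bar> powr p + \<bar>a + b\<bar> powr p + \<bar>a - b\<bar> powr p \<le> 3 * r powr p"
      using pw[OF le(2), of p] pw[OF le(3), of p] pw[OF le(4), of p] p by simp
    also have "\<dots> \<le> 3 * p * r powr p" using p by (simp add: mult_le_cancel_right1)
    finally show "\<bar>b\<bar> powr p + \<bar>a + b\<bar> powr p + \<bar>a - b\<bar> powr p \<le> 3 * p * r powr p" .
  qed
  finally show "\<bar>gauge p a b\<bar> \<le> gauge_bound p * (\<bar>a\<bar> + \<bar>b\<bar>) powr p" by (simp add: r_def)
  define v where "v = r powr (p - 1)"
  have v: "v \<ge> 0" by (simp add: v_def)
  have pv: "p * v \<ge> v" using p v by (simp add: mult_le_cancel_right1)
  have "\<bar>gauge_D1 p a b\<bar> \<le> \<bar>half_power p b\<bar> + gauge_const p * (p * (\<bar>signed_pow (a + b) (p - 1)\<bar> + \<bar>signed_pow (a - b) (p - 1)\<bar>))"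
    unfolding gauge_D1_def using K p
    by (intro order_trans[OF abs_triangle_ineq]) (auto simp: abs_mult mult.assoc intro!: mult_left_mono)
  also have "\<dots> \<le> gauge_bound p * v"
  proof (rule fin)
    show "\<bar>half_power p b\<bar> \<le> p * v" using hp pv by (simp add: v_def)
    have "p * (\<bar>signed_pow (a + b) (p - 1)\<bar> + \<bar>signed_pow (a - b) (p - 1)\<bar>) \<le> p * (3 * v)"
      using sp[OF le(3)] sp[OF le(4)] p v by (intro mult_left_mono) (auto simp: v_def)
    then show "p * (\<bar>signed_pow (a + b) (p - 1)\<bar> + \<bar>signed_pow (a - b) (p - 1)\<bar>) \<le> 3 * p * v"
      by (simp add: algebra_simps)
  qed
  finally show "\<bar>gauge_D1 p a b\<bar> \<le> gauge_bound p * (\<bar>a\<bar> + \<bar>b\<bar>) powr (p - 1)" by (simp add: r_def v_def)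
  have "\<bar>gauge_D2 p a b\<bar> \<le> \<bar>a * half_power_deriv p b\<bar> + gauge_const p * (p * (\<bar>signed_pow b (p - 1)\<bar> + \<bar>signed_pow (a + b) (p - 1)\<bar> + \<bar>signed_pow (a - b) (p - 1)\<bar>))"
    unfolding gauge_D2_def using K p
    by (intro order_trans[OF abs_triangle_ineq]) (auto simp: abs_mult mult.assoc intro!: mult_left_mono)
  also have "\<dots> \<le> gauge_bound p * v"
  proof (rule fin)
    show "\<bar>a * half_power_deriv p b\<bar> \<le> p * v" using hd v unfolding v_def[symmetric] by (simp add: left_diff_distrib)
    have "p * (\<bar>signed_pow b (p - 1)\<bar> + \<bar>signed_pow (a + b) (p - 1)\<bar> + \<bar>signed_pow (a - b) (p - 1)\<bar>) \<le> p * (3 * v)"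
      using sp[OF le(2)] sp[OF le(3)] sp[OF le(4)] p by (intro mult_left_mono) (auto simp: v_def)
    then show "p * (\<bar>signed_pow b (p - 1)\<bar> + \<bar>signed_pow (a + b) (p - 1)\<bar> + \<bar>signed_pow (a - b) (p - 1)\<bar>) \<le> 3 * p * v"
      by (simp add: algebra_simps)
  qed
  finally show "\<bar>gauge_D2 p a b\<bar> \<le> gauge_bound p * (\<bar>a\<bar> + \<bar>b\<bar>) powr (p - 1)" by (simp add: r_def v_def)
qed

section \<open>Approximation and translation in \<open>L\<^sup>p\<close>\<close>

lemma nn_integral_lborel_shift:
  fixes f :: "'a::euclidean_space \<Rightarrow> ennreal"
  assumes [measurable]: "f \<in> borel_measurable borel"
  shows "(\<integral>\<^sup>+y. f (y - x) \<partial>lborel) = (\<integral>\<^sup>+y. f y \<partial>lborel)"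
proof -
  have "(\<integral>\<^sup>+y. f y \<partial>lborel) = (\<integral>\<^sup>+y. f y \<partial>distr lborel borel ((+) (- x)))"
    by (simp only: lborel_distr_plus)
  also have "\<dots> = (\<integral>\<^sup>+y. f (- x + y) \<partial>lborel)"
    by (rule nn_integral_distr) auto
  finally show ?thesis by simp
qed

lemma abs_add_powr_le:
  fixes a b :: real
  assumes "p \<ge> 0"
  shows "\<bar>a + b\<bar> powr p \<le> 2 powr p * (\<bar>a\<bar> powr p + \<bar>b\<bar> powr p)"
proof -
  have "\<bar>a + b\<bar> powr p \<le> (2 * max \<bar>a\<bar> \<bar>b\<bar>) powr p" using assms by (intro powr_mono2) auto
  also have "\<dots> = 2 powr p * (max \<bar>a\<bar> \<bar>b\<bar>) powr p" by (simp add: powr_mult)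
  also have "\<dots> \<le> 2 powr p * (\<bar>a\<bar> powr p + \<bar>b\<bar> powr p)" by (intro mult_left_mono) (auto simp: max_def)
  finally show ?thesis .
qed

text \<open>This crude bound replaces Hoelder's inequality below: a function in \<open>L\<^sup>p\<close> is integrable against every
bounded integrable kernel, and no conjugate exponent is needed.\<close>

lemma abs_le_1_plus_powr: "p \<ge> 1 \<Longrightarrow> \<bar>a::real\<bar> \<le> 1 + \<bar>a\<bar> powr p"
  using powr_mono[of 1 p "\<bar>a\<bar>"] powr_ge_zero[of "\<bar>a\<bar>" p]
  by (cases "\<bar>a\<bar> \<le> 1") (auto simp del: powr_ge_zero)

lemma Lp_fun_measurable [measurable_dest]: "Lp_fun p f \<Longrightarrow> f \<in> borel_measurable borel"
  by (simp add: Lp_fun_def)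

lemma Lp_fun_integrable: "Lp_fun p f \<Longrightarrow> integrable lborel (\<lambda>x. \<bar>f x\<bar> powr p)"
  by (simp add: Lp_fun_def)

lemma Lp_fun_mono:
  assumes "Lp_fun p g" "p \<ge> 0" "f \<in> borel_measurable borel" "\<And>x. \<bar>f x\<bar> \<le> \<bar>g x\<bar>"
  shows "Lp_fun p f"
  unfolding Lp_fun_def using assms
  by (auto intro!: Bochner_Integration.integrable_bound[OF Lp_fun_integrable[OF assms(1)]] powr_mono2 AE_I2)

lemma Lp_fun_add:
  assumes "Lp_fun p f" "Lp_fun p g" "p \<ge> 0" shows "Lp_fun p (\<lambda>x. f x + g x)"
  unfolding Lp_fun_def
proof
  have [measurable]: "f \<in> borel_measurable borel" "g \<in> borel_measurable borel" using assms by auto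
  show "(\<lambda>x. f x + g x) \<in> borel_measurable borel" by simp
  show "integrable lborel (\<lambda>x. \<bar>f x + g x\<bar> powr p)"
  proof (rule Bochner_Integration.integrable_bound)
    show "integrable lborel (\<lambda>x. 2 powr p * (\<bar>f x\<bar> powr p + \<bar>g x\<bar> powr p))"
      using assms by (auto dest!: Lp_fun_integrable)
  qed (use abs_add_powr_le[OF assms(3)] in \<open>auto intro!: AE_I2\<close>)
qed

lemma Lp_fun_scale:
  assumes "Lp_fun p f" shows "Lp_fun p (\<lambda>x. a * f x)"
  using assms unfolding Lp_fun_def by (auto simp: abs_mult powr_mult)

lemma Lp_fun_minus: "Lp_fun p f \<Longrightarrow> Lp_fun p (\<lambda>x. - f x)"
  using Lp_fun_scale[of p f "-1"] by simp

lemma Lp_fun_diff: "Lp_fun p f \<Longrightarrow> Lp_fun p g \<Longrightarrow> p \<ge> 0 \<Longrightarrow> Lp_fun p (\<lambda>x. f x - g x)"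
  using Lp_fun_add[of p f "\<lambda>x. - g x"] Lp_fun_minus[of p g] by simp

lemma Lp_fun_indicator:
  assumes [measurable]: "A \<in> sets borel" and "emeasure lborel A < \<infinity>" "p > 0"
  shows "Lp_fun p (indicator A)"
proof -
  have "(\<lambda>x. \<bar>indicator A x :: real\<bar> powr p) = indicator A"
    using assms(3) by (auto simp: indicator_def fun_eq_iff)
  then show ?thesis unfolding Lp_fun_def using assms by simp
qed

text \<open>Density of simple functions in \<open>L\<^sup>p\<close>, as an induction principle.\<close>

lemma Lp_fun_induct [consumes 2, case_names indicator add scale lim]:
  assumes f: "Lp_fun p f" and p: "p > 0"
    and indicator: "\<And>A. A \<in> sets borel \<Longrightarrow> emeasure lborel A < \<infinity> \<Longrightarrow> Q (indicator A)"
    and add: "\<And>f g. Lp_fun p f \<Longrightarrow> Lp_fun p g \<Longrightarrow> Q f \<Longrightarrow> Q g \<Longrightarrow> Q (\<lambda>x. f x + g x)"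
    and scale: "\<And>f a. Lp_fun p f \<Longrightarrow> Q f \<Longrightarrow> Q (\<lambda>x. a * f x)"
    and lim: "\<And>f F. Lp_fun p f \<Longrightarrow> (\<And>n. Lp_fun p (F n)) \<Longrightarrow> (\<And>n. Q (F n)) \<Longrightarrow>
       (\<lambda>n. \<integral>x. \<bar>F n x - f x\<bar> powr p \<partial>lborel) \<longlonglongrightarrow> 0 \<Longrightarrow> Q f"
  shows "Q (f :: 'a::euclidean_space \<Rightarrow> real)"
proof -
  have f_meas[measurable]: "f \<in> borel_measurable lborel" using f by (simp add: Lp_fun_def)
  from borel_measurable_implies_sequence_metric[OF f_meas, of 0]
  obtain F where F: "\<And>i. simple_function lborel (F i)" "\<And>x. (\<lambda>i. F i x) \<longlonglongrightarrow> f x"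
     "\<And>i x. \<bar>F i x\<bar> \<le> 2 * \<bar>f x\<bar>" by auto
  have F_meas[measurable]: "F i \<in> borel_measurable borel" for i
    using borel_measurable_simple_function[OF F(1)] by simp
  have F_Lp: "Lp_fun p (F i)" for i
    by (rule Lp_fun_mono[OF Lp_fun_scale[OF f, of 2]]) (use p F(3) in \<open>auto simp: abs_mult\<close>)
  have Q0: "Lp_fun p (\<lambda>x::'a. 0)" "Q (\<lambda>x. 0)"
    using scale[OF Lp_fun_indicator[of "{}" p] indicator[of "{}"], of 0] Lp_fun_scale[OF Lp_fun_indicator[of "{}" p], of 0] p
    by auto
  have sum: "finite I \<Longrightarrow> (\<And>i. i \<in> I \<Longrightarrow> Lp_fun p (h i) \<and> Q (h i)) \<Longrightarrow>
     Lp_fun p (\<lambda>x. \<Sum>i\<in>I. h i x) \<and> Q (\<lambda>x. \<Sum>i\<in>I. h i x)" for I :: "real set" and h :: "real \<Rightarrow> 'a \<Rightarrow> real"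
    by (induction I rule: finite_induct) (use Q0 p in \<open>auto intro!: add Lp_fun_add\<close>)
  have QF: "Q (F n)" for n
  proof -
    let ?A = "\<lambda>v. F n -` {v}"
    have "Lp_fun p (\<lambda>x. v * indicator (?A v) x) \<and> Q (\<lambda>x. v * indicator (?A v) x)" if "v \<noteq> 0" for v
    proof -
      have A[measurable]: "?A v \<in> sets borel"
        using measurable_sets[OF F_meas[of n], of "{v}"] by simp
      have "integrable lborel (\<lambda>x. \<bar>v\<bar> powr p * indicator (?A v) x :: real)"
        by (rule Bochner_Integration.integrable_bound[OF Lp_fun_integrable[OF F_Lp[of n]]])
           (auto simp: indicator_def)
      then have "integrable lborel (indicator (?A v) :: 'a \<Rightarrow> real)"
        using that by simp
      then have "emeasure lborel (?A v) < \<infinity>" by (simp add: integrable_indicator_iff)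
      then show ?thesis using A p by (intro conjI scale Lp_fun_scale indicator Lp_fun_indicator) auto
    qed
    then have "Q (\<lambda>x. \<Sum>v\<in>range (F n) - {0}. v * indicator (?A v) x)"
      using simple_functionD(1)[OF F(1)[of n]] by (intro sum[THEN conjunct2]) auto
    moreover have "(\<Sum>v\<in>range (F n) - {0}. v * indicator (?A v) x) = F n x" for x
    proof -
      have fin: "finite (range (F n))" using simple_functionD(1)[OF F(1)[of n]] by simp
      have "(\<Sum>v\<in>range (F n) - {0}. v * indicator (?A v) x) = (\<Sum>v\<in>range (F n) - {0}. if v = F n x then v else 0)"
        by (intro sum.cong) (auto simp: indicator_def)
      also have "\<dots> = F n x" using fin by simp
      finally show ?thesis .
    qed
    ultimately show ?thesis by simp
  qed
  have "(\<lambda>n. \<integral>x. \<bar>F n x - f x\<bar> powr p \<partial>lborel) \<longlonglongrightarrow> integral\<^sup>L lborel (\<lambda>x::'a. 0)"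
  proof (rule integral_dominated_convergence)
    show "integrable lborel (\<lambda>x. \<bar>3 * f x\<bar> powr p)" by (rule Lp_fun_integrable[OF Lp_fun_scale[OF f]])
    show "AE x in lborel. (\<lambda>n. \<bar>F n x - f x\<bar> powr p) \<longlonglongrightarrow> 0"
    proof (rule AE_I2)
      fix x
      have "(\<lambda>n. \<bar>F n x - f x\<bar>) \<longlonglongrightarrow> 0" using F(2)[of x] by (simp add: LIM_zero tendsto_rabs_zero)
      then show "(\<lambda>n. \<bar>F n x - f x\<bar> powr p) \<longlonglongrightarrow> 0"
        using p tendsto_powr'[of "\<lambda>n. \<bar>F n x - f x\<bar>" 0 sequentially "\<lambda>_. p" p] by simp
    qed
    have "\<bar>F n x - f x\<bar> \<le> \<bar>3 * f x\<bar>" for n x using F(3)[of n x] by linarith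
    then show "AE x in lborel. norm (\<bar>F n x - f x\<bar> powr p) \<le> \<bar>3 * f x\<bar> powr p" for n
      using p by (auto intro!: AE_I2 powr_mono2)
  qed auto
  then show ?thesis by (intro lim[OF f F_Lp QF]) simp
qed

lemma integrable_lborel_shift:
  fixes f :: "'a::euclidean_space \<Rightarrow> real"
  assumes "integrable lborel f" shows "integrable lborel (\<lambda>y. f (y - x))"
proof -
  have [measurable]: "f \<in> borel_measurable borel" using assms by auto
  show ?thesis using assms nn_integral_lborel_shift[of "\<lambda>y. ennreal (norm (f y))" x]
    by (simp add: integrable_iff_bounded)
qed

text \<open>The Banach--Steinhaus argument: uniformly bounded operators that tend strongly to zero on a dense
set tend strongly to zero. It serves both for \<open>P h - 1\<close> with \<open>h \<rightarrow> 0\<close> and for \<open>P t\<close> with \<open>t \<rightarrow> \<infinity>\<close>.\<close>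

lemma Lp_operators_vanish:
  fixes T :: "nat \<Rightarrow> ('a::euclidean_space \<Rightarrow> real) \<Rightarrow> 'a \<Rightarrow> real"
  assumes f: "Lp_fun p f" and p: "p > 0"
    and T_Lp: "\<And>n f. Lp_fun p f \<Longrightarrow> Lp_fun p (T n f)"
    and T_add: "\<And>n f g x. Lp_fun p f \<Longrightarrow> Lp_fun p g \<Longrightarrow> T n (\<lambda>x. f x + g x) x = T n f x + T n g x"
    and T_scale: "\<And>n f a x. T n (\<lambda>x. a * f x) x = a * T n f x"
    and T_bound: "\<And>n f. Lp_fun p f \<Longrightarrow> (\<integral>x. \<bar>T n f x\<bar> powr p \<partial>lborel) \<le> K * (\<integral>x. \<bar>f x\<bar> powr p \<partial>lborel)"
    and T_ind: "\<And>A. A \<in> sets borel \<Longrightarrow> emeasure lborel A < \<infinity> \<Longrightarrow>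
       (\<lambda>n. \<integral>x. \<bar>T n (indicator A) x\<bar> powr p \<partial>lborel) \<longlonglongrightarrow> 0"
  shows "(\<lambda>n. \<integral>x. \<bar>T n f x\<bar> powr p \<partial>lborel) \<longlonglongrightarrow> 0"
proof -
  have sum_bound: "(\<integral>x. \<bar>T n (\<lambda>x. f x + g x) x\<bar> powr p \<partial>lborel) \<le>
      2 powr p * ((\<integral>x. \<bar>T n f x\<bar> powr p \<partial>lborel) + (\<integral>x. \<bar>T n g x\<bar> powr p \<partial>lborel))"
    if [simp]: "Lp_fun p f" "Lp_fun p g" for n f g
  proof -
    have "(\<integral>x. \<bar>T n (\<lambda>x. f x + g x) x\<bar> powr p \<partial>lborel) \<le> (\<integral>x. 2 powr p * (\<bar>T n f x\<bar> powr p + \<bar>T n g x\<bar> powr p) \<partial>lborel)"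
      using p abs_add_powr_le[of p]
      by (intro integral_mono integrable_mult_right Bochner_Integration.integrable_add Lp_fun_integrable T_Lp Lp_fun_add)
         (auto simp: T_add)
    then show ?thesis
      by (simp add: Lp_fun_integrable[OF T_Lp])
  qed
  show ?thesis using f p
  proof (induction rule: Lp_fun_induct)
    case (add f g)
    have "(\<lambda>n. 2 powr p * ((\<integral>x. \<bar>T n f x\<bar> powr p \<partial>lborel) + (\<integral>x. \<bar>T n g x\<bar> powr p \<partial>lborel))) \<longlonglongrightarrow> 2 powr p * (0 + 0)"
      using add by (intro tendsto_intros)
    then have "(\<lambda>n. 2 powr p * ((\<integral>x. \<bar>T n f x\<bar> powr p \<partial>lborel) + (\<integral>x. \<bar>T n g x\<bar> powr p \<partial>lborel))) \<longlonglongrightarrow> 0" by simp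
    then show ?case
      by (rule tendsto_sandwich[OF _ _ tendsto_const, rotated 2])
         (use sum_bound[OF add(1,2)] in \<open>auto intro!: always_eventually\<close>)
  next
    case (scale f a)
    have "(\<lambda>n. \<bar>a\<bar> powr p * (\<integral>x. \<bar>T n f x\<bar> powr p \<partial>lborel)) \<longlonglongrightarrow> \<bar>a\<bar> powr p * 0"
      using scale by (intro tendsto_intros)
    then show ?case by (simp add: T_scale abs_mult powr_mult)
  next
    case (lim f F)
    define N where "N m = (\<integral>x. \<bar>F m x - f x\<bar> powr p \<partial>lborel)" for m
    have N: "N \<longlonglongrightarrow> 0" using lim(3) by (simp add: N_def[abs_def])
    have le: "(\<integral>x. \<bar>T n f x\<bar> powr p \<partial>lborel) \<le> 2 powr p * (\<integral>x. \<bar>T n (F m) x\<bar> powr p \<partial>lborel) + 2 powr p * (K * N m)" for n m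
    proof -
      have d: "Lp_fun p (\<lambda>x. f x - F m x)" using lim(1,2) p by (intro Lp_fun_diff) auto
      have "2 powr p * (\<integral>x. \<bar>T n (\<lambda>x. f x - F m x) x\<bar> powr p \<partial>lborel) \<le> 2 powr p * (K * N m)"
        using T_bound[OF d, of n] unfolding N_def abs_minus_commute[of "f _"] by (intro mult_left_mono) auto
      moreover have "(\<integral>x. \<bar>T n f x\<bar> powr p \<partial>lborel) \<le> 2 powr p * ((\<integral>x. \<bar>T n (F m) x\<bar> powr p \<partial>lborel) + (\<integral>x. \<bar>T n (\<lambda>x. f x - F m x) x\<bar> powr p \<partial>lborel))"
        using sum_bound[OF lim(2)[of m] d, of n] by simp
      ultimately show ?thesis unfolding distrib_left by linarith
    qed
    show ?case
    proof (rule order_tendstoI)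
      fix a :: real assume "a < 0"
      then show "\<forall>\<^sub>F n in sequentially. a < (\<integral>x. \<bar>T n f x\<bar> powr p \<partial>lborel)"
        by (intro always_eventually allI) (rule less_le_trans, auto)
    next
      fix a :: real assume a: "0 < a"
      have "(\<lambda>m. 2 powr p * (K * N m)) \<longlonglongrightarrow> 2 powr p * (K * 0)" by (intro tendsto_intros N)
      from order_tendstoD(2)[OF this, of "a / 2"]
      have "\<forall>\<^sub>F m in sequentially. 2 powr p * (K * N m) < a / 2"
        using a by simp
      then obtain m where m: "2 powr p * (K * N m) < a / 2" by (auto simp: eventually_sequentially)
      have "(\<lambda>n. 2 powr p * (\<integral>x. \<bar>T n (F m) x\<bar> powr p \<partial>lborel)) \<longlonglongrightarrow> 2 powr p * 0"
        by (intro tendsto_intros lim)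
      from order_tendstoD(2)[OF this, of "a / 2"] have "\<forall>\<^sub>F n in sequentially. 2 powr p * (\<integral>x. \<bar>T n (F m) x\<bar> powr p \<partial>lborel) < a / 2"
        using a by simp
      then show "\<forall>\<^sub>F n in sequentially. (\<integral>x. \<bar>T n f x\<bar> powr p \<partial>lborel) < a"
      proof eventually_elim
        case (elim n)
        with m le[of n m] show ?case by linarith
      qed
    qed
  qed (rule T_ind)
qed

section \<open>Semigroups with a kernel dominated by the Levy density\<close>

definition kernel_op :: "(real \<Rightarrow> 'a::euclidean_space \<Rightarrow> real) \<Rightarrow> real \<Rightarrow> ('a \<Rightarrow> real) \<Rightarrow> 'a \<Rightarrow> real" where
  "kernel_op k t f x = (if t = 0 then f x else (LINT y|lborel. f y * k t (y - x)))"

locale levy_density =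
  fixes \<nu> :: "'a::euclidean_space \<Rightarrow> real"
  assumes \<nu>_meas: "\<nu> \<in> borel_measurable borel"
    and \<nu>_pos: "x \<noteq> 0 \<Longrightarrow> \<nu> x > 0"
    and \<nu>_levy: "integrable lborel (\<lambda>z. min ((norm z)\<^sup>2) 1 * \<nu> z)"
begin

declare \<nu>_meas [measurable]

lemma \<nu>_away_integrable:
  assumes "\<delta> > 0" shows "integrable lborel (\<lambda>z. indicator {z. norm z \<ge> \<delta>} z * \<nu> z)"
proof (rule Bochner_Integration.integrable_bound)
  show "integrable lborel (\<lambda>z. (1 / min (\<delta>\<^sup>2) 1) * (min ((norm z)\<^sup>2) 1 * \<nu> z))"
    by (intro integrable_mult_right \<nu>_levy)
  show "AE z in lborel. norm (indicator {z. norm z \<ge> \<delta>} z * \<nu> z) \<le> norm ((1 / min (\<delta>\<^sup>2) 1) * (min ((norm z)\<^sup>2) 1 * \<nu> z))"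
  proof (rule AE_I2)
    fix z :: 'a
    have m: "min (\<delta>\<^sup>2) 1 > 0" using assms by simp
    show "norm (indicator {z. norm z \<ge> \<delta>} z * \<nu> z) \<le> norm ((1 / min (\<delta>\<^sup>2) 1) * (min ((norm z)\<^sup>2) 1 * \<nu> z))"
    proof (cases "norm z \<ge> \<delta>")
      case True
      have "min (\<delta>\<^sup>2) 1 \<le> min ((norm z)\<^sup>2) 1" using True assms by (intro min.mono power_mono) auto
      then have "1 \<le> (1 / min (\<delta>\<^sup>2) 1) * min ((norm z)\<^sup>2) 1" using m by (simp add: field_simps)
      then have "1 * \<bar>\<nu> z\<bar> \<le> (1 / min (\<delta>\<^sup>2) 1) * min ((norm z)\<^sup>2) 1 * \<bar>\<nu> z\<bar>" by (intro mult_right_mono) auto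
      then show ?thesis using True m by (simp add: abs_mult)
    qed simp
  qed
qed measurable

end

text \<open>The properties of the heat kernel on which the identity rests. Continuity in time is asked for from
the right, where the Fourier integrals are dominated by the one at time \<open>t\<close>.\<close>

locale levy_kernel = levy_density \<nu>
  for k :: "real \<Rightarrow> 'a::euclidean_space \<Rightarrow> real" and \<nu> :: "'a \<Rightarrow> real" and c :: real +
  assumes k_meas: "(\<lambda>(t, x). k t x) \<in> borel_measurable (borel \<Otimes>\<^sub>M borel)"
    and k_nonneg: "t > 0 \<Longrightarrow> k t x \<ge> 0"
    and k_even: "k t (- x) = k t x"
    and k_mass: "t > 0 \<Longrightarrow> (\<integral>\<^sup>+x. ennreal (k t x) \<partial>lborel) = 1"
    and k_conv: "s > 0 \<Longrightarrow> t > 0 \<Longrightarrow> (\<integral>\<^sup>+y. ennreal (k s (y - x)) * ennreal (k t (z - y)) \<partial>lborel) = ennreal (k (s + t) (z - x))"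
    and k_le_0: "t > 0 \<Longrightarrow> k t x \<le> k t 0"
    and k_0_mono: "0 < s \<Longrightarrow> s \<le> t \<Longrightarrow> k t 0 \<le> k s 0"
    and k_0_lim: "((\<lambda>t. k t 0) \<longlongrightarrow> 0) at_top"
    and k_cont: "t > 0 \<Longrightarrow> X \<longlonglongrightarrow> t \<Longrightarrow> (\<And>n. t \<le> X n) \<Longrightarrow> (\<lambda>n. k (X n) x) \<longlonglongrightarrow> k t x"
    and k_bound: "t > 0 \<Longrightarrow> x \<noteq> 0 \<Longrightarrow> k t x / t \<le> c * \<nu> x"
    and k_limit: "x \<noteq> 0 \<Longrightarrow> ((\<lambda>t. k t x / t) \<longlongrightarrow> \<nu> x) (at_right 0)"
begin

abbreviation P :: "real \<Rightarrow> ('a \<Rightarrow> real) \<Rightarrow> 'a \<Rightarrow> real" where "P \<equiv> kernel_op k"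

lemma k_meas' [measurable (raw)]:
  assumes [measurable]: "f \<in> borel_measurable M" "g \<in> borel_measurable M"
  shows "(\<lambda>x. k (f x) (g x)) \<in> borel_measurable M"
  using measurable_compose[OF measurable_Pair[OF assms] k_meas] by simp

lemma k_sym: "k t (x - y) = k t (y - x)"
  using k_even[of t "x - y"] by simp

lemma nn_integral_k: "t > 0 \<Longrightarrow> (\<integral>\<^sup>+y. ennreal (k t (y - x)) \<partial>lborel) = 1"
  using nn_integral_lborel_shift[of "\<lambda>y. ennreal (k t y)" x] k_mass by simp

lemma nn_integral_k': "t > 0 \<Longrightarrow> (\<integral>\<^sup>+y. ennreal (k t (x - y)) \<partial>lborel) = 1"
  using nn_integral_k[of t x] by (simp add: k_sym[of t x])

lemma integrable_k: "t > 0 \<Longrightarrow> integrable lborel (\<lambda>y. k t (y - x))"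
  using nn_integral_k k_nonneg by (intro integrableI_nonneg) auto

lemma integral_k: assumes "t > 0" shows "(LINT y|lborel. k t (y - x)) = 1"
  using nn_integral_k[OF assms, of x] k_nonneg[OF assms] by (subst integral_eq_nn_integral) auto

lemma integral_k': "t > 0 \<Longrightarrow> (LINT y|lborel. k t (x - y)) = 1"
  using integral_k[of t x] by (simp add: k_sym[of t x])

lemma integrable_times_k:
  assumes "t > 0" "integrable lborel f"
  shows "integrable lborel (\<lambda>y. f y * k t (y - x))"
proof (rule Bochner_Integration.integrable_bound)
  show "integrable lborel (\<lambda>y. f y * k t 0)" using assms by simp
  have [measurable]: "f \<in> borel_measurable borel" using assms by auto
  show "(\<lambda>y. f y * k t (y - x)) \<in> borel_measurable lborel" by simp
  show "AE y in lborel. norm (f y * k t (y - x)) \<le> norm (f y * k t 0)"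
    using k_le_0[OF assms(1)] k_nonneg[OF assms(1)] by (auto simp: abs_mult intro!: AE_I2 mult_left_mono)
qed

lemma Lp_integrable_times_k:
  assumes "p \<ge> 1" "Lp_fun p f" "t > 0"
  shows "integrable lborel (\<lambda>y. f y * k t (y - x))"
proof (rule Bochner_Integration.integrable_bound)
  show "integrable lborel (\<lambda>y. k t (y - x) + \<bar>f y\<bar> powr p * k t (y - x))"
    using assms by (intro Bochner_Integration.integrable_add integrable_k integrable_times_k Lp_fun_integrable)
  have [measurable]: "f \<in> borel_measurable borel" using assms by auto
  show "(\<lambda>y. f y * k t (y - x)) \<in> borel_measurable lborel" by simp
  show "AE y in lborel. norm (f y * k t (y - x)) \<le> norm (k t (y - x) + \<bar>f y\<bar> powr p * k t (y - x))"
  proof (rule AE_I2)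
    fix y
    have "\<bar>f y\<bar> * k t (y - x) \<le> (1 + \<bar>f y\<bar> powr p) * k t (y - x)"
      using assms k_nonneg by (intro mult_right_mono abs_le_1_plus_powr) auto
    then show "norm (f y * k t (y - x)) \<le> norm (k t (y - x) + \<bar>f y\<bar> powr p * k t (y - x))"
      using k_nonneg[OF assms(3)] by (simp add: abs_mult algebra_simps)
  qed
qed

lemma P_0 [simp]: "P 0 f = f" by (auto simp: kernel_op_def)

lemma P_pos_time: "t > 0 \<Longrightarrow> P t f x = (LINT y|lborel. f y * k t (y - x))"
  by (simp add: kernel_op_def)

lemma P_joint_meas [measurable (raw)]:
  assumes [measurable]: "f \<in> borel_measurable borel" "h \<in> borel_measurable M" "g \<in> borel_measurable M"
  shows "(\<lambda>x. P (h x) f (g x)) \<in> borel_measurable M"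
  unfolding kernel_op_def by measurable

lemma P_nonneg: "t \<ge> 0 \<Longrightarrow> (\<And>x. f x \<ge> 0) \<Longrightarrow> P t f x \<ge> 0"
  by (auto simp: kernel_op_def k_nonneg intro!: Bochner_Integration.integral_nonneg)

lemma P_add:
  assumes "p \<ge> 1" "Lp_fun p f" "Lp_fun p g" "t \<ge> 0"
  shows "P t (\<lambda>x. f x + g x) x = P t f x + P t g x"
  using Lp_integrable_times_k[OF assms(1,2), of t x] Lp_integrable_times_k[OF assms(1,3), of t x] assms(4)
  by (auto simp: kernel_op_def distrib_right)

lemma P_scale: "P t (\<lambda>x. a * f x) x = a * P t f x"
  by (simp add: kernel_op_def mult.assoc)

lemma P_minus: "P t (\<lambda>x. - f x) x = - P t f x"
  using P_scale[of t "-1" f x] by simp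

lemma P_diff:
  assumes "p \<ge> 1" "Lp_fun p f" "Lp_fun p g" "t \<ge> 0"
  shows "P t (\<lambda>x. f x - g x) x = P t f x - P t g x"
  using P_add[OF assms(1,2) Lp_fun_minus[OF assms(3)] assms(4)] by (simp add: P_minus)

lemma nn_integral_k_average:
  assumes [measurable]: "F \<in> borel_measurable borel" and "t > 0"
  shows "(\<integral>\<^sup>+x. (\<integral>\<^sup>+y. F y * ennreal (k t (y - x)) \<partial>lborel) \<partial>lborel) = (\<integral>\<^sup>+y. F y \<partial>lborel)"
proof -
  have "(\<integral>\<^sup>+x. (\<integral>\<^sup>+y. F y * ennreal (k t (y - x)) \<partial>lborel) \<partial>lborel) =
        (\<integral>\<^sup>+y. (\<integral>\<^sup>+x. F y * ennreal (k t (y - x)) \<partial>lborel) \<partial>lborel)"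
    by (rule lborel_pair.Fubini') measurable
  also have "\<dots> = (\<integral>\<^sup>+y. F y \<partial>lborel)"
    using assms(2) by (intro nn_integral_cong) (simp add: nn_integral_cmult nn_integral_k')
  finally show ?thesis .
qed

text \<open>Averaging with the symmetric kernel of mass one preserves integrals.\<close>

lemma integrable_average:
  assumes F: "integrable lborel F" and t: "t > 0"
  shows "integrable (lborel \<Otimes>\<^sub>M lborel) (\<lambda>(x, y). F y * k t (y - x))"
    and "integrable lborel (\<lambda>x. LINT y|lborel. F y * k t (y - x))"
    and "(LINT x|lborel. LINT y|lborel. F y * k t (y - x)) = (LINT y|lborel. F y)"
proof -
  have [measurable]: "F \<in> borel_measurable borel" using F by auto
  have e: "(\<integral>\<^sup>+x. (\<integral>\<^sup>+y. ennreal (norm (F y)) * ennreal (k t (y - x)) \<partial>lborel) \<partial>lborel) = (\<integral>\<^sup>+y. ennreal (norm (F y)) \<partial>lborel)"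
    by (rule nn_integral_k_average[OF _ t]) measurable
  show I: "integrable (lborel \<Otimes>\<^sub>M lborel) (\<lambda>(x, y). F y * k t (y - x))"
  proof (rule integrableI_bounded)
    have "(\<integral>\<^sup>+z. ennreal (norm (case z of (x, y) \<Rightarrow> F y * k t (y - x))) \<partial>(lborel \<Otimes>\<^sub>M lborel)) =
       (\<integral>\<^sup>+x. (\<integral>\<^sup>+y. ennreal (norm (F y)) * ennreal (k t (y - x)) \<partial>lborel) \<partial>lborel)"
      by (subst lborel.nn_integral_fst[symmetric])
         (auto simp: abs_mult k_nonneg[OF t] ennreal_mult intro!: nn_integral_cong)
    also have "\<dots> < \<infinity>" unfolding e using F by (simp add: integrable_iff_bounded)
    finally show "(\<integral>\<^sup>+z. ennreal (norm (case z of (x, y) \<Rightarrow> F y * k t (y - x))) \<partial>(lborel \<Otimes>\<^sub>M lborel)) < \<infinity>" .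
  qed measurable
  from lborel_pair.integrable_fst'[OF I] show "integrable lborel (\<lambda>x. LINT y|lborel. F y * k t (y - x))" by simp
  have "(LINT x|lborel. LINT y|lborel. F y * k t (y - x)) = (LINT y|lborel. LINT x|lborel. F y * k t (y - x))"
    by (rule lborel_pair.Fubini_integral[OF I, symmetric])
  also have "\<dots> = (LINT y|lborel. F y)"
    by (intro Bochner_Integration.integral_cong refl) (simp add: integral_k'[OF t])
  finally show "(LINT x|lborel. LINT y|lborel. F y * k t (y - x)) = (LINT y|lborel. F y)" .
qed

text \<open>Integrate the tangent inequality of \<open>\<bar>s\<bar>\<^sup>p\<close> at \<open>P t f x\<close>; the linear term has mean zero.\<close>

lemma P_jensen:
  assumes p: "p \<ge> 2" and f: "Lp_fun p f" and t: "t > 0"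
  shows "\<bar>P t f x\<bar> powr p \<le> (LINT y|lborel. \<bar>f y\<bar> powr p * k t (y - x))"
proof -
  define b where "b = P t f x"
  have b: "b = (LINT y|lborel. f y * k t (y - x))" using t by (simp add: b_def P_pos_time)
  define a where "a = p * signed_pow b (p - 1)"
  have i1: "integrable lborel (\<lambda>y. f y * k t (y - x))" using p f t by (intro Lp_integrable_times_k[of p]) auto
  have i2: "integrable lborel (\<lambda>y. \<bar>f y\<bar> powr p * k t (y - x))" by (intro integrable_times_k t Lp_fun_integrable f)
  note ik = integrable_k[OF t, of x]
  have "(LINT y|lborel. (\<bar>b\<bar> powr p - a * b) * k t (y - x) + a * (f y * k t (y - x))) \<le> (LINT y|lborel. \<bar>f y\<bar> powr p * k t (y - x))"
  proof (rule integral_mono)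
    show "(\<bar>b\<bar> powr p - a * b) * k t (y - x) + a * (f y * k t (y - x)) \<le> \<bar>f y\<bar> powr p * k t (y - x)" for y
    proof -
      have "\<bar>b\<bar> powr p + a * (f y - b) \<le> \<bar>f y\<bar> powr p"
        using bregman_power_nonneg[OF p, of b "f y"] by (simp add: bregman_power_def a_def)
      from mult_right_mono[OF this k_nonneg[OF t, of "y - x"]] show ?thesis by (simp add: algebra_simps)
    qed
  qed (use i1 i2 ik in auto)
  also have "(LINT y|lborel. (\<bar>b\<bar> powr p - a * b) * k t (y - x) + a * (f y * k t (y - x))) = \<bar>b\<bar> powr p"
    using i1 ik integral_k[OF t, of x] by (simp add: b[symmetric])
  finally show ?thesis by (simp add: b_def)
qed

lemma
  assumes p: "p \<ge> 2" and f: "Lp_fun p f" and t: "t \<ge> 0"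
  shows Lp_fun_P: "Lp_fun p (P t f)"
    and P_contraction: "(\<integral>x. \<bar>P t f x\<bar> powr p \<partial>lborel) \<le> (\<integral>x. \<bar>f x\<bar> powr p \<partial>lborel)"
proof -
  have [measurable]: "f \<in> borel_measurable borel" using f by auto
  have "Lp_fun p (P t f) \<and> (\<integral>x. \<bar>P t f x\<bar> powr p \<partial>lborel) \<le> (\<integral>x. \<bar>f x\<bar> powr p \<partial>lborel)"
  proof (cases "t = 0")
    case False
    then have t: "t > 0" using t by simp
    note av = integrable_average[OF Lp_fun_integrable[OF f] t]
    have nn: "0 \<le> (LINT y|lborel. \<bar>f y\<bar> powr p * k t (y - x))" for x
      using k_nonneg[OF t] by (intro Bochner_Integration.integral_nonneg) auto
    have I: "integrable lborel (\<lambda>x. \<bar>P t f x\<bar> powr p)"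
      by (rule Bochner_Integration.integrable_bound[OF av(2)]) (use P_jensen[OF p f t] nn in auto)
    have "(\<integral>x. \<bar>P t f x\<bar> powr p \<partial>lborel) \<le> (\<integral>x. \<bar>f x\<bar> powr p \<partial>lborel)"
      unfolding av(3)[symmetric] by (rule integral_mono[OF I av(2) P_jensen[OF p f t]])
    with I show ?thesis by (simp add: Lp_fun_def)
  qed (use f in auto)
  then show "Lp_fun p (P t f)" "(\<integral>x. \<bar>P t f x\<bar> powr p \<partial>lborel) \<le> (\<integral>x. \<bar>f x\<bar> powr p \<partial>lborel)" by auto
qed

lemma P_semigroup:
  assumes p: "p \<ge> 1" and f: "Lp_fun p f" and s: "s > 0" and t: "t \<ge> 0"
  shows "P s (P t f) x = P (s + t) f x"
proof (cases "t = 0")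
  case False
  then have t: "t > 0" using t by simp
  have [measurable]: "f \<in> borel_measurable borel" using f by auto
  let ?h = "\<lambda>y z. f z * k t (z - y) * k s (y - x)"
  have conv: "(\<integral>\<^sup>+y. ennreal (k t (z - y) * k s (y - x)) \<partial>lborel) = ennreal (k (s + t) (z - x))" for z
    using k_conv[OF s t, of x z] by (simp add: ennreal_mult k_nonneg s t mult.commute)
  have I: "integrable (lborel \<Otimes>\<^sub>M lborel) (\<lambda>(y, z). ?h y z)"
  proof (rule integrableI_bounded)
    have "(\<integral>\<^sup>+w. ennreal (norm (case w of (y, z) \<Rightarrow> ?h y z)) \<partial>(lborel \<Otimes>\<^sub>M lborel)) =
       (\<integral>\<^sup>+z. (\<integral>\<^sup>+y. ennreal \<bar>f z\<bar> * ennreal (k t (z - y) * k s (y - x)) \<partial>lborel) \<partial>lborel)"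
      by (subst lborel_pair.nn_integral_snd[symmetric])
         (auto simp: abs_mult k_nonneg s t ennreal_mult mult.assoc intro!: nn_integral_cong)
    also have "\<dots> = (\<integral>\<^sup>+z. ennreal (norm (f z * k (s + t) (z - x))) \<partial>lborel)"
    proof (intro nn_integral_cong)
      fix z
      have "(\<integral>\<^sup>+y. ennreal \<bar>f z\<bar> * ennreal (k t (z - y) * k s (y - x)) \<partial>lborel) = ennreal \<bar>f z\<bar> * ennreal (k (s + t) (z - x))"
        by (subst nn_integral_cmult) (auto simp only: conv, measurable)
      then show "(\<integral>\<^sup>+y. ennreal \<bar>f z\<bar> * ennreal (k t (z - y) * k s (y - x)) \<partial>lborel) = ennreal (norm (f z * k (s + t) (z - x)))"
        using s t by (simp add: abs_mult k_nonneg ennreal_mult)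
    qed
    also have "\<dots> < \<infinity>"
      using Lp_integrable_times_k[OF p f, of "s + t" x] s t by (simp add: integrable_iff_bounded)
    finally show "(\<integral>\<^sup>+w. ennreal (norm (case w of (y, z) \<Rightarrow> ?h y z)) \<partial>(lborel \<Otimes>\<^sub>M lborel)) < \<infinity>" .
  qed measurable
  have "P s (P t f) x = (LINT y|lborel. LINT z|lborel. ?h y z)"
    using s t by (simp add: P_pos_time)
  also have "\<dots> = (LINT z|lborel. LINT y|lborel. ?h y z)"
    by (rule lborel_pair.Fubini_integral[OF I, symmetric])
  also have "\<dots> = (LINT z|lborel. f z * k (s + t) (z - x))"
  proof (intro Bochner_Integration.integral_cong refl)
    fix z
    have "(LINT y|lborel. k t (z - y) * k s (y - x)) = k (s + t) (z - x)"
      using s t conv[of z] by (subst integral_eq_nn_integral) (auto simp: k_nonneg)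
    then show "(LINT y|lborel. ?h y z) = f z * k (s + t) (z - x)" by (simp add: mult.assoc)
  qed
  finally show ?thesis using s t by (simp add: P_pos_time)
qed simp

lemma c\<nu>_nonneg: "x \<noteq> 0 \<Longrightarrow> c * \<nu> x \<ge> 0"
  using k_bound[of 1 x] k_nonneg[of 1 x] by simp

text \<open>The kernels at times in \<open>[t, t + 1]\<close> have a common majorant \<open>D\<close> that is bounded and integrable: away
from the origin the bound by \<open>c * \<nu>\<close> helps, near it the bound by the value at the origin.\<close>

lemma P_time_continuous:
  assumes p: "p \<ge> 1" and f: "Lp_fun p f" and t: "t > 0"
    and X: "X \<longlonglongrightarrow> t" "\<And>n. t \<le> X n" "\<And>n. X n \<le> t + 1"
  shows "(\<lambda>n. P (X n) f x) \<longlonglongrightarrow> P t f x"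
proof -
  have [measurable]: "f \<in> borel_measurable borel" using f by auto
  define M where "M = k t 0"
  \<comment> \<open>The minimum with \<open>M\<close> keeps \<open>D\<close> bounded, so that \<open>\<bar>f\<bar> D \<le> D + M \<bar>f\<bar>\<^sup>p\<close>.\<close>
  define D where "D z = (if norm z < 1 then M else min M ((t + 1) * (c * \<nu> z)))" for z
  have [measurable]: "D \<in> borel_measurable borel" unfolding D_def by measurable
  have M: "M \<ge> 0" using k_nonneg[OF t] by (simp add: M_def)
  have kM: "k s z \<le> M" if "s \<ge> t" for s z
    using k_le_0[of s z] k_0_mono[OF t that] that t by (simp add: M_def)
  have D: "0 \<le> D z" "D z \<le> M" for z
  proof -
    have "norm z \<ge> 1 \<Longrightarrow> 0 \<le> (t + 1) * (c * \<nu> z)" using t c\<nu>_nonneg[of z] mult_nonneg_nonneg[of "t + 1" "c * \<nu> z"] by fastforce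
    then show "0 \<le> D z" "D z \<le> M" using M by (auto simp: D_def not_less)
  qed
  have kD: "k s z \<le> D z" if "s \<ge> t" "s \<le> t + 1" for s z
  proof (cases "norm z < 1")
    case False
    then have z: "z \<noteq> 0" by auto
    have "k s z \<le> s * (c * \<nu> z)" using k_bound[of s z] z that t by (simp add: field_simps)
    also have "\<dots> \<le> (t + 1) * (c * \<nu> z)" using that c\<nu>_nonneg[OF z] by (intro mult_right_mono) auto
    finally show ?thesis using False kM[OF that(1)] by (simp add: D_def)
  qed (use kM[OF that(1)] in \<open>simp add: D_def\<close>)
  have DI: "integrable lborel D"
  proof (rule Bochner_Integration.integrable_bound)
    show "integrable lborel (\<lambda>z::'a. M * indicator (ball 0 1) z + ((t + 1) * c) * (indicator {z. norm z \<ge> 1} z * \<nu> z))"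
      using emeasure_bounded_finite[of "ball (0::'a) 1"]
      by (intro Bochner_Integration.integrable_add integrable_mult_right \<nu>_away_integrable) auto
    show "AE z in lborel. norm (D z) \<le> norm (M * indicator (ball 0 1) z + ((t + 1) * c) * (indicator {z. norm z \<ge> 1} z * \<nu> z))"
    proof (rule AE_I2)
      fix z :: 'a
      show "norm (D z) \<le> norm (M * indicator (ball 0 1) z + ((t + 1) * c) * (indicator {z. norm z \<ge> 1} z * \<nu> z))"
        using D(1)[of z] M by (cases "norm z < 1") (auto simp: D_def indicator_def)
    qed
  qed measurable
  have X0: "X n > 0" for n using X(2)[of n] t by simp
  have "(\<lambda>n. LINT y|lborel. f y * k (X n) (y - x)) \<longlonglongrightarrow> (LINT y|lborel. f y * k t (y - x))"
  proof (rule integral_dominated_convergence)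
    show "integrable lborel (\<lambda>y. D (y - x) + M * \<bar>f y\<bar> powr p)"
      by (intro Bochner_Integration.integrable_add integrable_mult_right Lp_fun_integrable f integrable_lborel_shift DI)
    show "AE y in lborel. (\<lambda>n. f y * k (X n) (y - x)) \<longlonglongrightarrow> f y * k t (y - x)"
    proof (intro AE_I2 tendsto_mult tendsto_const)
      fix y
      show "(\<lambda>n. k (X n) (y - x)) \<longlonglongrightarrow> k t (y - x)"
        by (rule k_cont[OF t X(1,2)])
    qed
    show "AE y in lborel. norm (f y * k (X n) (y - x)) \<le> D (y - x) + M * \<bar>f y\<bar> powr p" for n
    proof (rule AE_I2)
      fix y
      have "norm (f y * k (X n) (y - x)) = \<bar>f y\<bar> * k (X n) (y - x)" using k_nonneg[OF X0] by (simp add: abs_mult)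
      also have "\<dots> \<le> (1 + \<bar>f y\<bar> powr p) * D (y - x)"
        using k_nonneg[OF X0] kD[OF X(2,3)] by (intro mult_mono abs_le_1_plus_powr p) (auto simp: add_nonneg_nonneg)
      also have "\<dots> \<le> D (y - x) + M * \<bar>f y\<bar> powr p"
        using mult_right_mono[OF D(2)[of "y - x"], of "\<bar>f y\<bar> powr p"] by (simp add: algebra_simps)
      finally show "norm (f y * k (X n) (y - x)) \<le> D (y - x) + M * \<bar>f y\<bar> powr p" .
    qed
  qed measurable
  then show ?thesis using X0 t by (simp add: P_pos_time)
qed

lemma P_indicator_bounds:
  assumes [measurable]: "A \<in> sets borel" and t: "t > 0"
  shows "0 \<le> P t (indicator A) x" "P t (indicator A) x \<le> 1"
proof -
  show "0 \<le> P t (indicator A) x" using t by (intro P_nonneg) auto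
  have "P t (indicator A) x = (LINT y|lborel. indicator A y * k t (y - x))" using t by (simp add: P_pos_time)
  also have "\<dots> \<le> (LINT y|lborel. k t (y - x))"
    using integrable_k[OF t, of x] k_nonneg[OF t]
    by (intro integral_mono' ) (auto simp: indicator_def)
  finally show "P t (indicator A) x \<le> 1" using integral_k[OF t] by simp
qed

lemma P_indicator_integral:
  assumes [measurable]: "A \<in> sets borel" and "emeasure lborel A < \<infinity>" "t > 0"
  shows "integrable lborel (P t (indicator A))" "(LINT x|lborel. P t (indicator A) x) = measure lborel A"
proof -
  have "integrable lborel (indicator A :: 'a \<Rightarrow> real)" using assms by simp
  from integrable_average(2,3)[OF this assms(3)]
  show "integrable lborel (P t (indicator A))" "(LINT x|lborel. P t (indicator A) x) = measure lborel A"
    using assms by (simp_all add: kernel_op_def[abs_def])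
qed

text \<open>For the indicator of \<open>A\<close> the values are at most \<open>k t 0\<close> times the measure of \<open>A\<close>, and \<open>k t 0\<close> tends to
zero.\<close>

lemma P_long_time:
  assumes p: "p \<ge> 2" and f: "Lp_fun p f" and X: "filterlim X at_top sequentially" "\<And>n. X n > 0"
  shows "(\<lambda>n. \<integral>x. \<bar>P (X n) f x\<bar> powr p \<partial>lborel) \<longlonglongrightarrow> 0"
proof (rule Lp_operators_vanish[OF f, where K = 1])
  fix A :: "'a set" assume A[measurable]: "A \<in> sets borel" "emeasure lborel A < \<infinity>"
  define a where "a = measure lborel A"
  have fin: "integrable lborel (indicator A :: 'a \<Rightarrow> real)" using A by simp
  show "(\<lambda>n. \<integral>x. \<bar>P (X n) (indicator A) x\<bar> powr p \<partial>lborel) \<longlonglongrightarrow> 0"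
  proof (rule tendsto_sandwich[OF _ _ tendsto_const])
    have "(\<lambda>n. k (X n) 0 * a * a) \<longlonglongrightarrow> 0 * a * a"
      by (rule tendsto_mult[OF tendsto_mult[OF filterlim_compose[OF k_0_lim X(1)] tendsto_const] tendsto_const])
    then show "(\<lambda>n. k (X n) 0 * a * a) \<longlonglongrightarrow> 0" by simp
    have "(\<integral>x. \<bar>P (X n) (indicator A) x\<bar> powr p \<partial>lborel) \<le> k (X n) 0 * a * a" for n
    proof -
      define u where "u = P (X n) (indicator A)"
      have u: "0 \<le> u x" "u x \<le> 1" for x using P_indicator_bounds[OF A(1) X(2)] by (auto simp: u_def)
      have ub: "u x \<le> k (X n) 0 * a" for x
      proof -
        have "u x = (LINT y|lborel. indicator A y * k (X n) (y - x))" using X(2) by (simp add: u_def P_pos_time)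
        also have "\<dots> \<le> (LINT y|lborel. indicator A y * k (X n) 0)"
          using k_le_0[OF X(2)] k_nonneg[OF X(2)] by (intro integral_mono' integrable_mult_left fin mult_left_mono mult_nonneg_nonneg) auto
        finally show ?thesis using A by (simp add: a_def mult.commute)
      qed
      have "\<bar>u x\<bar> powr p \<le> k (X n) 0 * a * u x" for x
      proof -
        have "\<bar>u x\<bar> powr p \<le> u x powr 2" using u[of x] p powr_mono'[of 2 p "u x"] by simp
        also have "\<dots> = u x * u x" using u[of x] by (simp add: power2_eq_square)
        also have "\<dots> \<le> k (X n) 0 * a * u x" using u[of x] ub[of x] by (intro mult_right_mono) auto
        finally show ?thesis .
      qed
      then have "(\<integral>x. \<bar>u x\<bar> powr p \<partial>lborel) \<le> (\<integral>x. k (X n) 0 * a * u x \<partial>lborel)"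
        using P_indicator_integral[OF A X(2)] u(1) k_nonneg[OF X(2)] by (intro integral_mono') (auto simp: u_def a_def)
      also have "\<dots> = k (X n) 0 * a * a" using P_indicator_integral[OF A X(2)] by (simp add: u_def a_def)
      finally show ?thesis by (simp add: u_def)
    qed
    then show "\<forall>\<^sub>F n in sequentially. (\<integral>x. \<bar>P (X n) (indicator A) x\<bar> powr p \<partial>lborel) \<le> k (X n) 0 * a * a" by simp
  qed (auto intro!: always_eventually Bochner_Integration.integral_nonneg)
qed (use p X(2) in \<open>auto simp: P_scale less_imp_le intro!: Lp_fun_P P_add[of p] P_contraction\<close>)

text \<open>Only the mass of the kernel outside a ball escapes from \<open>U\<close>, and the bound by \<open>c * \<nu>\<close> makes it of
order \<open>t\<close>.\<close>

lemma P_indicator_open: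
  assumes U: "open U" "x \<in> U" and X: "X \<longlonglongrightarrow> 0" "\<And>n. X n > 0"
  shows "(\<lambda>n. P (X n) (indicator U) x) \<longlonglongrightarrow> 1"
proof -
  have Um[measurable]: "U \<in> sets borel" using U by simp
  obtain \<delta> where \<delta>: "\<delta> > 0" "ball x \<delta> \<subseteq> U" using U open_contains_ball by blast
  define N where "N = (LINT z|lborel. indicator {z. norm z \<ge> \<delta>} z * \<nu> z)"
  have low: "1 - X n * (c * N) \<le> P (X n) (indicator U) x" for n
  proof -
    have I: "integrable lborel (\<lambda>y. X n * (c * (indicator {z. norm z \<ge> \<delta>} (y - x) * \<nu> (y - x))))"
      using \<nu>_away_integrable[OF \<delta>(1)] by (intro integrable_mult_right integrable_lborel_shift)
    have "integrable lborel (\<lambda>y. indicator {z. norm z \<ge> \<delta>} y * \<nu> y)" by (rule \<nu>_away_integrable[OF \<delta>(1)])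
    then have N: "(LINT y|lborel. indicator {z. norm z \<ge> \<delta>} (y - x) * \<nu> (y - x)) = N"
    proof -
      have nn: "indicator {z. norm z \<ge> \<delta>} z * \<nu> z \<ge> 0" for z :: 'a
        using \<nu>_pos[of z] \<delta>(1) by (cases "z = 0") (auto simp: indicator_def less_imp_le)
      show ?thesis unfolding N_def using nn
        by (subst (1 2) integral_eq_nn_integral) (auto simp: nn_integral_lborel_shift[of "\<lambda>z. ennreal (indicator {z. norm z \<ge> \<delta>} z * \<nu> z)"])
    qed
    have IU: "integrable lborel (\<lambda>y. indicator U y * k (X n) (y - x))"
      by (rule Bochner_Integration.integrable_bound[OF integrable_k[OF X(2), of n x]]) (auto simp: indicator_def)
    have "1 = (LINT y|lborel. k (X n) (y - x))" using integral_k[OF X(2)] by simp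
    also have "\<dots> \<le> (LINT y|lborel. indicator U y * k (X n) (y - x) + X n * (c * (indicator {z. norm z \<ge> \<delta>} (y - x) * \<nu> (y - x))))"
    proof (rule integral_mono)
      fix y
      show "k (X n) (y - x) \<le> indicator U y * k (X n) (y - x) + X n * (c * (indicator {z. norm z \<ge> \<delta>} (y - x) * \<nu> (y - x)))"
      proof (cases "norm (y - x) \<ge> \<delta>")
        case True
        then have z: "y - x \<noteq> 0" using \<delta>(1) by auto
        have "k (X n) (y - x) \<le> X n * (c * \<nu> (y - x))"
          using k_bound[OF X(2) z, of n] X(2)[of n] by (simp add: field_simps)
        then show ?thesis using True k_nonneg[OF X(2), of n "y - x"] by (auto simp: indicator_def)
      next
        case False
        then have "y \<in> U" using \<delta>(2) by (auto simp: dist_norm norm_minus_commute)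
        then show ?thesis using False by simp
      qed
    qed (use integrable_k[OF X(2)] IU I in auto)
    also have "\<dots> = P (X n) (indicator U) x + X n * (c * N)"
      using IU I X(2)[of n] by (simp add: P_pos_time N)
    finally show ?thesis by simp
  qed
  have "(\<lambda>n. 1 - X n * (c * N)) \<longlonglongrightarrow> 1 - 0 * (c * N)"
    by (rule tendsto_diff[OF tendsto_const tendsto_mult[OF X(1) tendsto_const]])
  then have lim: "(\<lambda>n. 1 - X n * (c * N)) \<longlonglongrightarrow> 1" by simp
  have up: "P (X n) (indicator U) x \<le> 1" for n by (rule P_indicator_bounds(2)[OF Um X(2)])
  show ?thesis
    by (rule tendsto_sandwich[OF always_eventually[OF allI[OF low]] always_eventually[OF allI[OF up]] lim tendsto_const])
qed

text \<open>For the indicator of a set \<open>A\<close> of finite measure the \<open>L\<^sup>1\<close> distance is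
\<open>2 (\<bar>A\<bar> - \<integral>\<^sub>A P t 1\<^sub>A)\<close>, since the mass leaving \<open>A\<close> equals the mass arriving outside. An open set slightly
larger than \<open>A\<close> shows that \<open>\<integral>\<^sub>A P t 1\<^sub>A\<close> tends to the measure of \<open>A\<close>. As all values lie in \<open>[0, 1]\<close>,
\<open>p\<close>-th powers of differences only make the integral smaller.\<close>

lemma P_short_time:
  assumes p: "p \<ge> 2" and f: "Lp_fun p f" and X: "X \<longlonglongrightarrow> 0" "\<And>n. X n > 0"
  shows "(\<lambda>n. \<integral>x. \<bar>P (X n) f x - f x\<bar> powr p \<partial>lborel) \<longlonglongrightarrow> 0"
proof (rule Lp_operators_vanish[OF f, where K = "2 powr p * 2" and T = "\<lambda>n f x. P (X n) f x - f x"])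
  fix n and f :: "'a \<Rightarrow> real" assume f: "Lp_fun p f"
  note Pf = Lp_fun_P[OF p f less_imp_le[OF X(2)], of n]
  have mf: "Lp_fun p (\<lambda>x. - f x)" using f by (rule Lp_fun_minus)
  have "(\<integral>x. \<bar>P (X n) f x - f x\<bar> powr p \<partial>lborel) \<le> (\<integral>x. 2 powr p * (\<bar>P (X n) f x\<bar> powr p + \<bar>f x\<bar> powr p) \<partial>lborel)"
    using p abs_add_powr_le[of p "P (X n) f _" "- f _"] Pf f
    by (intro integral_mono integrable_mult_right Bochner_Integration.integrable_add Lp_fun_integrable Lp_fun_diff) auto
  also have "\<dots> = 2 powr p * ((\<integral>x. \<bar>P (X n) f x\<bar> powr p \<partial>lborel) + (\<integral>x. \<bar>f x\<bar> powr p \<partial>lborel))"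
    using Pf f by (simp add: Lp_fun_integrable)
  also have "\<dots> \<le> 2 powr p * ((\<integral>x. \<bar>f x\<bar> powr p \<partial>lborel) + (\<integral>x. \<bar>f x\<bar> powr p \<partial>lborel))"
    by (intro mult_left_mono add_right_mono P_contraction p f less_imp_le[OF X(2)]) auto
  finally show "(\<integral>x. \<bar>P (X n) f x - f x\<bar> powr p \<partial>lborel) \<le> 2 powr p * 2 * (\<integral>x. \<bar>f x\<bar> powr p \<partial>lborel)" by simp
next
  fix A :: "'a set" assume A[measurable]: "A \<in> sets borel" "emeasure lborel A < \<infinity>"
  define a where "a = measure lborel A"
  define J where "J n = (LINT x|lborel. indicator A x * P (X n) (indicator A) x)" for n
  note bd = P_indicator_bounds[OF A(1) X(2)]
  note int = P_indicator_integral[OF A X(2)]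
  have fin: "integrable lborel (indicator A :: 'a \<Rightarrow> real)" using A by simp
  have IJ: "integrable lborel (\<lambda>x. indicator A x * P (X n) (indicator B) x)" if [measurable]: "B \<in> sets borel" for n B
    using P_indicator_bounds[OF that X(2), of n]
    by (intro Bochner_Integration.integrable_bound[OF fin]) (auto simp: indicator_def)
  have le: "(\<integral>x. \<bar>P (X n) (indicator A) x - indicator A x\<bar> powr p \<partial>lborel) \<le> 2 * (a - J n)" for n
  proof -
    have "(\<integral>x. \<bar>P (X n) (indicator A) x - indicator A x\<bar> powr p \<partial>lborel) \<le>
       (\<integral>x. P (X n) (indicator A) x + indicator A x - 2 * (indicator A x * P (X n) (indicator A) x) \<partial>lborel)"
    proof (rule integral_mono')
      fix x
      let ?u = "P (X n) (indicator A) x"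
      have "\<bar>?u - indicator A x\<bar> powr p \<le> \<bar>?u - indicator A x\<bar> powr 1"
        using bd[of n x] p by (intro powr_mono') (auto simp: indicator_def)
      also have "\<dots> = ?u + indicator A x - 2 * (indicator A x * ?u)"
        using bd[of n x] by (auto simp: indicator_def)
      finally show "\<bar>?u - indicator A x\<bar> powr p \<le> ?u + indicator A x - 2 * (indicator A x * ?u)" .
      show "0 \<le> ?u + indicator A x - 2 * (indicator A x * ?u)" using bd[of n x] by (auto simp: indicator_def)
    qed (use int fin IJ[OF A(1)] in auto)
    also have "\<dots> = 2 * (a - J n)" using int[of n] fin IJ[OF A(1), of n] A by (simp add: a_def J_def)
    finally show ?thesis .
  qed
  have J: "J \<longlonglongrightarrow> a"
  proof (rule order_tendstoI)
    fix b assume b: "b > a"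
    have "J n \<le> a" for n
    proof -
      have "J n \<le> (LINT x|lborel. indicator A x)" unfolding J_def
        using bd by (intro integral_mono'[OF fin]) (auto simp: indicator_def)
      then show ?thesis using A by (simp add: a_def)
    qed
    then show "\<forall>\<^sub>F n in sequentially. J n < b" by (intro always_eventually allI le_less_trans[OF _ b])
  next
    fix b assume b: "b < a"
    define e where "e = (a - b) / 2"
    have e: "e > 0" using b by (simp add: e_def)
    obtain U where U: "open U" "A \<subseteq> U" "emeasure lborel (U - A) \<le> e"
      using outer_regular_lborel_le[OF A(1) e] by blast
    have Um[measurable]: "U \<in> sets borel" using U by simp
    have UA: "U - A \<in> sets borel" "emeasure lborel (U - A) < \<infinity>"
      using le_less_trans[OF U(3), of \<infinity>] by auto
    have mUA: "measure lborel (U - A) \<le> e" using U(3) e by (simp add: measure_def enn2real_leI)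
    have "(\<lambda>n. LINT x|lborel. indicator A x * P (X n) (indicator U) x) \<longlonglongrightarrow> (LINT x|lborel. indicator A x)"
    proof (rule integral_dominated_convergence[OF _ _ fin])
      show "AE x in lborel. (\<lambda>n. indicator A x * P (X n) (indicator U) x) \<longlonglongrightarrow> indicator A x"
      proof (rule AE_I2)
        fix x show "(\<lambda>n. indicator A x * P (X n) (indicator U) x) \<longlonglongrightarrow> (indicator A x :: real)"
          using P_indicator_open[OF U(1) _ X, of x] U(2) by (cases "x \<in> A") auto
      qed
    qed (use P_indicator_bounds[OF Um X(2)] in \<open>auto simp: indicator_def intro!: AE_I2\<close>)
    from order_tendstoD(1)[OF this, of "a - e"]
    have "\<forall>\<^sub>F n in sequentially. a - e < (LINT x|lborel. indicator A x * P (X n) (indicator U) x)"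
      using e A by (simp add: a_def)
    then show "\<forall>\<^sub>F n in sequentially. b < J n"
    proof eventually_elim
      case (elim n)
      have split: "P (X n) (indicator U) x = P (X n) (indicator A) x + P (X n) (indicator (U - A)) x" for x
      proof -
        have ii: "integrable lborel (\<lambda>y. indicator B y * k (X n) (y - x))" if [measurable]: "B \<in> sets borel" for B
          by (rule Bochner_Integration.integrable_bound[OF integrable_k[OF X(2), of n x]]) (auto simp: indicator_def)
        have "(indicator U :: 'a \<Rightarrow> real) = (\<lambda>y. indicator A y + indicator (U - A) y)"
          using U(2) by (auto simp: indicator_def fun_eq_iff)
        then show ?thesis using ii[OF A(1)] ii[OF UA(1)] X(2)[of n]
          by (simp add: P_pos_time distrib_right)
      qed
      have "(LINT x|lborel. indicator A x * P (X n) (indicator U) x) \<le> (LINT x|lborel. indicator A x * P (X n) (indicator A) x + P (X n) (indicator (U - A)) x)"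
      proof (rule integral_mono)
        fix x
        show "indicator A x * P (X n) (indicator U) x \<le> indicator A x * P (X n) (indicator A) x + P (X n) (indicator (U - A)) x"
          using P_indicator_bounds(1)[OF UA(1) X(2), of n x] unfolding split by (simp add: indicator_def)
      qed (use IJ[OF Um] IJ[OF A(1)] P_indicator_integral[OF UA X(2)] in auto)
      also have "\<dots> = J n + measure lborel (U - A)"
        using IJ[OF A(1), of n] P_indicator_integral[OF UA X(2), of n] by (simp add: J_def)
      finally have "a - e < J n + e" using elim mUA by linarith
      then show ?case by (simp add: e_def field_simps)
    qed
  qed
  show "(\<lambda>n. \<integral>x. \<bar>P (X n) (indicator A) x - indicator A x\<bar> powr p \<partial>lborel) \<longlonglongrightarrow> 0"
  proof (rule tendsto_sandwich[OF _ _ tendsto_const])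
    have "(\<lambda>n. 2 * (a - J n)) \<longlonglongrightarrow> 2 * (a - a)" by (intro tendsto_intros J)
    then show "(\<lambda>n. 2 * (a - J n)) \<longlonglongrightarrow> 0" by simp
  qed (use le in \<open>auto intro!: always_eventually Bochner_Integration.integral_nonneg\<close>)
qed (use p X(2) in \<open>auto simp: P_scale less_imp_le algebra_simps intro!: Lp_fun_P Lp_fun_diff P_add[of p]\<close>)

end

section \<open>The Hardy--Stein identity for convex functions\<close>

lemma nn_integral_triple:
  fixes f :: "real \<times> 'a::euclidean_space \<times> 'a \<Rightarrow> ennreal"
  assumes [measurable]: "f \<in> borel_measurable (lborel \<Otimes>\<^sub>M (lborel \<Otimes>\<^sub>M lborel))"
  shows "(\<integral>\<^sup>+s. \<integral>\<^sup>+x. \<integral>\<^sup>+y. f (s, x, y) \<partial>lborel \<partial>lborel \<partial>lborel) = (\<integral>\<^sup>+z. f z \<partial>(lborel \<Otimes>\<^sub>M (lborel \<Otimes>\<^sub>M lborel)))"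
proof -
  have L: "sigma_finite_measure (lborel \<Otimes>\<^sub>M lborel :: ('a \<times> 'a) measure)"
    by (simp add: lborel_prod sigma_finite_lborel)
  have "(\<integral>\<^sup>+y. (\<integral>\<^sup>+z. f (s, y, z) \<partial>lborel) \<partial>lborel) = (\<integral>\<^sup>+w. f (s, w) \<partial>(lborel \<Otimes>\<^sub>M lborel))" for s
    by (rule lborel.nn_integral_fst) measurable
  then show ?thesis by (simp add: sigma_finite_measure.nn_integral_fst[OF L])
qed

text \<open>Young's inequality with a parameter, by comparing \<open>\<bar>g\<bar>\<close> with \<open>\<delta> r\<close>.\<close>

lemma powr_young:
  fixes r g \<delta> p :: real
  assumes "r \<ge> 0" "\<delta> > 0" "p \<ge> 1"
  shows "r powr (p - 1) * \<bar>g\<bar> \<le> \<delta> * r powr p + (1 / \<delta>) powr (p - 1) * \<bar>g\<bar> powr p"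
proof (cases "\<bar>g\<bar> \<le> \<delta> * r")
  case True
  have "r powr (p - 1) * \<bar>g\<bar> \<le> r powr (p - 1) * (\<delta> * r)" using True by (intro mult_left_mono) auto
  also have "\<dots> = \<delta> * r powr p" using powr_mult_base[OF assms(1), of "p - 1"] by (simp add: algebra_simps)
  finally show ?thesis by (simp add: add_increasing2)
next
  case False
  have "r powr (p - 1) \<le> (1 / \<delta> * \<bar>g\<bar>) powr (p - 1)" using False assms by (intro powr_mono2) (auto simp: field_simps)
  also have "\<dots> = (1 / \<delta>) powr (p - 1) * \<bar>g\<bar> powr (p - 1)" by (rule powr_mult)
  finally have "r powr (p - 1) * \<bar>g\<bar> \<le> (1 / \<delta>) powr (p - 1) * \<bar>g\<bar> powr (p - 1) * \<bar>g\<bar>" by (intro mult_right_mono) auto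
  also have "\<dots> = (1 / \<delta>) powr (p - 1) * \<bar>g\<bar> powr p"
    using powr_mult_base[of "\<bar>g\<bar>" "p - 1"] by (simp add: algebra_simps)
  finally show ?thesis using assms by (simp add: add_increasing)
qed

text \<open>The integral of \<open>G s - G (s + h)\<close> telescopes to the integral of \<open>G\<close> over \<open>(0, h]\<close>, minus a contribution
from the far end. As \<open>G\<close> itself need not be integrable, the shift is performed on \<open>(0, T]\<close>, where
all terms are finite and can be cancelled.\<close>

lemma
  fixes G :: "real \<Rightarrow> real"
  assumes [measurable]: "G \<in> borel_measurable borel"
    and G0: "\<And>t. t \<ge> 0 \<Longrightarrow> G t \<ge> 0" and dec: "\<And>s t. 0 \<le> s \<Longrightarrow> s \<le> t \<Longrightarrow> G t \<le> G s" and h: "h > 0"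
  shows decreasing_increments_upper: "(\<integral>\<^sup>+s. indicator {0<..} s * ennreal (G s - G (s + h)) \<partial>lborel) \<le> ennreal (h * G 0)"
    and decreasing_increments_lower: "T > 0 \<Longrightarrow> ennreal (h * (G h - G T)) \<le> (\<integral>\<^sup>+s. indicator {0<..} s * ennreal (G s - G (s + h)) \<partial>lborel)"
proof -
  define I where "I a b = (\<integral>\<^sup>+s. indicator {a<..b} s * ennreal (G s) \<partial>lborel)" for a b
  define X where "X T = (\<integral>\<^sup>+s. indicator {0<..T} s * ennreal (G s - G (s + h)) \<partial>lborel)" for T
  have I_add: "I a b + I b d = I a d" if "a \<le> b" "b \<le> d" for a b d
    unfolding I_def using that
    by (subst nn_integral_add[symmetric]) (auto intro!: nn_integral_cong simp: indicator_def)
  have I_const: "(\<integral>\<^sup>+s. indicator {a<..b} s * ennreal K \<partial>lborel) = ennreal ((b - a) * K)" if "a \<le> b" "K \<ge> 0" for a b K :: real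
    using that by (simp add: nn_integral_multc ennreal_mult)
  have I_le: "I a b \<le> ennreal ((b - a) * G a)" if "0 \<le> a" "a \<le> b" for a b
    unfolding I_const[OF that(2) G0[OF that(1)], symmetric] I_def
    using that by (intro nn_integral_mono) (auto simp: indicator_def intro!: ennreal_leI dec)
  have I_ge: "ennreal ((b - a) * G b) \<le> I a b" if "0 \<le> a" "a \<le> b" for a b
    unfolding I_const[OF that(2) G0[OF order_trans[OF that]], symmetric] I_def
    using that by (intro nn_integral_mono) (auto simp: indicator_def intro!: ennreal_leI dec)
  have X_I: "X T + I h (T + h) = I 0 T" for T
  proof -
    have "I h (T + h) = (\<integral>\<^sup>+s. indicator {h<..T + h} (h + 1 * s) * ennreal (G (h + 1 * s)) \<partial>lborel)"
      unfolding I_def by (subst nn_integral_real_affine[of _ 1 h]) auto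
    also have "\<dots> = (\<integral>\<^sup>+s. indicator {0<..T} s * ennreal (G (s + h)) \<partial>lborel)"
      by (intro nn_integral_cong) (auto simp: indicator_def add.commute)
    finally have "X T + I h (T + h) = (\<integral>\<^sup>+s. indicator {0<..T} s * ennreal (G s - G (s + h)) + indicator {0<..T} s * ennreal (G (s + h)) \<partial>lborel)"
      unfolding X_def by (subst nn_integral_add) auto
    also have "\<dots> = I 0 T" unfolding I_def
      using h G0 dec by (intro nn_integral_cong) (auto simp: indicator_def ennreal_plus[symmetric] simp del: ennreal_plus)
    finally show ?thesis .
  qed
  have I_fin: "I a b \<noteq> \<infinity>" if "0 \<le> a" "a \<le> b" for a b
    using I_le[OF that] by (auto simp: top_unique)
  have up: "X T \<le> ennreal (h * G 0)" if T: "T \<ge> 0" for T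
  proof -
    have "X T + I h (T + h) = I 0 T" by (rule X_I)
    also have "\<dots> \<le> I 0 (T + h)" unfolding I_def using h by (intro nn_integral_mono) (auto simp: indicator_def)
    also have "\<dots> = I 0 h + I h (T + h)" using I_add[of 0 h "T + h"] h T by simp
    also have "\<dots> \<le> ennreal (h * G 0) + I h (T + h)" using I_le[of 0 h] h by (intro add_right_mono) auto
    finally show ?thesis using I_fin[of h "T + h"] h T by (simp add: ennreal_add_left_cancel_le add.commute[of _ "I h (T + h)"])
  qed
  have "(\<integral>\<^sup>+s. indicator {0<..} s * ennreal (G s - G (s + h)) \<partial>lborel) = (\<integral>\<^sup>+s. (SUP n. indicator {0<..real n} s * ennreal (G s - G (s + h))) \<partial>lborel)"
  proof (intro nn_integral_cong)
    fix s :: real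
    obtain N :: nat where N: "s \<le> real N" using real_arch_simple by blast
    show "indicator {0<..} s * ennreal (G s - G (s + h)) = (SUP n. indicator {0<..real n} s * ennreal (G s - G (s + h)))"
      by (rule antisym, rule SUP_upper2[of N], use N in \<open>auto simp: indicator_def intro!: SUP_least\<close>)
  qed
  also have "\<dots> = (SUP n. X (real n))" unfolding X_def
    by (intro nn_integral_monotone_convergence_SUP) (auto simp: incseq_def le_fun_def indicator_def)
  also have "\<dots> \<le> ennreal (h * G 0)" by (intro SUP_least up) auto
  finally show "(\<integral>\<^sup>+s. indicator {0<..} s * ennreal (G s - G (s + h)) \<partial>lborel) \<le> ennreal (h * G 0)" .
  assume T: "T > 0"
  have "ennreal (h * G h) + I h (T + h) \<le> I 0 h + I h (T + h)" using I_ge[of 0 h] h by (intro add_right_mono) auto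
  also have "\<dots> = I 0 T + I T (T + h)" using I_add[of 0 h "T + h"] I_add[of 0 T "T + h"] h T by simp
  also have "\<dots> = X T + I T (T + h) + I h (T + h)" unfolding X_I[symmetric] by (simp add: ac_simps)
  also have "\<dots> \<le> X T + ennreal (h * G T) + I h (T + h)"
    using I_le[of T "T + h"] h T by (intro add_right_mono add_left_mono) auto
  finally have "ennreal (h * G h) \<le> X T + ennreal (h * G T)"
    using I_fin[of h "T + h"] h T by (simp add: ennreal_add_left_cancel_le add.commute[of _ "I h (T + h)"])
  then have "ennreal (h * G h) - ennreal (h * G T) \<le> X T" by (simp add: ennreal_minus_le_iff add.commute)
  moreover have "ennreal (h * (G h - G T)) = ennreal (h * G h) - ennreal (h * G T)"
    using h T G0[of T] by (simp add: ennreal_minus right_diff_distrib)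
  moreover have "X T \<le> (\<integral>\<^sup>+s. indicator {0<..} s * ennreal (G s - G (s + h)) \<partial>lborel)"
    unfolding X_def by (intro nn_integral_mono) (auto simp: indicator_def)
  ultimately show "ennreal (h * (G h - G T)) \<le> (\<integral>\<^sup>+s. indicator {0<..} s * ennreal (G s - G (s + h)) \<partial>lborel)"
    by simp
qed

locale hardy_stein = levy_kernel k \<nu> c + convex_gauge Y D1 D2 p C
  for k :: "real \<Rightarrow> 'a::euclidean_space \<Rightarrow> real" and \<nu> c Y D1 D2 p C
begin

abbreviation B :: "real \<Rightarrow> real \<Rightarrow> real \<Rightarrow> real \<Rightarrow> real" where "B \<equiv> bregman Y D1 D2"

lemma gauge_measurable_aux:
  fixes F :: "real \<Rightarrow> real \<Rightarrow> real"
  assumes "continuous_on UNIV (\<lambda>(a, b). F a b)" "f \<in> borel_measurable M" "g \<in> borel_measurable M"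
  shows "(\<lambda>x. F (f x) (g x) :: real) \<in> borel_measurable M"
proof -
  have "(\<lambda>(a, b). F a b) \<in> borel_measurable (borel \<Otimes>\<^sub>M borel)"
    unfolding borel_prod by (rule borel_measurable_continuous_onI[OF assms(1)])
  from measurable_compose[OF measurable_Pair[OF assms(2,3)] this] show ?thesis by simp
qed

lemmas Y_meas [measurable (raw)] = gauge_measurable_aux[OF Y_cont]
lemmas D1_meas [measurable (raw)] = gauge_measurable_aux[OF D1_cont]
lemmas D2_meas [measurable (raw)] = gauge_measurable_aux[OF D2_cont]

lemma B_meas [measurable (raw)]:
  assumes [measurable]: "f1 \<in> borel_measurable M" "f2 \<in> borel_measurable M" "f3 \<in> borel_measurable M" "f4 \<in> borel_measurable M"
  shows "(\<lambda>x. B (f1 x) (f2 x) (f3 x) (f4 x)) \<in> borel_measurable M"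
  unfolding bregman_def by measurable

lemma B_diag [simp]: "B a b a b = 0" by (simp add: bregman_def)

lemma gauge_tendsto_aux:
  fixes F :: "real \<Rightarrow> real \<Rightarrow> real"
  assumes "continuous_on UNIV (\<lambda>(a, b). F a b)" "(f \<longlongrightarrow> a) L" "(g \<longlongrightarrow> b) L"
  shows "((\<lambda>x. F (f x) (g x) :: real) \<longlongrightarrow> F a b) L"
proof -
  have "isCont (\<lambda>(a, b). F a b) (a, b)" using assms(1) by (simp add: continuous_on_eq_continuous_at)
  from isCont_tendsto_compose[OF this tendsto_Pair[OF assms(2,3)]] show ?thesis by simp
qed

lemma B_tendsto:
  assumes "(f1 \<longlongrightarrow> a1) L" "(f2 \<longlongrightarrow> a2) L"
  shows "((\<lambda>x. B (f1 x) (f2 x) b1 b2) \<longlongrightarrow> B a1 a2 b1 b2) L"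
  unfolding bregman_def
  by (intro tendsto_diff tendsto_mult tendsto_const gauge_tendsto_aux[OF Y_cont] gauge_tendsto_aux[OF D1_cont]
      gauge_tendsto_aux[OF D2_cont] assms)

lemma p1: "p \<ge> 1" and p0: "p \<ge> 0" using p_ge_2 by auto

lemma at_origin: "Y 0 0 = 0" "D1 0 0 = 0" "D2 0 0 = 0"
  using Y_bound[of 0 0] D1_bound[of 0 0] D2_bound[of 0 0] by auto

lemma Y_nonneg: "a \<ge> 0 \<Longrightarrow> Y a b \<ge> 0"
  using bregman_nonneg[of 0 a 0 b] by (simp add: bregman_def at_origin)

lemma Lp_abs_sum: "Lp_fun p f \<Longrightarrow> Lp_fun p g \<Longrightarrow> Lp_fun p (\<lambda>x. \<bar>f x\<bar> + \<bar>g x\<bar>)"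
proof (intro Lp_fun_add p0)
  show "Lp_fun p f \<Longrightarrow> Lp_fun p (\<lambda>x. \<bar>f x\<bar>)" "Lp_fun p g \<Longrightarrow> Lp_fun p (\<lambda>x. \<bar>g x\<bar>)"
    by (auto simp: Lp_fun_def)
qed

lemma Y_integrable:
  assumes "Lp_fun p f" "Lp_fun p g" shows "integrable lborel (\<lambda>x. Y (f x) (g x))"
proof (rule Bochner_Integration.integrable_bound)
  have [measurable]: "f \<in> borel_measurable borel" "g \<in> borel_measurable borel" using assms by auto
  show "integrable lborel (\<lambda>x. C * \<bar>\<bar>f x\<bar> + \<bar>g x\<bar>\<bar> powr p)"
    by (intro integrable_mult_right Lp_fun_integrable Lp_abs_sum assms)
  show "(\<lambda>x. Y (f x) (g x)) \<in> borel_measurable lborel" by measurable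
  show "AE x in lborel. norm (Y (f x) (g x)) \<le> norm (C * \<bar>\<bar>f x\<bar> + \<bar>g x\<bar>\<bar> powr p)"
    using Y_bound C_nonneg by (auto simp: abs_mult)
qed

lemma gradient_times_integrable:
  assumes F: "\<And>a b. \<bar>F a b\<bar> \<le> C * (\<bar>a\<bar> + \<bar>b\<bar>) powr (p - 1)" "continuous_on UNIV (\<lambda>(a, b). F a b)"
    and Lp: "Lp_fun p w1" "Lp_fun p w2" "Lp_fun p g"
  shows "integrable lborel (\<lambda>x. F (w1 x) (w2 x) * g x)"
    and "\<delta> > 0 \<Longrightarrow> (LINT x|lborel. \<bar>F (w1 x) (w2 x) * g x\<bar>) \<le>
       C * (\<delta> * (LINT x|lborel. (\<bar>w1 x\<bar> + \<bar>w2 x\<bar>) powr p) + (1 / \<delta>) powr (p - 1) * (LINT x|lborel. \<bar>g x\<bar> powr p))"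
proof -
  have [measurable]: "w1 \<in> borel_measurable borel" "w2 \<in> borel_measurable borel" "g \<in> borel_measurable borel" using Lp by auto
  note [measurable (raw)] = gauge_measurable_aux[OF F(2)]
  have i: "integrable lborel (\<lambda>x. (\<bar>w1 x\<bar> + \<bar>w2 x\<bar>) powr p)"
    using Lp_fun_integrable[OF Lp_abs_sum[OF Lp(1,2)]] by simp
  have I: "integrable lborel (\<lambda>x. C * (\<delta> * (\<bar>w1 x\<bar> + \<bar>w2 x\<bar>) powr p + (1 / \<delta>) powr (p - 1) * \<bar>g x\<bar> powr p))" for \<delta>
    by (intro integrable_mult_right Bochner_Integration.integrable_add i Lp_fun_integrable Lp)
  have le: "\<bar>F (w1 x) (w2 x) * g x\<bar> \<le> C * (\<delta> * (\<bar>w1 x\<bar> + \<bar>w2 x\<bar>) powr p + (1 / \<delta>) powr (p - 1) * \<bar>g x\<bar> powr p)" if "\<delta> > 0" for \<delta> x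
  proof -
    have "\<bar>F (w1 x) (w2 x) * g x\<bar> \<le> C * (\<bar>w1 x\<bar> + \<bar>w2 x\<bar>) powr (p - 1) * \<bar>g x\<bar>"
      unfolding abs_mult by (intro mult_right_mono F) auto
    also have "\<dots> \<le> C * (\<delta> * (\<bar>w1 x\<bar> + \<bar>w2 x\<bar>) powr p + (1 / \<delta>) powr (p - 1) * \<bar>g x\<bar> powr p)"
      unfolding mult.assoc using that p1 by (intro mult_left_mono C_nonneg powr_young) auto
    finally show ?thesis .
  qed
  show int: "integrable lborel (\<lambda>x. F (w1 x) (w2 x) * g x)"
    by (rule Bochner_Integration.integrable_bound[OF I[of 1]]) (use le[of 1] in \<open>auto intro!: AE_I2 intro: order_trans[OF _ abs_ge_self]\<close>)
  assume d: "\<delta> > 0"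
  have "(LINT x|lborel. \<bar>F (w1 x) (w2 x) * g x\<bar>) \<le> (LINT x|lborel. C * (\<delta> * (\<bar>w1 x\<bar> + \<bar>w2 x\<bar>) powr p + (1 / \<delta>) powr (p - 1) * \<bar>g x\<bar> powr p))"
    using int by (intro integral_mono I le d integrable_abs)
  also have "\<dots> = C * (\<delta> * (LINT x|lborel. (\<bar>w1 x\<bar> + \<bar>w2 x\<bar>) powr p) + (1 / \<delta>) powr (p - 1) * (LINT x|lborel. \<bar>g x\<bar> powr p))"
    using i Lp_fun_integrable[OF Lp(3)] by simp
  finally show "(LINT x|lborel. \<bar>F (w1 x) (w2 x) * g x\<bar>) \<le> C * (\<delta> * (LINT x|lborel. (\<bar>w1 x\<bar> + \<bar>w2 x\<bar>) powr p) + (1 / \<delta>) powr (p - 1) * (LINT x|lborel. \<bar>g x\<bar> powr p))" .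
qed

lemmas D1_integrable = gradient_times_integrable(1)[OF D1_bound D1_cont]
lemmas D2_integrable = gradient_times_integrable(1)[OF D2_bound D2_cont]

text \<open>The gradient of the gauge along an \<open>L\<^sup>p\<close> function is a functional that is continuous on \<open>L\<^sup>p\<close>.\<close>

lemma gradient_times_tendsto_0:
  assumes F: "\<And>a b. \<bar>F a b\<bar> \<le> C * (\<bar>a\<bar> + \<bar>b\<bar>) powr (p - 1)" "continuous_on UNIV (\<lambda>(a, b). F a b)"
    and Lp: "Lp_fun p w1" "Lp_fun p w2" "\<And>n. Lp_fun p (g n)"
    and g0: "(\<lambda>n. LINT x|lborel. \<bar>g n x\<bar> powr p) \<longlonglongrightarrow> 0"
  shows "(\<lambda>n. LINT x|lborel. F (w1 x) (w2 x) * g n x) \<longlonglongrightarrow> 0"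
proof (rule LIMSEQ_I)
  fix \<epsilon> :: real assume e: "\<epsilon> > 0"
  define R where "R = (LINT x|lborel. (\<bar>w1 x\<bar> + \<bar>w2 x\<bar>) powr p)"
  have R: "R \<ge> 0" by (simp add: R_def)
  \<comment> \<open>The summand \<open>1\<close> avoids a division by zero when \<open>C * R = 0\<close>.\<close>
  define \<delta> where "\<delta> = \<epsilon> / (2 * (C * R + 1))"
  have CR: "C * R \<ge> 0" using C_nonneg R by simp
  have d: "\<delta> > 0" using e CR by (simp add: \<delta>_def)
  have "C * (\<delta> * R) = \<epsilon> / 2 * (C * R / (C * R + 1))" by (simp add: \<delta>_def field_simps)
  also have "\<dots> \<le> \<epsilon> / 2 * 1" using e CR by (intro mult_left_mono) (auto simp: divide_le_eq_1)
  finally have d2: "C * (\<delta> * R) \<le> \<epsilon> / 2" by simp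
  define K where "K = C * (1 / \<delta>) powr (p - 1)"
  have "(\<lambda>n. K * (LINT x|lborel. \<bar>g n x\<bar> powr p)) \<longlonglongrightarrow> K * 0" by (rule tendsto_mult[OF tendsto_const g0])
  from order_tendstoD(2)[OF this, of "\<epsilon> / 2"] e
  obtain N where N: "\<And>n. n \<ge> N \<Longrightarrow> K * (LINT x|lborel. \<bar>g n x\<bar> powr p) < \<epsilon> / 2"
    by (auto simp: eventually_sequentially)
  show "\<exists>N. \<forall>n\<ge>N. norm ((LINT x|lborel. F (w1 x) (w2 x) * g n x) - 0) < \<epsilon>"
  proof (intro exI allI impI)
    fix n assume n: "n \<ge> N"
    have "norm ((LINT x|lborel. F (w1 x) (w2 x) * g n x) - 0) \<le> (LINT x|lborel. \<bar>F (w1 x) (w2 x) * g n x\<bar>)"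
      using integral_norm_bound[of lborel "\<lambda>x. F (w1 x) (w2 x) * g n x"] by simp
    also have "\<dots> \<le> C * (\<delta> * R + (1 / \<delta>) powr (p - 1) * (LINT x|lborel. \<bar>g n x\<bar> powr p))"
      unfolding R_def by (rule gradient_times_integrable(2)[OF F Lp(1,2) Lp(3) d])
    also have "\<dots> = C * (\<delta> * R) + K * (LINT x|lborel. \<bar>g n x\<bar> powr p)" by (simp add: K_def algebra_simps)
    also have "\<dots> < \<epsilon>" using d2 N[OF n] by simp
    finally show "norm ((LINT x|lborel. F (w1 x) (w2 x) * g n x) - 0) < \<epsilon>" .
  qed
qed

text \<open>Expand the divergence and integrate term by term, first in \<open>y\<close>: \<open>k h\<close> has mass one, turns \<open>a\<close> and \<open>b\<close>
into \<open>P h a\<close> and \<open>P h b\<close>, and preserves the integral of \<open>Y (a, b)\<close>. The base point \<open>(w1, w2)\<close> is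
arbitrary: it is taken as \<open>(P h a, P h b)\<close>, which kills the gradient terms, and as \<open>(a, b)\<close>.\<close>

lemma bregman_average:
  assumes Lp: "Lp_fun p a" "Lp_fun p b" "Lp_fun p w1" "Lp_fun p w2"
    and nn: "\<And>x. a x \<ge> 0" "\<And>x. w1 x \<ge> 0" and h: "h > 0"
  defines "V \<equiv> (LINT x|lborel. Y (a x) (b x)) - (LINT x|lborel. Y (w1 x) (w2 x))
      - (LINT x|lborel. D1 (w1 x) (w2 x) * (P h a x - w1 x)) - (LINT x|lborel. D2 (w1 x) (w2 x) * (P h b x - w2 x))"
  shows "V \<ge> 0"
    and "(\<integral>\<^sup>+x. \<integral>\<^sup>+y. ennreal (B (w1 x) (w2 x) (a y) (b y) * k h (y - x)) \<partial>lborel \<partial>lborel) = ennreal V"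
proof -
  have [measurable]: "a \<in> borel_measurable borel" "b \<in> borel_measurable borel"
     "w1 \<in> borel_measurable borel" "w2 \<in> borel_measurable borel" using Lp by auto
  define PY where "PY x = (LINT y|lborel. Y (a y) (b y) * k h (y - x))" for x
  define W where "W x = PY x - Y (w1 x) (w2 x) - D1 (w1 x) (w2 x) * (P h a x - w1 x) - D2 (w1 x) (w2 x) * (P h b x - w2 x)" for x
  note Yi = Y_integrable[OF Lp(1,2)]
  have inner: "W x \<ge> 0 \<and> (\<integral>\<^sup>+y. ennreal (B (w1 x) (w2 x) (a y) (b y) * k h (y - x)) \<partial>lborel) = ennreal (W x)" for x
  proof -
    define d1 d2 where "d1 = D1 (w1 x) (w2 x)" and "d2 = D2 (w1 x) (w2 x)"
    define K where "K = Y (w1 x) (w2 x) - d1 * w1 x - d2 * w2 x"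
    have e: "B (w1 x) (w2 x) (a y) (b y) * k h (y - x) = Y (a y) (b y) * k h (y - x)
       - K * k h (y - x) - d1 * (a y * k h (y - x)) - d2 * (b y * k h (y - x))" for y
      unfolding bregman_def K_def d1_def d2_def by (simp add: algebra_simps)
    note i = integrable_times_k[OF h Yi, of x] integrable_k[OF h, of x]
      Lp_integrable_times_k[OF p1 Lp(1) h, of x] Lp_integrable_times_k[OF p1 Lp(2) h, of x]
    have I: "integrable lborel (\<lambda>y. B (w1 x) (w2 x) (a y) (b y) * k h (y - x))"
      unfolding e by (intro Bochner_Integration.integrable_diff integrable_mult_right i)
    have nnB: "B (w1 x) (w2 x) (a y) (b y) * k h (y - x) \<ge> 0" for y
      by (intro mult_nonneg_nonneg bregman_nonneg nn k_nonneg h)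
    have "(LINT y|lborel. B (w1 x) (w2 x) (a y) (b y) * k h (y - x)) =
        PY x - K * (LINT y|lborel. k h (y - x)) - d1 * P h a x - d2 * P h b x"
      unfolding e using i h by (simp add: PY_def P_pos_time)
    also have "\<dots> = W x"
      using h by (simp add: W_def integral_k K_def d1_def[symmetric] d2_def[symmetric] algebra_simps)
    finally have "(LINT y|lborel. B (w1 x) (w2 x) (a y) (b y) * k h (y - x)) = W x" .
    then show ?thesis
      using nn_integral_eq_integral[OF I AE_I2[OF nnB]] Bochner_Integration.integral_nonneg[OF nnB, of lborel "\<lambda>y. y"] by simp
  qed
  have LpP: "Lp_fun p (\<lambda>x. P h a x - w1 x)" "Lp_fun p (\<lambda>x. P h b x - w2 x)"
    using h by (auto intro!: Lp_fun_diff Lp_fun_P Lp p0 p_ge_2)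
  note i = integrable_average(2)[OF Yi h, folded PY_def] Y_integrable[OF Lp(3,4)]
     D1_integrable[OF Lp(3,4) LpP(1)] D2_integrable[OF Lp(3,4) LpP(2)]
  have WI: "integrable lborel W" unfolding W_def by (intro Bochner_Integration.integrable_diff i)
  have WV: "(LINT x|lborel. W x) = V"
    using i integrable_average(3)[OF Yi h, folded PY_def] by (simp add: W_def V_def)
  show "V \<ge> 0" using inner unfolding WV[symmetric] by (intro Bochner_Integration.integral_nonneg) auto
  have "(\<integral>\<^sup>+x. \<integral>\<^sup>+y. ennreal (B (w1 x) (w2 x) (a y) (b y) * k h (y - x)) \<partial>lborel \<partial>lborel) = (\<integral>\<^sup>+x. ennreal (W x) \<partial>lborel)"
    using inner by (intro nn_integral_cong) auto
  also have "\<dots> = ennreal V" using inner unfolding WV[symmetric] by (intro nn_integral_eq_integral WI) auto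
  finally show "(\<integral>\<^sup>+x. \<integral>\<^sup>+y. ennreal (B (w1 x) (w2 x) (a y) (b y) * k h (y - x)) \<partial>lborel \<partial>lborel) = ennreal V" .
qed

lemma bregman_pointwise:
  assumes Lp: "Lp_fun p a" "Lp_fun p b" "Lp_fun p w1" "Lp_fun p w2"
    and nn: "\<And>x. a x \<ge> 0" "\<And>x. w1 x \<ge> 0"
  shows "(LINT x|lborel. Y (w1 x) (w2 x)) + (LINT x|lborel. D1 (w1 x) (w2 x) * (a x - w1 x)) + (LINT x|lborel. D2 (w1 x) (w2 x) * (b x - w2 x))
     \<le> (LINT x|lborel. Y (a x) (b x))"
proof -
  have i: "integrable lborel (\<lambda>x. D1 (w1 x) (w2 x) * (a x - w1 x))" "integrable lborel (\<lambda>x. D2 (w1 x) (w2 x) * (b x - w2 x))"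
    "integrable lborel (\<lambda>x. Y (w1 x) (w2 x))" "integrable lborel (\<lambda>x. Y (a x) (b x))"
    by (intro D1_integrable D2_integrable Y_integrable Lp Lp_fun_diff p0)+
  have "(LINT x|lborel. Y (w1 x) (w2 x) + D1 (w1 x) (w2 x) * (a x - w1 x) + D2 (w1 x) (w2 x) * (b x - w2 x)) \<le> (LINT x|lborel. Y (a x) (b x))"
  proof (rule integral_mono)
    fix x show "Y (w1 x) (w2 x) + D1 (w1 x) (w2 x) * (a x - w1 x) + D2 (w1 x) (w2 x) * (b x - w2 x) \<le> Y (a x) (b x)"
      using bregman_nonneg[OF nn(2)[of x] nn(1)[of x], of "w2 x" "b x"] by (simp add: bregman_def)
  qed (use i in auto)
  then show ?thesis using i by simp
qed

context
  fixes a b :: "'a \<Rightarrow> real"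
  assumes a_Lp: "Lp_fun p a" and b_Lp: "Lp_fun p b" and a_nonneg: "\<And>x. a x \<ge> 0"
begin

definition gauge_integral :: "real \<Rightarrow> real" where "gauge_integral t = (LINT x|lborel. Y (P t a x) (P t b x))"

lemma [measurable]: "a \<in> borel_measurable borel" "b \<in> borel_measurable borel"
  using a_Lp b_Lp by auto

lemma gauge_integral_meas [measurable]: "gauge_integral \<in> borel_measurable borel"
  unfolding gauge_integral_def[abs_def] by measurable

lemma Pa_nonneg: "t \<ge> 0 \<Longrightarrow> P t a x \<ge> 0" by (intro P_nonneg a_nonneg)

lemma P_ab_Lp: "t \<ge> 0 \<Longrightarrow> Lp_fun p (P t a)" "t \<ge> 0 \<Longrightarrow> Lp_fun p (P t b)"
  by (intro Lp_fun_P p_ge_2 a_Lp b_Lp; simp)+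

lemma P_step:
  assumes "t \<ge> 0" "h > 0"
  shows "P h (P t a) x = P (t + h) a x" "P h (P t b) x = P (t + h) b x"
  using P_semigroup[OF p1 a_Lp assms(2,1)] P_semigroup[OF p1 b_Lp assms(2,1)] by (auto simp: add.commute)

lemma gauge_integral_nonneg: "t \<ge> 0 \<Longrightarrow> gauge_integral t \<ge> 0"
  unfolding gauge_integral_def by (intro Bochner_Integration.integral_nonneg Y_nonneg Pa_nonneg)

lemma gauge_integral_step:
  assumes t: "t \<ge> 0" and h: "h > 0"
  shows "gauge_integral (t + h) \<le> gauge_integral t"
    and "(\<integral>\<^sup>+x. \<integral>\<^sup>+y. ennreal (B (P (t + h) a x) (P (t + h) b x) (P t a y) (P t b y) * k h (y - x)) \<partial>lborel \<partial>lborel) = ennreal (gauge_integral t - gauge_integral (t + h))"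
proof -
  have th: "t + h \<ge> 0" using t h by simp
  note * = bregman_average[OF P_ab_Lp[OF t] P_ab_Lp[OF th] Pa_nonneg[OF t] Pa_nonneg[OF th] h, unfolded P_step[OF t h], simplified, folded gauge_integral_def]
  show "gauge_integral (t + h) \<le> gauge_integral t" using *(1) by simp
  show "(\<integral>\<^sup>+x. \<integral>\<^sup>+y. ennreal (B (P (t + h) a x) (P (t + h) b x) (P t a y) (P t b y) * k h (y - x)) \<partial>lborel \<partial>lborel) = ennreal (gauge_integral t - gauge_integral (t + h))"
    using *(2) .
qed

lemma gauge_integral_decreasing: "0 \<le> s \<Longrightarrow> s \<le> t \<Longrightarrow> gauge_integral t \<le> gauge_integral s"
  using gauge_integral_step(1)[of s "t - s"] by (cases "s = t") auto

lemma gauge_integral_step_lower: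
  assumes t: "t \<ge> 0" and h: "h > 0"
  shows "ennreal (gauge_integral t - gauge_integral (t + h)) \<le> (\<integral>\<^sup>+x. \<integral>\<^sup>+y. ennreal (B (P t a x) (P t b x) (P t a y) (P t b y) * k h (y - x)) \<partial>lborel \<partial>lborel)"
proof -
  have th: "t + h \<ge> 0" using t h by simp
  note * = bregman_average(2)[OF P_ab_Lp[OF t] P_ab_Lp[OF t] Pa_nonneg[OF t] Pa_nonneg[OF t] h, unfolded P_step[OF t h], folded gauge_integral_def]
  have "gauge_integral t + (LINT x|lborel. D1 (P t a x) (P t b x) * (P (t + h) a x - P t a x)) + (LINT x|lborel. D2 (P t a x) (P t b x) * (P (t + h) b x - P t b x)) \<le> gauge_integral (t + h)"
    unfolding gauge_integral_def by (rule bregman_pointwise[OF P_ab_Lp[OF th] P_ab_Lp[OF t] Pa_nonneg[OF th] Pa_nonneg[OF t]])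
  then show ?thesis unfolding * by (intro ennreal_leI) simp
qed

text \<open>Monotonicity bounds the values from above. From below, the tangent inequality at \<open>(a, b)\<close> leaves an error
that is linear in \<open>P t a - a\<close> and \<open>P t b - b\<close>.\<close>

lemma gauge_integral_short_time:
  assumes X: "X \<longlonglongrightarrow> 0" "\<And>n. X n > 0"
  shows "(\<lambda>n. gauge_integral (X n)) \<longlonglongrightarrow> gauge_integral 0"
proof -
  define e1 where "e1 n = (LINT x|lborel. D1 (a x) (b x) * (P (X n) a x - a x))" for n
  define e2 where "e2 n = (LINT x|lborel. D2 (a x) (b x) * (P (X n) b x - b x))" for n
  have X0: "X n \<ge> 0" for n using X(2)[of n] by simp
  have e1: "e1 \<longlonglongrightarrow> 0" unfolding e1_def
    by (rule gradient_times_tendsto_0[OF D1_bound D1_cont a_Lp b_Lp Lp_fun_diff[OF P_ab_Lp(1)[OF X0] a_Lp p0] P_short_time[OF p_ge_2 a_Lp X]])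
  have e2: "e2 \<longlonglongrightarrow> 0" unfolding e2_def
    by (rule gradient_times_tendsto_0[OF D2_bound D2_cont a_Lp b_Lp Lp_fun_diff[OF P_ab_Lp(2)[OF X0] b_Lp p0] P_short_time[OF p_ge_2 b_Lp X]])
  have lim: "(\<lambda>n. gauge_integral 0 + e1 n + e2 n) \<longlonglongrightarrow> gauge_integral 0"
    using tendsto_add[OF tendsto_add[OF tendsto_const e1] e2, of "gauge_integral 0"] by simp
  have low: "gauge_integral 0 + e1 n + e2 n \<le> gauge_integral (X n)" for n
    using bregman_pointwise[OF P_ab_Lp[OF X0] a_Lp b_Lp Pa_nonneg[OF X0] a_nonneg, of n]
    by (simp add: gauge_integral_def e1_def e2_def)
  have up: "gauge_integral (X n) \<le> gauge_integral 0" for n by (intro gauge_integral_decreasing X0 order_refl)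
  show ?thesis
    by (rule tendsto_sandwich[OF always_eventually[OF allI[OF low]] always_eventually[OF allI[OF up]] lim tendsto_const])
qed

lemma gauge_integral_long_time:
  assumes X: "filterlim X at_top sequentially" "\<And>n. X n > 0"
  shows "(\<lambda>n. gauge_integral (X n)) \<longlonglongrightarrow> 0"
proof -
  define N where "N n = C * (2 powr p * ((LINT x|lborel. \<bar>P (X n) a x\<bar> powr p) + (LINT x|lborel. \<bar>P (X n) b x\<bar> powr p)))" for n
  have X0: "X n \<ge> 0" for n using X(2)[of n] by simp
  have "N \<longlonglongrightarrow> C * (2 powr p * (0 + 0))" unfolding N_def
    by (rule tendsto_mult[OF tendsto_const tendsto_mult[OF tendsto_const tendsto_add[OF P_long_time[OF p_ge_2 a_Lp X] P_long_time[OF p_ge_2 b_Lp X]]]])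
  then have lim: "N \<longlonglongrightarrow> 0" by simp
  have up: "gauge_integral (X n) \<le> N n" for n
  proof -
    let ?u = "P (X n) a" and ?v = "P (X n) b"
    note i = Lp_fun_integrable[OF P_ab_Lp(1)[OF X0[of n]]] Lp_fun_integrable[OF P_ab_Lp(2)[OF X0[of n]]]
    have "gauge_integral (X n) \<le> (LINT x|lborel. C * (2 powr p * (\<bar>?u x\<bar> powr p + \<bar>?v x\<bar> powr p)))"
      unfolding gauge_integral_def
    proof (rule integral_mono)
      show "Y (?u x) (?v x) \<le> C * (2 powr p * (\<bar>?u x\<bar> powr p + \<bar>?v x\<bar> powr p))" for x
      proof -
        have "Y (?u x) (?v x) \<le> C * \<bar>\<bar>?u x\<bar> + \<bar>?v x\<bar>\<bar> powr p" using Y_bound[of "?u x" "?v x"] by simp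
        also have "\<dots> \<le> C * (2 powr p * (\<bar>\<bar>?u x\<bar>\<bar> powr p + \<bar>\<bar>?v x\<bar>\<bar> powr p))"
          by (intro mult_left_mono C_nonneg abs_add_powr_le p0)
        finally show ?thesis by simp
      qed
    qed (use i Y_integrable[OF P_ab_Lp[OF X0[of n]]] in auto)
    also have "\<dots> = N n" using i by (simp add: N_def)
    finally show ?thesis .
  qed
  have low: "0 \<le> gauge_integral (X n)" for n by (rule gauge_integral_nonneg[OF X0])
  show ?thesis
    by (rule tendsto_sandwich[OF always_eventually[OF allI[OF low]] always_eventually[OF allI[OF up]] tendsto_const lim])
qed

lemma c_nonneg: "c \<ge> 0"
proof -
  obtain i :: 'a where "i \<in> Basis" using nonempty_Basis by blast
  then have "i \<noteq> 0" by auto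
  from c\<nu>_nonneg[OF this] \<nu>_pos[OF this] show ?thesis by (simp add: zero_le_mult_iff)
qed

text \<open>The sequence \<open>u\<close> (base point at the later time) yields the upper bound by Fatou's lemma, the
sequence \<open>v\<close> (both points at the same time) the lower bound by dominated convergence. On the
diagonal the divergence vanishes, so no limit of the kernel is required there.\<close>

theorem convex_hardy_stein:
  "(\<integral>\<^sup>+t. \<integral>\<^sup>+x. \<integral>\<^sup>+y. indicator {0<..} t * ennreal (B (P t a x) (P t b x) (P t a y) (P t b y) * \<nu> (y - x)) \<partial>lborel \<partial>lborel \<partial>lborel)
    = ennreal (LINT x|lborel. Y (a x) (b x))"
proof -
  define X where "X n = 1 / real (Suc n)" for n
  have X: "X \<longlonglongrightarrow> 0" "\<And>n. X n > 0" "\<And>n. X n \<le> 1"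
    using LIMSEQ_inverse_real_of_nat by (auto simp: X_def[abs_def] inverse_eq_divide)
  have "X n \<noteq> 0" for n using X(2)[of n] by simp
  then have Xr: "filterlim X (at_right 0) sequentially"
    using X by (auto simp: filterlim_at intro!: always_eventually)
  let ?M = "lborel \<Otimes>\<^sub>M (lborel \<Otimes>\<^sub>M lborel) :: (real \<times> 'a \<times> 'a) measure"
  define f where "f = (\<lambda>(t, x, y). indicator {0<..} t * ennreal (B (P t a x) (P t b x) (P t a y) (P t b y) * \<nu> (y - x)))"
  define u where "u n = (\<lambda>(t, x, y). indicator {0<..} t * ennreal (B (P (t + X n) a x) (P (t + X n) b x) (P t a y) (P t b y) * (k (X n) (y - x) / X n)))" for n
  define v where "v n = (\<lambda>(t, x, y). indicator {0<..} t * ennreal (B (P t a x) (P t b x) (P t a y) (P t b y) * (k (X n) (y - x) / X n)))" for n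
  have fm[measurable]: "f \<in> borel_measurable ?M" unfolding f_def by measurable
  have um[measurable]: "u n \<in> borel_measurable ?M" for n unfolding u_def by measurable
  have vm[measurable]: "v n \<in> borel_measurable ?M" for n unfolding v_def by measurable
  have klim: "(\<lambda>n. k (X n) z / X n) \<longlonglongrightarrow> \<nu> z" if "z \<noteq> 0" for z
    by (rule filterlim_compose[OF k_limit[OF that] Xr])
  have scale: "ennreal (B' * (K / X n)) = ennreal (1 / X n) * ennreal (B' * K)" for B' K n
    using X(2)[of n] by (subst ennreal_mult'[symmetric]) (auto simp: less_imp_le)
  have intu: "(\<integral>\<^sup>+z. u n z \<partial>?M) = ennreal (1 / X n) * (\<integral>\<^sup>+t. indicator {0<..} t * ennreal (gauge_integral t - gauge_integral (t + X n)) \<partial>lborel)" for n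
  proof -
    have "(\<integral>\<^sup>+z. u n z \<partial>?M) = (\<integral>\<^sup>+t. \<integral>\<^sup>+x. \<integral>\<^sup>+y. u n (t, x, y) \<partial>lborel \<partial>lborel \<partial>lborel)"
      by (rule nn_integral_triple[symmetric]) measurable
    also have "\<dots> = (\<integral>\<^sup>+t. ennreal (1 / X n) * (indicator {0<..} t * ennreal (gauge_integral t - gauge_integral (t + X n))) \<partial>lborel)"
    proof (intro nn_integral_cong)
      fix t :: real
      show "(\<integral>\<^sup>+x. \<integral>\<^sup>+y. u n (t, x, y) \<partial>lborel \<partial>lborel) = ennreal (1 / X n) * (indicator {0<..} t * ennreal (gauge_integral t - gauge_integral (t + X n)))"
      proof (cases "t > 0")
        case True
        have "(\<integral>\<^sup>+x. \<integral>\<^sup>+y. u n (t, x, y) \<partial>lborel \<partial>lborel) = (\<integral>\<^sup>+x. \<integral>\<^sup>+y. ennreal (1 / X n) * ennreal (B (P (t + X n) a x) (P (t + X n) b x) (P t a y) (P t b y) * k (X n) (y - x)) \<partial>lborel \<partial>lborel)"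
          using True by (simp add: u_def scale[symmetric])
        also have "\<dots> = ennreal (1 / X n) * ennreal (gauge_integral t - gauge_integral (t + X n))"
          unfolding gauge_integral_step(2)[OF less_imp_le[OF True] X(2), symmetric]
          by (subst nn_integral_cmult, measurable)+
        finally show ?thesis using True by simp
      qed (simp add: u_def)
    qed
    also have "\<dots> = ennreal (1 / X n) * (\<integral>\<^sup>+t. indicator {0<..} t * ennreal (gauge_integral t - gauge_integral (t + X n)) \<partial>lborel)"
      by (rule nn_integral_cmult) measurable
    finally show ?thesis .
  qed
  have u_up: "(\<integral>\<^sup>+z. u n z \<partial>?M) \<le> ennreal (gauge_integral 0)" for n
  proof -
    have "(\<integral>\<^sup>+z. u n z \<partial>?M) \<le> ennreal (1 / X n) * ennreal (X n * gauge_integral 0)"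
      unfolding intu by (intro mult_left_mono decreasing_increments_upper gauge_integral_nonneg gauge_integral_decreasing X(2)) auto
    also have "\<dots> = ennreal (gauge_integral 0)" using X(2)[of n] gauge_integral_nonneg[of 0] by (subst ennreal_mult'[symmetric]) auto
    finally show ?thesis .
  qed
  have v_low: "ennreal (gauge_integral (X n) - gauge_integral T) \<le> (\<integral>\<^sup>+z. v n z \<partial>?M)" if T: "T > 0" for n T
  proof -
    have "ennreal (gauge_integral (X n) - gauge_integral T) = ennreal (1 / X n) * ennreal (X n * (gauge_integral (X n) - gauge_integral T))"
      using X(2)[of n] by (subst ennreal_mult'[symmetric]) auto
    also have "\<dots> \<le> ennreal (1 / X n) * (\<integral>\<^sup>+t. indicator {0<..} t * ennreal (gauge_integral t - gauge_integral (t + X n)) \<partial>lborel)"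
      by (intro mult_left_mono decreasing_increments_lower gauge_integral_nonneg gauge_integral_decreasing X(2) T) auto
    also have "\<dots> = (\<integral>\<^sup>+t. ennreal (1 / X n) * (indicator {0<..} t * ennreal (gauge_integral t - gauge_integral (t + X n))) \<partial>lborel)"
      by (rule nn_integral_cmult[symmetric]) measurable
    also have "\<dots> \<le> (\<integral>\<^sup>+t. \<integral>\<^sup>+x. \<integral>\<^sup>+y. v n (t, x, y) \<partial>lborel \<partial>lborel \<partial>lborel)"
    proof (intro nn_integral_mono)
      fix t :: real
      show "ennreal (1 / X n) * (indicator {0<..} t * ennreal (gauge_integral t - gauge_integral (t + X n))) \<le> (\<integral>\<^sup>+x. \<integral>\<^sup>+y. v n (t, x, y) \<partial>lborel \<partial>lborel)"
      proof (cases "t > 0")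
        case True
        have "ennreal (1 / X n) * ennreal (gauge_integral t - gauge_integral (t + X n)) \<le> ennreal (1 / X n) * (\<integral>\<^sup>+x. \<integral>\<^sup>+y. ennreal (B (P t a x) (P t b x) (P t a y) (P t b y) * k (X n) (y - x)) \<partial>lborel \<partial>lborel)"
          by (intro mult_left_mono gauge_integral_step_lower less_imp_le[OF True] X(2)) auto
        also have "\<dots> = (\<integral>\<^sup>+x. \<integral>\<^sup>+y. ennreal (1 / X n) * ennreal (B (P t a x) (P t b x) (P t a y) (P t b y) * k (X n) (y - x)) \<partial>lborel \<partial>lborel)"
          by (subst nn_integral_cmult, measurable)+
        also have "\<dots> = (\<integral>\<^sup>+x. \<integral>\<^sup>+y. v n (t, x, y) \<partial>lborel \<partial>lborel)"
          using True by (simp add: v_def scale[symmetric])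
        finally show ?thesis using True by simp
      qed simp
    qed
    also have "\<dots> = (\<integral>\<^sup>+z. v n z \<partial>?M)" by (rule nn_integral_triple) measurable
    finally show ?thesis .
  qed
  have f_lim_u: "f z \<le> liminf (\<lambda>n. u n z)" for z
  proof -
    obtain t x y where z: "z = (t, x, y)" by (cases z) auto
    show ?thesis
    proof (cases "t > 0 \<and> x \<noteq> y")
      case True
      have tX: "(\<lambda>n. t + X n) \<longlonglongrightarrow> t" using tendsto_add[OF tendsto_const X(1), of t] by simp
      note Pl = P_time_continuous[OF p1 _ _ tX, of _ x]
      have lim: "(\<lambda>n. B (P (t + X n) a x) (P (t + X n) b x) (P t a y) (P t b y) * (k (X n) (y - x) / X n)) \<longlonglongrightarrow> B (P t a x) (P t b x) (P t a y) (P t b y) * \<nu> (y - x)"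
        using True X by (intro tendsto_mult B_tendsto Pl a_Lp b_Lp klim) (auto simp: less_imp_le)
      have "(\<lambda>n. u n z) \<longlonglongrightarrow> f z"
        using tendsto_ennrealI[OF lim] True by (simp add: u_def f_def z)
      then show ?thesis by (simp add: lim_imp_Liminf)
    qed (auto simp: f_def z)
  qed
  have fin: "(\<integral>\<^sup>+z. f z \<partial>?M) \<le> ennreal (gauge_integral 0)"
  proof -
    have "(\<integral>\<^sup>+z. f z \<partial>?M) \<le> (\<integral>\<^sup>+z. liminf (\<lambda>n. u n z) \<partial>?M)" by (intro nn_integral_mono f_lim_u)
    also have "\<dots> \<le> liminf (\<lambda>n. \<integral>\<^sup>+z. u n z \<partial>?M)" by (rule nn_integral_liminf) measurable
    also have "\<dots> \<le> liminf (\<lambda>n. ennreal (gauge_integral 0))" by (intro Liminf_mono always_eventually allI u_up)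
    also have "\<dots> = ennreal (gauge_integral 0)" by (simp add: Liminf_const)
    finally show ?thesis .
  qed
  have nnB: "0 \<le> B (P t a x) (P t b x) (P t a y) (P t b y)" if "t > 0" for t x y
    using that by (intro bregman_nonneg Pa_nonneg) auto
  have "(\<lambda>n. \<integral>\<^sup>+z. v n z \<partial>?M) \<longlonglongrightarrow> (\<integral>\<^sup>+z. f z \<partial>?M)"
  proof (rule nn_integral_dominated_convergence)
    show "AE z in ?M. v n z \<le> ennreal c * f z" for n
    proof (intro AE_I2)
      fix z :: "real \<times> 'a \<times> 'a"
      obtain t x y where z: "z = (t, x, y)" by (cases z) auto
      show "v n z \<le> ennreal c * f z"
      proof (cases "t > 0 \<and> x \<noteq> y")
        case True
        have "B (P t a x) (P t b x) (P t a y) (P t b y) * (k (X n) (y - x) / X n) \<le> B (P t a x) (P t b x) (P t a y) (P t b y) * (c * \<nu> (y - x))"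
          using True by (intro mult_left_mono k_bound X nnB) auto
        then show ?thesis using True c_nonneg
          by (simp add: v_def f_def z ennreal_mult'[symmetric] ennreal_leI mult.left_commute)
      qed (auto simp: v_def z)
    qed
    have "(\<integral>\<^sup>+z. ennreal c * f z \<partial>?M) = ennreal c * (\<integral>\<^sup>+z. f z \<partial>?M)" by (rule nn_integral_cmult) measurable
    also have "\<dots> < \<infinity>" using le_less_trans[OF fin ennreal_less_top] by (simp add: ennreal_mult_less_top)
    finally show "(\<integral>\<^sup>+z. ennreal c * f z \<partial>?M) < \<infinity>" .
    show "AE z in ?M. (\<lambda>n. v n z) \<longlonglongrightarrow> f z"
    proof (intro AE_I2)
      fix z :: "real \<times> 'a \<times> 'a"
      obtain t x y where z: "z = (t, x, y)" by (cases z) auto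
      show "(\<lambda>n. v n z) \<longlonglongrightarrow> f z"
      proof (cases "t > 0 \<and> x \<noteq> y")
        case True
        have lim: "(\<lambda>n. B (P t a x) (P t b x) (P t a y) (P t b y) * (k (X n) (y - x) / X n)) \<longlonglongrightarrow> B (P t a x) (P t b x) (P t a y) (P t b y) * \<nu> (y - x)"
          using True by (intro tendsto_mult tendsto_const klim) auto
        show ?thesis using tendsto_ennrealI[OF lim] True by (simp add: v_def f_def z)
      qed (auto simp: f_def v_def z)
    qed
  qed measurable
  then have low_T: "ennreal (gauge_integral 0 - gauge_integral T) \<le> (\<integral>\<^sup>+z. f z \<partial>?M)" if "T > 0" for T
    by (rule LIMSEQ_le[OF tendsto_ennrealI[OF tendsto_diff[OF gauge_integral_short_time[OF X(1,2)] tendsto_const]]])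
       (use v_low[OF that] in auto)
  have low: "ennreal (gauge_integral 0) \<le> (\<integral>\<^sup>+z. f z \<partial>?M)"
  proof -
    have "(\<lambda>n. gauge_integral (real (Suc n))) \<longlonglongrightarrow> 0"
      by (rule gauge_integral_long_time[OF filterlim_compose[OF filterlim_real_sequentially filterlim_Suc]]) simp
    then have "(\<lambda>n. ennreal (gauge_integral 0 - gauge_integral (real (Suc n)))) \<longlonglongrightarrow> ennreal (gauge_integral 0 - 0)"
      by (intro tendsto_ennrealI tendsto_diff tendsto_const)
    from LIMSEQ_le_const2[OF this] show ?thesis using low_T by auto
  qed
  have "(\<integral>\<^sup>+t. \<integral>\<^sup>+x. \<integral>\<^sup>+y. f (t, x, y) \<partial>lborel \<partial>lborel \<partial>lborel) = (\<integral>\<^sup>+z. f z \<partial>?M)"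
    by (rule nn_integral_triple) measurable
  also have "\<dots> = ennreal (gauge_integral 0)" using fin low by (rule antisym)
  finally show ?thesis by (simp add: f_def gauge_integral_def)
qed

end

end

section \<open>Polarization\<close>

lemma bregman_codiv_diff_left:
  "bregman_codiv p (w1 - w1', w2) (z1 - z1', z2) = bregman_codiv p (w1, w2) (z1, z2) - bregman_codiv p (w1', w2) (z1', z2)"
  by (simp add: algebra_simps)

lemma bregman_codiv_diag [simp]: "bregman_codiv p w w = 0"
  by (cases w) simp

context levy_kernel
begin

definition codiv_integrand :: "real \<Rightarrow> ('a \<Rightarrow> real) \<Rightarrow> ('a \<Rightarrow> real) \<Rightarrow> real \<times> 'a \<times> 'a \<Rightarrow> real" where
  "codiv_integrand p f g = (\<lambda>(t, x, y). indicator {0<..} t *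
     (bregman_codiv p (P t f x, P t g x) (P t f y, P t g y) * \<nu> (y - x)))"

text \<open>The difference of the identity for \<open>(f, g)\<close> and the one for \<open>(f, -g)\<close>.\<close>

lemma codiv_integrand_nonneg_case:
  assumes p: "p \<ge> 2" and f: "Lp_fun p f" and g: "Lp_fun p g" and nn: "\<And>x. f x \<ge> 0"
  shows "has_bochner_integral (lborel \<Otimes>\<^sub>M (lborel \<Otimes>\<^sub>M lborel)) (codiv_integrand p f g) (LINT x|lborel. f x * signed_pow (g x) (p - 1))"
    and "integrable lborel (\<lambda>x. f x * signed_pow (g x) (p - 1))"
proof -
  interpret hs: hardy_stein k \<nu> c "gauge p" "gauge_D1 p" "gauge_D2 p" p "gauge_bound p"
    by (intro hardy_stein.intro levy_kernel_axioms gauge_convex_gauge p)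
  let ?M = "lborel \<Otimes>\<^sub>M (lborel \<Otimes>\<^sub>M lborel) :: (real \<times> 'a \<times> 'a) measure"
  define q where "q b = (\<lambda>(t, x, y). indicator {0<..} t * (hs.B (P t f x) (P t b x) (P t f y) (P t b y) * \<nu> (y - x)))" for b
  have fm[measurable]: "f \<in> borel_measurable borel" using f by auto
  have q: "has_bochner_integral ?M (q b) (LINT x|lborel. gauge p (f x) (b x))" if b: "Lp_fun p b" for b
  proof (rule has_bochner_integral_nn_integral)
    have [measurable]: "b \<in> borel_measurable borel" using b by auto
    show m[measurable]: "q b \<in> borel_measurable ?M" unfolding q_def by measurable
    show "AE z in ?M. 0 \<le> q b z"
    proof (intro AE_I2)
      fix z :: "real \<times> 'a \<times> 'a"
      obtain t x y where z: "z = (t, x, y)" by (cases z) auto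
      show "0 \<le> q b z"
      proof (cases "t > 0 \<and> x \<noteq> y")
        case True
        then have "0 \<le> hs.B (P t f x) (P t b x) (P t f y) (P t b y)" "0 \<le> \<nu> (y - x)"
          using \<nu>_pos[of "y - x"] by (auto intro!: hs.bregman_nonneg P_nonneg nn)
        then show ?thesis by (simp add: q_def z)
      qed (auto simp: q_def z)
    qed
    show "0 \<le> (LINT x|lborel. gauge p (f x) (b x))"
      by (intro Bochner_Integration.integral_nonneg hs.Y_nonneg nn)
    have "(\<integral>\<^sup>+z. ennreal (q b z) \<partial>?M) = (\<integral>\<^sup>+t. \<integral>\<^sup>+x. \<integral>\<^sup>+y. ennreal (q b (t, x, y)) \<partial>lborel \<partial>lborel \<partial>lborel)"
      by (rule nn_integral_triple[symmetric]) measurable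
    also have "\<dots> = (\<integral>\<^sup>+t. \<integral>\<^sup>+x. \<integral>\<^sup>+y. indicator {0<..} t * ennreal (hs.B (P t f x) (P t b x) (P t f y) (P t b y) * \<nu> (y - x)) \<partial>lborel \<partial>lborel \<partial>lborel)"
      by (intro nn_integral_cong) (auto simp: q_def indicator_def)
    also have "\<dots> = ennreal (LINT x|lborel. gauge p (f x) (b x))" by (rule hs.convex_hardy_stein[OF f b nn])
    finally show "(\<integral>\<^sup>+z. ennreal (q b z) \<partial>?M) = ennreal (LINT x|lborel. gauge p (f x) (b x))" .
  qed
  have e: "codiv_integrand p f g = (\<lambda>z. q g z - q (\<lambda>x. - g x) z)"
    by (auto simp: codiv_integrand_def q_def fun_eq_iff bregman_codiv_polarization[OF p] P_minus algebra_simps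
        simp del: bregman_codiv.simps)
  note i = hs.Y_integrable[OF f g] hs.Y_integrable[OF f Lp_fun_minus[OF g]]
  have E: "f x * signed_pow (g x) (p - 1) = gauge p (f x) (g x) - gauge p (f x) (- g x)" for x
    by (simp add: gauge_odd_part[OF p])
  show "integrable lborel (\<lambda>x. f x * signed_pow (g x) (p - 1))" unfolding E by (intro Bochner_Integration.integrable_diff i)
  have "(LINT x|lborel. f x * signed_pow (g x) (p - 1)) = (LINT x|lborel. gauge p (f x) (g x)) - (LINT x|lborel. gauge p (f x) (- g x))"
    unfolding E using i by simp
  then show "has_bochner_integral ?M (codiv_integrand p f g) (LINT x|lborel. f x * signed_pow (g x) (p - 1))"
    unfolding e using has_bochner_integral_diff[OF q[OF g] q[OF Lp_fun_minus[OF g]]] by simp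
qed

lemma codiv_integrand_integral:
  assumes p: "p \<ge> 2" and f: "Lp_fun p f" and g: "Lp_fun p g"
  shows "has_bochner_integral (lborel \<Otimes>\<^sub>M (lborel \<Otimes>\<^sub>M lborel)) (codiv_integrand p f g) (LINT x|lborel. f x * signed_pow (g x) (p - 1))"
proof -
  define f1 f2 where "f1 x = max 0 (f x)" and "f2 x = max 0 (- f x)" for x
  have fm[measurable]: "f \<in> borel_measurable borel" using f by auto
  have f12: "f x = f1 x - f2 x" for x by (auto simp: f1_def f2_def)
  have [measurable]: "f1 \<in> borel_measurable borel" "f2 \<in> borel_measurable borel"
    unfolding f1_def[abs_def] f2_def[abs_def] by measurable
  have Lp: "Lp_fun p f1" "Lp_fun p f2"
    using p by (auto intro!: Lp_fun_mono[OF f] simp: f1_def f2_def)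
  have nn: "f1 x \<ge> 0" "f2 x \<ge> 0" for x by (auto simp: f1_def f2_def)
  note c1 = codiv_integrand_nonneg_case[OF p Lp(1) g nn(1)] and c2 = codiv_integrand_nonneg_case[OF p Lp(2) g nn(2)]
  have Pf: "P t f x = P t f1 x - P t f2 x" if "t > 0" for t x
    using P_diff[OF _ Lp, of t x] p that f12 by (metis less_imp_le order_trans one_le_numeral ext)
  have e: "codiv_integrand p f g = (\<lambda>z. codiv_integrand p f1 g z - codiv_integrand p f2 g z)"
    by (auto simp: codiv_integrand_def fun_eq_iff Pf bregman_codiv_diff_left indicator_def left_diff_distrib
        simp del: bregman_codiv.simps)
  have "(LINT x|lborel. f x * signed_pow (g x) (p - 1)) = (LINT x|lborel. f1 x * signed_pow (g x) (p - 1)) - (LINT x|lborel. f2 x * signed_pow (g x) (p - 1))"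
    using c1(2) c2(2) by (simp add: f12 left_diff_distrib)
  then show ?thesis unfolding e using has_bochner_integral_diff[OF c1(1) c2(1)] by simp
qed

theorem polarized_hardy_stein:
  assumes p: "p \<ge> 2" and f: "Lp_fun p f" and g: "Lp_fun p g"
  shows "(\<integral>\<^sup>+t\<in>{0..}. (\<integral>\<^sup>+y. (\<integral>\<^sup>+x. ennreal
            (\<bar>bregman_codiv p (P t f x, P t g x) (P t f y, P t g y)\<bar> * \<nu> (y - x)) \<partial>lborel) \<partial>lborel) \<partial>lborel) < \<infinity>"
    and "(LINT x|lborel. f x * signed_pow (g x) (p - 1)) =
         (LINT t:{0..}|lborel. (LINT y|lborel. (LINT x|lborel.
            bregman_codiv p (P t f x, P t g x) (P t f y, P t g y) * \<nu> (y - x))))"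
proof -
  let ?M = "lborel \<Otimes>\<^sub>M (lborel \<Otimes>\<^sub>M lborel) :: (real \<times> 'a \<times> 'a) measure"
  let ?J = "\<lambda>t x y. bregman_codiv p (P t f x, P t g x) (P t f y, P t g y)"
  note main = codiv_integrand_integral[OF p f g]
  have I: "integrable ?M (codiv_integrand p f g)" using main by (rule integrable.intros)
  have m[measurable]: "codiv_integrand p f g \<in> borel_measurable ?M" using I by auto
  \<comment> \<open>The integrand at \<open>t = 0\<close> need not be integrable in space, but a single time does not count.\<close>
  have AE0: "AE t in lborel. t \<noteq> (0::real)" by (rule AE_lborel_singleton)
  have abs: "ennreal (norm (codiv_integrand p f g (t, x, y))) = ennreal (\<bar>?J t x y\<bar> * \<nu> (y - x))" if "t > 0" for t x y
    using that \<nu>_pos[of "y - x"] by (cases "x = y") (auto simp: codiv_integrand_def abs_mult simp del: bregman_codiv.simps)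
  have "(\<integral>\<^sup>+t\<in>{0..}. (\<integral>\<^sup>+y. (\<integral>\<^sup>+x. ennreal (\<bar>?J t x y\<bar> * \<nu> (y - x)) \<partial>lborel) \<partial>lborel) \<partial>lborel)
     = (\<integral>\<^sup>+t. (\<integral>\<^sup>+x. (\<integral>\<^sup>+y. ennreal (norm (codiv_integrand p f g (t, x, y))) \<partial>lborel) \<partial>lborel) \<partial>lborel)"
  proof (rule nn_integral_cong_AE)
    show "AE t in lborel. (\<integral>\<^sup>+y. (\<integral>\<^sup>+x. ennreal (\<bar>?J t x y\<bar> * \<nu> (y - x)) \<partial>lborel) \<partial>lborel) * indicator {0..} t =
        (\<integral>\<^sup>+x. (\<integral>\<^sup>+y. ennreal (norm (codiv_integrand p f g (t, x, y))) \<partial>lborel) \<partial>lborel)"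
      using AE0
    proof eventually_elim
      case (elim t)
      show ?case
      proof (cases "t > 0")
        case True
        have "(\<integral>\<^sup>+y. (\<integral>\<^sup>+x. ennreal (norm (codiv_integrand p f g (t, x, y))) \<partial>lborel) \<partial>lborel) =
          (\<integral>\<^sup>+x. (\<integral>\<^sup>+y. ennreal (norm (codiv_integrand p f g (t, x, y))) \<partial>lborel) \<partial>lborel)"
          by (rule lborel_pair.Fubini') measurable
        then show ?thesis unfolding abs[OF True] using True by (simp del: bregman_codiv.simps)
      next
        case False
        then show ?thesis using elim by (simp add: codiv_integrand_def del: bregman_codiv.simps)
      qed
    qed
  qed
  also have "\<dots> = (\<integral>\<^sup>+z. ennreal (norm (codiv_integrand p f g z)) \<partial>?M)"
    by (rule nn_integral_triple) measurable
  also have "\<dots> < \<infinity>" using I by (simp add: integrable_iff_bounded)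
  finally show "(\<integral>\<^sup>+t\<in>{0..}. (\<integral>\<^sup>+y. (\<integral>\<^sup>+x. ennreal (\<bar>?J t x y\<bar> * \<nu> (y - x)) \<partial>lborel) \<partial>lborel) \<partial>lborel) < \<infinity>" .
  have L: "sigma_finite_measure (lborel \<Otimes>\<^sub>M lborel :: ('a \<times> 'a) measure)"
    by (simp add: lborel_prod sigma_finite_lborel)
  interpret R: pair_sigma_finite "lborel :: real measure" "lborel \<Otimes>\<^sub>M lborel :: ('a \<times> 'a) measure"
    by (intro pair_sigma_finite.intro L sigma_finite_lborel)
  have "(LINT x|lborel. f x * signed_pow (g x) (p - 1)) = integral\<^sup>L ?M (codiv_integrand p f g)"
    using main by (simp add: has_bochner_integral_integral_eq)
  also have "\<dots> = (LINT t|lborel. LINT w|(lborel \<Otimes>\<^sub>M lborel). codiv_integrand p f g (t, w))"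
    by (rule R.integral_fst'[OF I, symmetric])
  also have "\<dots> = (LINT t:{0..}|lborel. (LINT y|lborel. (LINT x|lborel. ?J t x y * \<nu> (y - x))))"
    unfolding set_lebesgue_integral_def
  proof (rule integral_cong_AE)
    show "(\<lambda>t. LINT w|(lborel \<Otimes>\<^sub>M lborel). codiv_integrand p f g (t, w)) \<in> borel_measurable lborel"
      using R.integrable_fst'[OF I] by auto
    have eq: "AE t in lborel. (LINT w|(lborel \<Otimes>\<^sub>M lborel). codiv_integrand p f g (t, w)) =
        indicator {0..} t *\<^sub>R (LINT y|lborel. LINT x|lborel. ?J t x y * \<nu> (y - x))"
      using AE0 R.AE_integrable_fst'[OF I]
    proof eventually_elim
      case (elim t)
      show ?case
      proof (cases "t > 0")
        case True
        have e: "(\<lambda>w. codiv_integrand p f g (t, w)) = (\<lambda>(x, y). ?J t x y * \<nu> (y - x))"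
          using True by (auto simp: codiv_integrand_def fun_eq_iff simp del: bregman_codiv.simps)
        have i: "integrable (lborel \<Otimes>\<^sub>M lborel) (\<lambda>(x, y). ?J t x y * \<nu> (y - x))" using elim(2) unfolding e .
        have "(LINT w|(lborel \<Otimes>\<^sub>M lborel). codiv_integrand p f g (t, w)) = (LINT y|lborel. LINT x|lborel. ?J t x y * \<nu> (y - x))"
          unfolding e by (rule lborel_pair.integral_snd[OF i, symmetric])
        then show ?thesis using True by simp
      next
        case False
        then show ?thesis using elim by (simp add: codiv_integrand_def case_prod_beta del: bregman_codiv.simps)
      qed
    qed
    show "AE t in lborel. (LINT w|(lborel \<Otimes>\<^sub>M lborel). codiv_integrand p f g (t, w)) =
        indicator {0..} t *\<^sub>R (LINT y|lborel. LINT x|lborel. ?J t x y * \<nu> (y - x))" by (rule eq)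
    have [measurable]: "f \<in> borel_measurable borel" "g \<in> borel_measurable borel" using f g by auto
    show "(\<lambda>t. indicator {0..} t *\<^sub>R (LINT y|lborel. LINT x|lborel. ?J t x y * \<nu> (y - x))) \<in> borel_measurable lborel"
      unfolding bregman_codiv.simps signed_pow_def abs_pow_def by measurable
  qed
  finally show "(LINT x|lborel. f x * signed_pow (g x) (p - 1)) =
     (LINT t:{0..}|lborel. (LINT y|lborel. (LINT x|lborel. ?J t x y * \<nu> (y - x))))" .
qed

end

section \<open>Cosine transforms and Gaussians\<close>

lemma lborel_integral_prod:
  fixes f :: "'a::euclidean_space \<Rightarrow> real \<Rightarrow> 'b::{real_normed_field, banach, second_countable_topology}"
  assumes f: "\<And>b. b \<in> Basis \<Longrightarrow> integrable lborel (f b)"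
  shows "integrable lborel (\<lambda>x. \<Prod>b\<in>Basis. f b (x \<bullet> b))"
    and "(LINT x|lborel. (\<Prod>b\<in>Basis. f b (x \<bullet> b))) = (\<Prod>b\<in>Basis. (LINT x|lborel. f b x))"
proof -
  interpret product_sigma_finite "\<lambda>_::'a. lborel :: real measure" ..
  have [measurable]: "b \<in> Basis \<Longrightarrow> f b \<in> borel_measurable borel" for b using f[of b] by auto
  let ?T = "\<lambda>g. \<Sum>b\<in>(Basis::'a set). g b *\<^sub>R b"
  let ?M = "\<Pi>\<^sub>M b\<in>(Basis::'a set). (lborel :: real measure)"
  have T: "?T \<in> measurable ?M borel" by measurable
  have c: "?T g \<bullet> b = g b" if "b \<in> Basis" for g b
    using that by (simp add: inner_sum_left inner_Basis if_distrib cong: if_cong)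
  have m: "(\<lambda>x. \<Prod>b\<in>Basis. f b (x \<bullet> b)) \<in> borel_measurable (borel :: 'a measure)" by measurable
  have e: "(\<lambda>g. \<Prod>b\<in>Basis. f b (?T g \<bullet> b)) = (\<lambda>g. \<Prod>b\<in>Basis. f b (g b))"
    by (intro ext prod.cong refl) (simp add: c)
  show "integrable lborel (\<lambda>x. \<Prod>b\<in>Basis. f b (x \<bullet> b))"
    by (subst lborel_eq, subst integrable_distr_eq[OF T m], subst e, rule product_integrable_prod) (use f in auto)
  show "(LINT x|lborel. (\<Prod>b\<in>Basis. f b (x \<bullet> b))) = (\<Prod>b\<in>Basis. (LINT x|lborel. f b x))"
    by (subst lborel_eq, subst integral_distr[OF T m], subst e, rule product_integral_prod) (use f in auto)
qed

lemma lborel_integral_affine: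
  fixes f :: "'a::euclidean_space \<Rightarrow> 'b::{banach, second_countable_topology}"
  assumes [measurable]: "f \<in> borel_measurable borel" and s: "s \<noteq> 0"
  shows "(LINT y|lborel. f y) = \<bar>s\<bar> ^ DIM('a) *\<^sub>R (LINT y|lborel. f (a + s *\<^sub>R y))"
  by (subst lborel_affine[OF s, of a]) (simp add: integral_density integral_distr)

lemma lborel_integral_reflect:
  fixes f :: "'a::euclidean_space \<Rightarrow> 'b::{banach, second_countable_topology}"
  assumes "f \<in> borel_measurable borel"
  shows "(LINT y|lborel. f (- y)) = (LINT y|lborel. f y)"
  using lborel_integral_affine[OF assms, of "-1" 0] by simp

text \<open>The characteristic function of the normal distribution, rescaled.\<close>

lemma gaussian_char_real:
  fixes s t :: real assumes s: "s > 0"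
  shows "integrable lborel (\<lambda>x. iexp (t * x) * complex_of_real (exp (- (s * x)\<^sup>2 / 2)))"
    and "(CLINT x|lborel. iexp (t * x) * complex_of_real (exp (- (s * x)\<^sup>2 / 2))) =
      complex_of_real (sqrt (2 * pi) / s * exp (- (t / s)\<^sup>2 / 2))"
proof -
  define F where "F x = iexp (t / s * x) * complex_of_real (exp (- x\<^sup>2 / 2))" for x :: real
  have [measurable]: "F \<in> borel_measurable borel" unfolding F_def by measurable
  have e: "std_normal_density x *\<^sub>R iexp (t / s * x) = complex_of_real (1 / sqrt (2 * pi)) * F x" for x
    by (simp add: std_normal_density_def F_def scaleR_conv_of_real mult_ac)
  interpret N: prob_space std_normal_distribution by (rule prob_space_normal_density) simp
  have "integrable std_normal_distribution (\<lambda>x. iexp (t / s * x))"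
    by (rule N.integrable_const_bound[where B = 1]) auto
  then have "integrable lborel (\<lambda>x. std_normal_density x *\<^sub>R iexp (t / s * x))"
    by (subst (asm) integrable_density) auto
  then have "integrable lborel (\<lambda>x. complex_of_real (sqrt (2 * pi)) * (complex_of_real (1 / sqrt (2 * pi)) * F x))"
    unfolding e by (rule integrable_mult_right)
  moreover have "complex_of_real (sqrt (2 * pi)) * (complex_of_real (1 / sqrt (2 * pi)) * z) = z" for z
    unfolding mult.assoc[symmetric] of_real_mult[symmetric] by simp
  ultimately have FI: "integrable lborel F" by simp
  have "char std_normal_distribution (t / s) = (CLINT x|lborel. std_normal_density x *\<^sub>R iexp (t / s * x))"
    unfolding char_def by (subst integral_density) auto
  also have "\<dots> = complex_of_real (1 / sqrt (2 * pi)) * (CLINT x|lborel. F x)"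
    unfolding e by (rule integral_mult_right_zero)
  finally have "complex_of_real (exp (- ((t / s)\<^sup>2) / 2)) = complex_of_real (1 / sqrt (2 * pi)) * (CLINT x|lborel. F x)"
    by (simp only: char_std_normal_distribution)
  then have Fint: "(CLINT x|lborel. F x) = complex_of_real (sqrt (2 * pi) * exp (- (t / s)\<^sup>2 / 2))"
    by (simp add: field_simps)
  have Fe: "iexp (t * x) * complex_of_real (exp (- (s * x)\<^sup>2 / 2)) = F (0 + s * x)" for x
    using s by (simp add: F_def)
  show "integrable lborel (\<lambda>x. iexp (t * x) * complex_of_real (exp (- (s * x)\<^sup>2 / 2)))"
    unfolding Fe using s by (intro lborel_integrable_real_affine FI) auto
  have "(CLINT x|lborel. F x) = \<bar>s\<bar> *\<^sub>R (CLINT x|lborel. F (0 + s * x))" using s by (intro lborel_integral_real_affine) auto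
  then show "(CLINT x|lborel. iexp (t * x) * complex_of_real (exp (- (s * x)\<^sup>2 / 2))) =
      complex_of_real (sqrt (2 * pi) / s * exp (- (t / s)\<^sup>2 / 2))"
    unfolding Fe using s Fint by (simp add: scaleR_conv_of_real field_simps)
qed

definition gaussian :: "real \<Rightarrow> 'a::euclidean_space \<Rightarrow> real" where
  "gaussian s x = exp (- (s * norm x)\<^sup>2 / 2)"

lemma gaussian_measurable [measurable]: "gaussian s \<in> borel_measurable borel"
  unfolding gaussian_def[abs_def] by measurable

lemma gaussian_bounds: "0 \<le> gaussian s x" "gaussian s x \<le> 1" "0 < gaussian s x"
  by (auto simp: gaussian_def)

lemma gaussian_prod: "gaussian s x = (\<Prod>b\<in>Basis. exp (- (s * (x \<bullet> b))\<^sup>2 / 2))"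
proof -
  have "(norm x)\<^sup>2 = (\<Sum>b\<in>Basis. (x \<bullet> b)\<^sup>2)"
    by (subst (1) power2_norm_eq_inner, subst euclidean_inner) (simp add: power2_eq_square)
  then have "- (s * norm x)\<^sup>2 / 2 = (\<Sum>b\<in>Basis. - (s * (x \<bullet> b))\<^sup>2 / 2)"
    by (simp add: power_mult_distrib sum_distrib_left sum_divide_distrib sum_negf)
  then show ?thesis by (simp add: gaussian_def exp_sum)
qed

lemma gaussian_char:
  fixes \<xi> :: "'a::euclidean_space" assumes s: "s > 0"
  shows "integrable lborel (\<lambda>x::'a. gaussian s x)"
    and "(LINT x|lborel. cos (\<xi> \<bullet> x) * gaussian s x) = (sqrt (2 * pi) / s) ^ DIM('a) * gaussian (1 / s) \<xi>"
proof -
  let ?f = "\<lambda>b x. iexp ((\<xi> \<bullet> b) * x) * complex_of_real (exp (- (s * x)\<^sup>2 / 2))"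
  note * = lborel_integral_prod[of ?f, OF gaussian_char_real(1)[OF s]]
  have e: "(\<Prod>b\<in>Basis. ?f b (x \<bullet> b)) = iexp (\<xi> \<bullet> x) * complex_of_real (gaussian s x)" for x :: 'a
  proof -
    have "\<i> * complex_of_real (\<xi> \<bullet> x) = (\<Sum>b\<in>Basis. \<i> * complex_of_real ((\<xi> \<bullet> b) * (x \<bullet> b)))"
      by (subst euclidean_inner) (simp add: sum_distrib_left)
    then have "iexp (\<xi> \<bullet> x) = (\<Prod>b\<in>Basis. iexp ((\<xi> \<bullet> b) * (x \<bullet> b)))" by (simp add: exp_sum)
    then show ?thesis by (simp add: gaussian_prod prod.distrib)
  qed
  have I: "integrable lborel (\<lambda>x. iexp (\<xi> \<bullet> x) * complex_of_real (gaussian s x))" using *(1) unfolding e .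
  have "integrable lborel (\<lambda>x. norm (iexp (\<xi> \<bullet> x) * complex_of_real (gaussian s x)))" using I by (rule integrable_norm)
  then show "integrable lborel (\<lambda>x::'a. gaussian s x)" by (simp add: norm_mult gaussian_bounds)
  have "(CLINT x|lborel. iexp (\<xi> \<bullet> x) * complex_of_real (gaussian s x)) = (\<Prod>b\<in>Basis. complex_of_real (sqrt (2 * pi) / s * exp (- ((\<xi> \<bullet> b) / s)\<^sup>2 / 2)))"
    using *(2) unfolding e gaussian_char_real(2)[OF s] .
  also have "\<dots> = complex_of_real ((sqrt (2 * pi) / s) ^ DIM('a) * gaussian (1 / s) \<xi>)"
  proof -
    have "(\<Prod>b\<in>Basis. sqrt (2 * pi) / s * exp (- ((\<xi> \<bullet> b) / s)\<^sup>2 / 2)) = (sqrt (2 * pi) / s) ^ DIM('a) * gaussian (1 / s) \<xi>"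
      unfolding prod.distrib prod_constant by (simp add: gaussian_prod)
    then show ?thesis by (simp only: of_real_prod[symmetric])
  qed
  finally have "Re (CLINT x|lborel. iexp (\<xi> \<bullet> x) * complex_of_real (gaussian s x)) = (sqrt (2 * pi) / s) ^ DIM('a) * gaussian (1 / s) \<xi>"
    by simp
  moreover have "Re (CLINT x|lborel. iexp (\<xi> \<bullet> x) * complex_of_real (gaussian s x)) = (LINT x|lborel. cos (\<xi> \<bullet> x) * gaussian s x)"
    by (subst integral_Re[OF I, symmetric]) (simp add: Re_exp)
  ultimately show "(LINT x|lborel. cos (\<xi> \<bullet> x) * gaussian s x) = (sqrt (2 * pi) / s) ^ DIM('a) * gaussian (1 / s) \<xi>" by simp
qed

lemma gaussian_tendsto_1:
  assumes "s \<longlonglongrightarrow> 0" shows "(\<lambda>n. gaussian (s n) x) \<longlonglongrightarrow> 1"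
proof -
  have "(\<lambda>n. exp (- (s n * norm x)\<^sup>2 / 2)) \<longlonglongrightarrow> exp (- (0 * norm x)\<^sup>2 / 2)"
    by (intro tendsto_exp tendsto_divide tendsto_minus tendsto_power tendsto_mult tendsto_const assms) simp
  then show ?thesis by (simp add: gaussian_def)
qed

definition cos_transform :: "('a::euclidean_space \<Rightarrow> real) \<Rightarrow> 'a \<Rightarrow> real" where
  "cos_transform f x = (LINT \<xi>|lborel. cos (\<xi> \<bullet> x) * f \<xi>)"

lemma cos_times_integrable:
  assumes "integrable lborel f" shows "integrable lborel (\<lambda>\<xi>. cos (\<xi> \<bullet> x) * f \<xi>)"
proof -
  have [measurable]: "f \<in> borel_measurable borel" using assms by auto
  show ?thesis
    by (rule Bochner_Integration.integrable_bound[OF assms])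
       (auto simp: abs_mult intro!: AE_I2 mult_left_le_one_le)
qed

lemma sin_times_integrable:
  assumes "integrable lborel f" shows "integrable lborel (\<lambda>\<xi>. sin (\<xi> \<bullet> x) * f \<xi>)"
proof -
  have [measurable]: "f \<in> borel_measurable borel" using assms by auto
  show ?thesis
    by (rule Bochner_Integration.integrable_bound[OF assms])
       (auto simp: abs_mult intro!: AE_I2 mult_left_le_one_le)
qed

lemma cos_transform_measurable [measurable]:
  assumes [measurable]: "f \<in> borel_measurable borel"
  shows "cos_transform f \<in> borel_measurable borel"
  unfolding cos_transform_def[abs_def] by measurable

lemma cos_transform_bound:
  assumes "integrable lborel f" shows "\<bar>cos_transform f x\<bar> \<le> (LINT \<xi>|lborel. \<bar>f \<xi>\<bar>)"
proof -
  have "\<bar>cos_transform f x\<bar> \<le> (LINT \<xi>|lborel. \<bar>cos (\<xi> \<bullet> x) * f \<xi>\<bar>)"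
    unfolding cos_transform_def using integral_norm_bound[of lborel "\<lambda>\<xi>. cos (\<xi> \<bullet> x) * f \<xi>"] by simp
  also have "\<dots> \<le> (LINT \<xi>|lborel. \<bar>f \<xi>\<bar>)"
    using assms by (intro integral_mono integrable_abs cos_times_integrable) (auto simp: abs_mult intro!: mult_left_le_one_le)
  finally show ?thesis .
qed

lemma product_integrable_pair:
  fixes f g :: "'a::euclidean_space \<Rightarrow> real"
  assumes f: "integrable lborel f" and g: "integrable lborel g"
  shows "integrable (lborel \<Otimes>\<^sub>M lborel) (\<lambda>(x, y). f x * g y)"
proof (rule lborel_pair.Fubini_integrable)
  have [measurable]: "f \<in> borel_measurable borel" "g \<in> borel_measurable borel" using f g by auto
  show "(\<lambda>(x, y). f x * g y) \<in> borel_measurable (lborel \<Otimes>\<^sub>M lborel)" by measurable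
qed (use f g in \<open>auto simp: abs_mult\<close>)

text \<open>By \<open>2 cos \<alpha> cos \<beta> = cos (\<alpha> + \<beta>) + cos (\<alpha> - \<beta>)\<close>, the cosine transform of the product is the average of
translates of the transform of \<open>h\<close> with the weight \<open>m\<close>.\<close>

lemma cos_transform_times_nonneg:
  assumes h: "integrable lborel h" and pos: "\<And>x. cos_transform h x \<ge> 0"
    and m: "integrable lborel m" and m_nonneg: "\<And>y. m y \<ge> 0"
  shows "integrable lborel (\<lambda>\<xi>. h \<xi> * cos_transform m \<xi>)"
    and "cos_transform (\<lambda>\<xi>. h \<xi> * cos_transform m \<xi>) x \<ge> 0"
proof -
  have [measurable]: "h \<in> borel_measurable borel" "m \<in> borel_measurable borel" using h m by auto
  define \<Lambda> where "\<Lambda> = (LINT \<xi>|lborel. \<bar>m \<xi>\<bar>)"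
  have \<Lambda>: "\<bar>cos_transform m \<xi>\<bar> \<le> \<Lambda>" for \<xi> unfolding \<Lambda>_def by (rule cos_transform_bound[OF m])
  show "integrable lborel (\<lambda>\<xi>. h \<xi> * cos_transform m \<xi>)"
  proof (rule Bochner_Integration.integrable_bound)
    show "integrable lborel (\<lambda>\<xi>. h \<xi> * \<Lambda>)" using h by simp
    show "AE \<xi> in lborel. norm (h \<xi> * cos_transform m \<xi>) \<le> norm (h \<xi> * \<Lambda>)"
      using \<Lambda> by (auto simp: abs_mult intro!: AE_I2 mult_left_mono intro: order_trans[OF _ abs_ge_self])
  qed measurable
  let ?F = "\<lambda>\<xi> y. cos (\<xi> \<bullet> x) * h \<xi> * (cos (y \<bullet> \<xi>) * m y)"
  have I: "integrable (lborel \<Otimes>\<^sub>M lborel) (\<lambda>(\<xi>, y). ?F \<xi> y)"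
  proof (rule Bochner_Integration.integrable_bound[OF product_integrable_pair[OF h m]])
    show "AE z in lborel \<Otimes>\<^sub>M lborel. norm (case z of (\<xi>, y) \<Rightarrow> ?F \<xi> y) \<le> norm (case z of (\<xi>, y) \<Rightarrow> h \<xi> * m y)"
      by (auto simp: abs_mult intro!: AE_I2 mult_mono mult_left_le_one_le)
  qed measurable
  have inner: "(LINT \<xi>|lborel. ?F \<xi> y) = m y * (cos_transform h (x + y) + cos_transform h (x - y)) / 2" for y
  proof -
    have "?F \<xi> y = m y / 2 * (cos (\<xi> \<bullet> (x + y)) * h \<xi> + cos (\<xi> \<bullet> (x - y)) * h \<xi>)" for \<xi>
      by (simp add: inner_add_right inner_diff_right cos_add cos_diff inner_commute[of y] algebra_simps)
    then have "(LINT \<xi>|lborel. ?F \<xi> y) = (LINT \<xi>|lborel. m y / 2 * (cos (\<xi> \<bullet> (x + y)) * h \<xi> + cos (\<xi> \<bullet> (x - y)) * h \<xi>))"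
      by (simp only:)
    then show ?thesis using cos_times_integrable[OF h] by (simp add: cos_transform_def)
  qed
  have "cos_transform (\<lambda>\<xi>. h \<xi> * cos_transform m \<xi>) x = (LINT \<xi>|lborel. LINT y|lborel. ?F \<xi> y)"
    by (simp add: cos_transform_def mult.assoc)
  also have "\<dots> = (LINT y|lborel. LINT \<xi>|lborel. ?F \<xi> y)" by (rule lborel_pair.Fubini_integral[OF I, symmetric])
  also have "\<dots> \<ge> 0" unfolding inner
    using pos m_nonneg by (intro Bochner_Integration.integral_nonneg) auto
  finally show "cos_transform (\<lambda>\<xi>. h \<xi> * cos_transform m \<xi>) x \<ge> 0" .
qed

lemma cos_transform_times_exp_nonneg:
  assumes h: "integrable lborel h" and pos: "\<And>x. cos_transform h x \<ge> 0"
    and m: "integrable lborel m" and m_nonneg: "\<And>y. m y \<ge> 0" and t: "t \<ge> 0"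
  shows "cos_transform (\<lambda>\<xi>. h \<xi> * exp (t * cos_transform m \<xi>)) x \<ge> 0"
proof -
  have [measurable]: "h \<in> borel_measurable borel" "m \<in> borel_measurable borel" using h m by auto
  let ?q = "\<lambda>n \<xi>. h \<xi> * cos_transform m \<xi> ^ n"
  have q: "integrable lborel (?q n) \<and> (\<forall>x. cos_transform (?q n) x \<ge> 0)" for n
  proof (induction n)
    case 0 then show ?case using h pos by simp
  next
    case (Suc n)
    have e: "?q (Suc n) = (\<lambda>\<xi>. ?q n \<xi> * cos_transform m \<xi>)" by (simp add: mult_ac)
    show ?case unfolding e using cos_transform_times_nonneg[OF _ _ m m_nonneg, of "?q n"] Suc by blast
  qed
  define \<Lambda> where "\<Lambda> = (LINT \<xi>|lborel. \<bar>m \<xi>\<bar>)"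
  have \<Lambda>: "\<bar>cos_transform m \<xi>\<bar> \<le> \<Lambda>" for \<xi> unfolding \<Lambda>_def by (rule cos_transform_bound[OF m])
  let ?S = "\<lambda>N \<xi>. \<Sum>n<N. (t * cos_transform m \<xi>) ^ n / fact n"
  have S_bound: "\<bar>?S N \<xi>\<bar> \<le> exp (t * \<Lambda>)" for N \<xi>
  proof -
    have "\<bar>?S N \<xi>\<bar> \<le> (\<Sum>n<N. (t * \<Lambda>) ^ n / fact n)"
      using t \<Lambda> by (intro order_trans[OF sum_abs] sum_mono) (auto simp: power_abs abs_mult intro!: divide_right_mono power_mono mult_left_mono)
    also have "\<dots> \<le> exp (t * \<Lambda>)"
    proof -
      have "t * \<Lambda> \<ge> 0" using t \<Lambda>[of 0] by (intro mult_nonneg_nonneg) auto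
      then show ?thesis
        using sum_le_suminf[OF summable_exp, of "{..<N}" "t * \<Lambda>"]
        by (simp add: exp_def divide_inverse mult.commute)
    qed
    finally show ?thesis .
  qed
  have lim: "(\<lambda>N. LINT \<xi>|lborel. cos (\<xi> \<bullet> x) * (h \<xi> * ?S N \<xi>)) \<longlonglongrightarrow> (LINT \<xi>|lborel. cos (\<xi> \<bullet> x) * (h \<xi> * exp (t * cos_transform m \<xi>)))"
  proof (rule integral_dominated_convergence)
    show "integrable lborel (\<lambda>\<xi>. \<bar>h \<xi>\<bar> * exp (t * \<Lambda>))" using h by simp
    show "AE \<xi> in lborel. (\<lambda>N. cos (\<xi> \<bullet> x) * (h \<xi> * ?S N \<xi>)) \<longlonglongrightarrow> cos (\<xi> \<bullet> x) * (h \<xi> * exp (t * cos_transform m \<xi>))"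
    proof (intro AE_I2 tendsto_mult tendsto_const)
      fix \<xi> show "(\<lambda>N. ?S N \<xi>) \<longlonglongrightarrow> exp (t * cos_transform m \<xi>)"
        using exp_converges[of "t * cos_transform m \<xi>"] by (simp add: sums_def divide_inverse mult.commute)
    qed
    show "AE \<xi> in lborel. norm (cos (\<xi> \<bullet> x) * (h \<xi> * ?S N \<xi>)) \<le> \<bar>h \<xi>\<bar> * exp (t * \<Lambda>)" for N
    proof (rule AE_I2)
      fix \<xi> :: 'a
      have "norm (cos (\<xi> \<bullet> x) * (h \<xi> * ?S N \<xi>)) = \<bar>cos (\<xi> \<bullet> x)\<bar> * (\<bar>h \<xi>\<bar> * \<bar>?S N \<xi>\<bar>)" by (simp only: real_norm_def abs_mult)
      also have "\<dots> \<le> 1 * (\<bar>h \<xi>\<bar> * exp (t * \<Lambda>))" by (intro mult_mono S_bound) auto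
      finally show "norm (cos (\<xi> \<bullet> x) * (h \<xi> * ?S N \<xi>)) \<le> \<bar>h \<xi>\<bar> * exp (t * \<Lambda>)" by simp
    qed
  qed measurable
  have nn: "(LINT \<xi>|lborel. cos (\<xi> \<bullet> x) * (h \<xi> * ?S N \<xi>)) \<ge> 0" for N
  proof -
    have "cos (\<xi> \<bullet> x) * (h \<xi> * ?S N \<xi>) = (\<Sum>n<N. t ^ n / fact n * (cos (\<xi> \<bullet> x) * ?q n \<xi>))" for \<xi>
      by (simp add: sum_distrib_left power_mult_distrib mult_ac)
    then have "(LINT \<xi>|lborel. cos (\<xi> \<bullet> x) * (h \<xi> * ?S N \<xi>)) = (\<Sum>n<N. t ^ n / fact n * cos_transform (?q n) x)"
      using q by (simp add: cos_transform_def cos_times_integrable)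
    also have "\<dots> \<ge> 0" using q t by (intro sum_nonneg mult_nonneg_nonneg) auto
    finally show ?thesis .
  qed
  show ?thesis
    by (subst cos_transform_def) (rule LIMSEQ_le_const[OF lim], use nn in blast)
qed

section \<open>The Levy exponent\<close>

lemma one_minus_cos_bounds: "0 \<le> 1 - cos a" "1 - cos a \<le> a\<^sup>2 / 2" "1 - cos a \<le> 2" for a :: real
proof -
  show "0 \<le> 1 - cos a" "1 - cos a \<le> 2" using cos_le_one[of a] cos_ge_minus_one[of a] by linarith+
  have "1 - cos a = 2 * (sin (a / 2))\<^sup>2" using cos_double_sin[of "a / 2"] by simp
  also have "\<dots> \<le> 2 * (a / 2)\<^sup>2"
    using abs_sin_x_le_abs_x[of "a / 2"] by (simp only: abs_le_square_iff mult_le_cancel_left_pos zero_less_numeral)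
  finally show "1 - cos a \<le> a\<^sup>2 / 2" by (simp add: power2_eq_square)
qed

context levy_density
begin

abbreviation \<psi> :: "'a \<Rightarrow> real" where "\<psi> \<equiv> levy_exponent \<nu>"

lemma exponent_integrand_bound:
  assumes "norm \<xi> \<le> R"
  shows "\<bar>(1 - cos (\<xi> \<bullet> x)) * \<nu> x\<bar> \<le> (R\<^sup>2 + 2) * (min ((norm x)\<^sup>2) 1 * \<nu> x)"
proof (cases "x = 0")
  case False
  then have \<nu>: "\<nu> x > 0" by (rule \<nu>_pos)
  have "1 - cos (\<xi> \<bullet> x) \<le> (R\<^sup>2 + 2) * min ((norm x)\<^sup>2) 1"
  proof (cases "norm x \<le> 1")
    case True
    then have m: "min ((norm x)\<^sup>2) 1 = (norm x)\<^sup>2" by (simp add: power_le_one)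
    have "\<bar>\<xi> \<bullet> x\<bar>\<^sup>2 \<le> (R * norm x)\<^sup>2"
      using Cauchy_Schwarz_ineq2[of \<xi> x] mult_right_mono[OF assms norm_ge_zero[of x]] by (intro power_mono) linarith+
    then have "(\<xi> \<bullet> x)\<^sup>2 \<le> R\<^sup>2 * (norm x)\<^sup>2" by (simp add: power_mult_distrib)
    moreover have "0 \<le> R\<^sup>2 * (norm x)\<^sup>2" "0 \<le> (norm x)\<^sup>2" by simp_all
    ultimately have "(\<xi> \<bullet> x)\<^sup>2 / 2 \<le> (R\<^sup>2 + 2) * (norm x)\<^sup>2"
      unfolding distrib_right by linarith
    then show ?thesis using one_minus_cos_bounds(2)[of "\<xi> \<bullet> x"] m by simp
  next
    case False
    then have "1 \<le> (norm x)\<^sup>2" by simp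
    then have m: "min ((norm x)\<^sup>2) 1 = 1" by simp
    show ?thesis using one_minus_cos_bounds(3)[of "\<xi> \<bullet> x"] unfolding m by (simp add: add_increasing)
  qed
  from mult_right_mono[OF this less_imp_le[OF \<nu>]] \<nu> one_minus_cos_bounds(1)[of "\<xi> \<bullet> x"]
  show ?thesis by (simp add: abs_mult mult.assoc)
qed simp

lemma exponent_integrable: "integrable lborel (\<lambda>x. (1 - cos (\<xi> \<bullet> x)) * \<nu> x)"
proof (rule Bochner_Integration.integrable_bound)
  show "integrable lborel (\<lambda>x. ((norm \<xi>)\<^sup>2 + 2) * (min ((norm x)\<^sup>2) 1 * \<nu> x))"
    by (rule integrable_mult_right[OF \<nu>_levy])
  show "AE x in lborel. norm ((1 - cos (\<xi> \<bullet> x)) * \<nu> x) \<le> norm (((norm \<xi>)\<^sup>2 + 2) * (min ((norm x)\<^sup>2) 1 * \<nu> x))"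
    using exponent_integrand_bound[OF order_refl, of \<xi>] by (auto intro!: AE_I2 intro: order_trans[OF _ abs_ge_self])
qed measurable

lemma exponent_integrand_nonneg: "0 \<le> (1 - cos (\<xi> \<bullet> x)) * \<nu> x"
  using one_minus_cos_bounds(1)[of "\<xi> \<bullet> x"] \<nu>_pos[of x] by (cases "x = 0") auto

lemma \<psi>_nonneg: "0 \<le> \<psi> \<xi>"
  unfolding levy_exponent_def by (intro Bochner_Integration.integral_nonneg exponent_integrand_nonneg)

lemma \<psi>_even: "\<psi> (- \<xi>) = \<psi> \<xi>"
  by (simp add: levy_exponent_def)

lemma \<psi>_measurable [measurable]: "\<psi> \<in> borel_measurable borel"
  unfolding levy_exponent_def[abs_def] by measurable

lemma \<psi>_continuous:
  assumes X: "X \<longlonglongrightarrow> \<xi>" shows "(\<lambda>n. \<psi> (X n)) \<longlonglongrightarrow> \<psi> \<xi>"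
proof -
  obtain R where R: "\<And>n. norm (X n) \<le> R"
    using X Bseq_def convergent_imp_Bseq convergentI by metis
  show ?thesis unfolding levy_exponent_def
  proof (rule integral_dominated_convergence)
    show "integrable lborel (\<lambda>x. (R\<^sup>2 + 2) * (min ((norm x)\<^sup>2) 1 * \<nu> x))"
      by (rule integrable_mult_right[OF \<nu>_levy])
    show "AE x in lborel. (\<lambda>n. (1 - cos (X n \<bullet> x)) * \<nu> x) \<longlonglongrightarrow> (1 - cos (\<xi> \<bullet> x)) * \<nu> x"
      by (intro AE_I2 tendsto_mult tendsto_diff tendsto_const tendsto_cos tendsto_inner X)
    show "AE x in lborel. norm ((1 - cos (X n \<bullet> x)) * \<nu> x) \<le> (R\<^sup>2 + 2) * (min ((norm x)\<^sup>2) 1 * \<nu> x)" for n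
      using exponent_integrand_bound[OF R] by (auto intro!: AE_I2)
  qed measurable
qed

text \<open>If \<open>\<psi> \<xi> = 0\<close>, then \<open>cos (\<xi> \<bullet> x) = 1\<close> for almost all \<open>x\<close> because \<open>\<nu>\<close> is positive; but the inequality is
strict on a nonempty open set.\<close>

lemma \<psi>_pos: assumes "\<xi> \<noteq> 0" shows "\<psi> \<xi> > 0"
proof (rule ccontr)
  assume "\<not> \<psi> \<xi> > 0"
  then have "\<psi> \<xi> = 0" using \<psi>_nonneg[of \<xi>] by simp
  then have "AE x in lborel. (1 - cos (\<xi> \<bullet> x)) * \<nu> x = 0"
    unfolding levy_exponent_def
    by (subst (asm) integral_nonneg_eq_0_iff_AE[OF exponent_integrable]) (auto simp: exponent_integrand_nonneg)
  moreover have "AE x in lborel. x \<noteq> (0::'a)" by (rule AE_lborel_singleton)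
  ultimately have "AE x in lborel. \<not> cos (\<xi> \<bullet> x) < 1"
  proof eventually_elim
    case (elim x)
    then show ?case using \<nu>_pos[of x] by auto
  qed
  then have null: "{x. cos (\<xi> \<bullet> x) < 1} \<in> null_sets lborel"
    by (subst (asm) AE_iff_null) auto
  have "open {x. cos (\<xi> \<bullet> x) < 1}" by (intro open_Collect_less continuous_intros)
  moreover have "(pi / (\<xi> \<bullet> \<xi>)) *\<^sub>R \<xi> \<in> {x. cos (\<xi> \<bullet> x) < 1}" using assms by simp
  ultimately have "\<not> negligible {x. cos (\<xi> \<bullet> x) < 1}" by (intro open_not_negligible) (metis empty_iff)+
  moreover have "negligible {x. cos (\<xi> \<bullet> x) < 1}"
    using null null_sets_completionI by (auto simp: negligible_iff_null_sets)
  ultimately show False by blast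
qed

text \<open>Without its part near the origin \<open>\<nu>\<close> is integrable, and the exponent is a constant minus a cosine
transform. In probabilistic terms the jumps of size at least \<open>1 / (n + 1)\<close> form a compound Poisson process.\<close>

lemma truncation_tendsto:
  defines "m \<equiv> \<lambda>n z. indicator {z. norm z \<ge> 1 / real (Suc n)} z * \<nu> z"
  shows "(\<lambda>n. (LINT z|lborel. m n z) - cos_transform (m n) \<xi>) \<longlonglongrightarrow> \<psi> \<xi>"
    and "0 \<le> (LINT z|lborel. m n z) - cos_transform (m n) \<xi>"
proof -
  have mi: "integrable lborel (m n)" for n
    unfolding m_def by (rule \<nu>_away_integrable) simp
  have e: "(LINT z|lborel. m n z) - cos_transform (m n) \<xi> = (LINT z|lborel. (1 - cos (\<xi> \<bullet> z)) * m n z)" for n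
    using mi[of n] cos_times_integrable[OF mi[of n], of \<xi>]
    by (simp add: cos_transform_def left_diff_distrib inner_commute[of \<xi>])
  have [measurable]: "m n \<in> borel_measurable borel" for n using mi[of n] by auto
  have dom: "0 \<le> (1 - cos (\<xi> \<bullet> z)) * m n z \<and> (1 - cos (\<xi> \<bullet> z)) * m n z \<le> (1 - cos (\<xi> \<bullet> z)) * \<nu> z" for n z
    using exponent_integrand_nonneg[of \<xi> z] by (auto simp: m_def indicator_def)
  show "0 \<le> (LINT z|lborel. m n z) - cos_transform (m n) \<xi>"
    unfolding e using dom by (intro Bochner_Integration.integral_nonneg) auto
  show "(\<lambda>n. (LINT z|lborel. m n z) - cos_transform (m n) \<xi>) \<longlonglongrightarrow> \<psi> \<xi>"
    unfolding e levy_exponent_def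
  proof (rule integral_dominated_convergence[OF _ _ exponent_integrable])
    show "AE z in lborel. (\<lambda>n. (1 - cos (\<xi> \<bullet> z)) * m n z) \<longlonglongrightarrow> (1 - cos (\<xi> \<bullet> z)) * \<nu> z"
    proof (rule AE_I2)
      fix z :: 'a
      show "(\<lambda>n. (1 - cos (\<xi> \<bullet> z)) * m n z) \<longlonglongrightarrow> (1 - cos (\<xi> \<bullet> z)) * \<nu> z"
      proof (cases "z = 0")
        case False
        have "(\<lambda>n. 1 / real (Suc n)) \<longlonglongrightarrow> 0"
          using LIMSEQ_inverse_real_of_nat by (simp add: inverse_eq_divide)
        from order_tendstoD(2)[OF this, of "norm z"] False
        have "\<forall>\<^sub>F n in sequentially. 1 / real (Suc n) < norm z" by simp
        then have "\<forall>\<^sub>F n in sequentially. (1 - cos (\<xi> \<bullet> z)) * m n z = (1 - cos (\<xi> \<bullet> z)) * \<nu> z"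
          by eventually_elim (simp add: m_def)
        then show ?thesis by (rule tendsto_eventually)
      qed simp
    qed
    show "AE z in lborel. norm ((1 - cos (\<xi> \<bullet> z)) * m n z) \<le> (1 - cos (\<xi> \<bullet> z)) * \<nu> z" for n
    proof (rule AE_I2)
      fix z show "norm ((1 - cos (\<xi> \<bullet> z)) * m n z) \<le> (1 - cos (\<xi> \<bullet> z)) * \<nu> z"
        using dom[of z n] by (simp only: real_norm_def abs_of_nonneg)
    qed
  qed measurable
qed

end

section \<open>The heat kernel\<close>

locale levy_growth = levy_density \<nu> for \<nu> :: "'a::euclidean_space \<Rightarrow> real" +
  assumes growth: "filterlim (\<lambda>\<xi>. levy_exponent \<nu> \<xi> / ln (norm \<xi>)) at_top at_infinity"
begin

lemma integrable_inverse_prod: "integrable lborel (\<lambda>x::'a. \<Prod>b\<in>Basis. inverse (1 + (x \<bullet> b)\<^sup>2))"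
proof (rule lborel_integral_prod(1))
  show "integrable lborel (\<lambda>x::real. inverse (1 + x\<^sup>2))"
    using integrable_inverse_1_plus_square by (simp add: set_integrable_def)
qed

text \<open>The growth hypothesis makes \<open>exp (- t * \<psi> \<xi>)\<close> decay faster than any power, for every \<open>t > 0\<close>. The
comparison function is a product of \<open>1 / (1 + \<xi>\<^sub>b\<^sup>2)\<close> over the coordinates, whose integral factorizes; it
dominates \<open>\<bar>\<xi>\<bar>\<^bsup>-2d\<^esup>\<close> up to a constant.\<close>

lemma exp_\<psi>_integrable:
  assumes t: "t > 0" shows "integrable lborel (\<lambda>\<xi>. exp (- t * \<psi> \<xi>))"
proof -
  define d where "d = DIM('a)"
  have "\<forall>\<^sub>F \<xi> in at_infinity. 2 * real d / t \<le> \<psi> \<xi> / ln (norm \<xi>)"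
    using growth by (simp add: filterlim_at_top)
  then obtain b where b: "\<And>\<xi>. norm \<xi> \<ge> b \<Longrightarrow> 2 * real d / t \<le> \<psi> \<xi> / ln (norm \<xi>)"
    by (auto simp: eventually_at_infinity)
  define R where "R = max b 2"
  let ?Q = "\<lambda>\<xi>::'a. \<Prod>b\<in>Basis. inverse (1 + (\<xi> \<bullet> b)\<^sup>2)"
  have Q0: "0 \<le> ?Q \<xi>" for \<xi> by (intro prod_nonneg) auto
  have far: "exp (- t * \<psi> \<xi>) \<le> 2 ^ d * ?Q \<xi>" if "norm \<xi> \<ge> R" for \<xi>
  proof -
    have n: "norm \<xi> \<ge> 2" "norm \<xi> \<ge> b" using that by (auto simp: R_def)
    have ln: "ln (norm \<xi>) > 0" by (rule ln_gt_zero) (use n in linarith)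
    have "2 * real d * ln (norm \<xi>) \<le> t * \<psi> \<xi>" using b[OF n(2)] ln t by (simp add: field_simps)
    then have "exp (- t * \<psi> \<xi>) \<le> exp (- (real (2 * d) * ln (norm \<xi>)))" by simp
    also have "\<dots> = inverse (norm \<xi> ^ (2 * d))"
    proof -
      have "exp (real (2 * d) * ln (norm \<xi>)) = norm \<xi> ^ (2 * d)"
      proof -
        have "exp (ln (norm \<xi>)) = norm \<xi>" by (rule exp_ln) (use n in linarith)
        then show ?thesis by (simp add: exp_of_nat_mult del: of_nat_mult)
      qed
      then show ?thesis by (simp add: exp_minus)
    qed
    also have "\<dots> \<le> 2 ^ d * ?Q \<xi>"
    proof -
      have "(\<Prod>b\<in>Basis. 1 + (\<xi> \<bullet> b)\<^sup>2) \<le> (\<Prod>b\<in>(Basis::'a set). 2 * (norm \<xi>)\<^sup>2)"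
      proof (rule prod_mono)
        fix b :: 'a assume "b \<in> Basis"
        then have "\<bar>\<xi> \<bullet> b\<bar>\<^sup>2 \<le> (norm \<xi>)\<^sup>2" by (intro power_mono Basis_le_norm) auto
        moreover have "1 \<le> (norm \<xi>)\<^sup>2" using n by simp
        ultimately show "0 \<le> 1 + (\<xi> \<bullet> b)\<^sup>2 \<and> 1 + (\<xi> \<bullet> b)\<^sup>2 \<le> 2 * (norm \<xi>)\<^sup>2" by simp
      qed
      also have "\<dots> = 2 ^ d * norm \<xi> ^ (2 * d)" by (simp add: d_def power_mult_distrib power_mult)
      finally have le: "(\<Prod>b\<in>Basis. 1 + (\<xi> \<bullet> b)\<^sup>2) \<le> 2 ^ d * norm \<xi> ^ (2 * d)" .
      have pos: "(\<Prod>b\<in>Basis. 1 + (\<xi> \<bullet> b)\<^sup>2) > 0" by (intro prod_pos) (auto simp: add_pos_nonneg)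
      have Q: "?Q \<xi> = inverse (\<Prod>b\<in>Basis. 1 + (\<xi> \<bullet> b)\<^sup>2)" using prod_inversef[of "\<lambda>b. 1 + (\<xi> \<bullet> b)\<^sup>2" Basis] by (simp add: comp_def)
      have "norm \<xi> ^ (2 * d) > 0" using n by (intro zero_less_power) auto
      then show ?thesis unfolding Q using le pos by (simp add: field_simps)
    qed
    finally show ?thesis .
  qed
  show ?thesis
  proof (rule Bochner_Integration.integrable_bound)
    show "integrable lborel (\<lambda>\<xi>. indicator (ball 0 R) \<xi> + 2 ^ d * ?Q \<xi>)"
      using emeasure_bounded_finite[of "ball (0::'a) R"]
      by (intro Bochner_Integration.integrable_add integrable_mult_right integrable_inverse_prod) auto
    show "AE \<xi> in lborel. norm (exp (- t * \<psi> \<xi>)) \<le> norm (indicator (ball 0 R) \<xi> + 2 ^ d * ?Q \<xi>)"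
    proof (rule AE_I2)
      fix \<xi> :: 'a
      have nn: "0 \<le> 2 ^ d * ?Q \<xi>" using Q0 by simp
      have "exp (- t * \<psi> \<xi>) \<le> indicator (ball 0 R) \<xi> + 2 ^ d * ?Q \<xi>"
      proof (cases "norm \<xi> \<ge> R")
        case True then show ?thesis using far[OF True] by (simp add: indicator_def)
      next
        case False
        have "exp (- t * \<psi> \<xi>) \<le> 1" using t \<psi>_nonneg[of \<xi>] by simp
        moreover have "indicator (ball 0 R) \<xi> = (1 :: real)" using False by simp
        ultimately show ?thesis using nn by linarith
      qed
      then show "norm (exp (- t * \<psi> \<xi>)) \<le> norm (indicator (ball 0 R) \<xi> + 2 ^ d * ?Q \<xi>)"
        using nn by simp
    qed
  qed measurable
qed

text \<open>For truncated \<open>\<nu>\<close> the function is \<open>exp\<close> of a cosine transform, up to a constant factor. It is not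
integrable then, which is why a Gaussian is carried along and removed at the end.\<close>

lemma cos_transform_exp_\<psi>_nonneg:
  assumes t: "t > 0" shows "0 \<le> cos_transform (\<lambda>\<xi>. exp (- t * \<psi> \<xi>)) x"
proof -
  have gauss: "0 \<le> cos_transform (\<lambda>\<xi>. gaussian s \<xi> * exp (- t * \<psi> \<xi>)) x" if s: "s > 0" for s
  proof -
    define m where "m n z = indicator {z. norm z \<ge> 1 / real (Suc n)} z * \<nu> z" for n and z :: 'a
    define \<psi>' where "\<psi>' n \<xi> = (LINT z|lborel. m n z) - cos_transform (m n) \<xi>" for n \<xi>
    have \<psi>': "(\<lambda>n. \<psi>' n \<xi>) \<longlonglongrightarrow> \<psi> \<xi>" "0 \<le> \<psi>' n \<xi>" for n \<xi>
      using truncation_tendsto(1)[of \<xi>] truncation_tendsto(2)[of n \<xi>] by (simp_all add: \<psi>'_def m_def[abs_def])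
    have mi: "integrable lborel (m n)" for n unfolding m_def[abs_def] by (rule \<nu>_away_integrable) simp
    have mn: "m n z \<ge> 0" for n z using \<nu>_pos[of z] by (cases "z = 0") (auto simp: m_def indicator_def)
    have [measurable]: "m n \<in> borel_measurable borel" for n using mi[of n] by auto
    have [measurable]: "\<psi>' n \<in> borel_measurable borel" for n unfolding \<psi>'_def by measurable
    note gi = gaussian_char(1)[OF s, where 'a='a]
    have gpos: "0 \<le> cos_transform (gaussian s) (x::'a)" for x
      unfolding cos_transform_def using gaussian_char(2)[OF s, of x] s
      by (simp add: inner_commute gaussian_bounds)
    have nn: "0 \<le> (LINT \<xi>|lborel. cos (\<xi> \<bullet> x) * (gaussian s \<xi> * exp (- t * \<psi>' n \<xi>)))" for n
    proof -
      have e: "cos (\<xi> \<bullet> x) * (gaussian s \<xi> * exp (- t * \<psi>' n \<xi>)) = exp (- t * (LINT z|lborel. m n z)) * (cos (\<xi> \<bullet> x) * (gaussian s \<xi> * exp (t * cos_transform (m n) \<xi>)))" for \<xi>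
        by (simp add: \<psi>'_def right_diff_distrib exp_diff exp_minus field_simps)
      have "0 \<le> cos_transform (\<lambda>\<xi>. gaussian s \<xi> * exp (t * cos_transform (m n) \<xi>)) x"
        using t by (intro cos_transform_times_exp_nonneg gi gpos mi mn) auto
      then show ?thesis unfolding e by (simp add: cos_transform_def[of "\<lambda>\<xi>. gaussian s \<xi> * _ \<xi>"])
    qed
    have "(\<lambda>n. LINT \<xi>|lborel. cos (\<xi> \<bullet> x) * (gaussian s \<xi> * exp (- t * \<psi>' n \<xi>))) \<longlonglongrightarrow> (LINT \<xi>|lborel. cos (\<xi> \<bullet> x) * (gaussian s \<xi> * exp (- t * \<psi> \<xi>)))"
    proof (rule integral_dominated_convergence[OF _ _ gi])
      show "AE \<xi> in lborel. (\<lambda>n. cos (\<xi> \<bullet> x) * (gaussian s \<xi> * exp (- t * \<psi>' n \<xi>))) \<longlonglongrightarrow> cos (\<xi> \<bullet> x) * (gaussian s \<xi> * exp (- t * \<psi> \<xi>))"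
        by (intro AE_I2 tendsto_mult tendsto_const tendsto_exp \<psi>'(1))
      show "AE \<xi> in lborel. norm (cos (\<xi> \<bullet> x) * (gaussian s \<xi> * exp (- t * \<psi>' n \<xi>))) \<le> gaussian s \<xi>" for n
      proof (rule AE_I2)
        fix \<xi> :: 'a
        have "norm (cos (\<xi> \<bullet> x) * (gaussian s \<xi> * exp (- t * \<psi>' n \<xi>))) \<le> 1 * (gaussian s \<xi> * 1)"
          unfolding real_norm_def abs_mult using t \<psi>'(2)[of n \<xi>] by (intro mult_mono) (auto simp: gaussian_bounds)
        then show "norm (cos (\<xi> \<bullet> x) * (gaussian s \<xi> * exp (- t * \<psi>' n \<xi>))) \<le> gaussian s \<xi>" by simp
      qed
    qed measurable
    then show ?thesis unfolding cos_transform_def by (rule LIMSEQ_le_const) (use nn in blast)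
  qed
  have lim0: "(\<lambda>n. 1 / real (Suc n)) \<longlonglongrightarrow> 0" using LIMSEQ_inverse_real_of_nat by (simp add: inverse_eq_divide)
  have "(\<lambda>n. LINT \<xi>|lborel. cos (\<xi> \<bullet> x) * (gaussian (1 / real (Suc n)) \<xi> * exp (- t * \<psi> \<xi>))) \<longlonglongrightarrow> (LINT \<xi>|lborel. cos (\<xi> \<bullet> x) * (1 * exp (- t * \<psi> \<xi>)))"
  proof (rule integral_dominated_convergence[OF _ _ exp_\<psi>_integrable[OF t]])
    show "AE \<xi> in lborel. (\<lambda>n. cos (\<xi> \<bullet> x) * (gaussian (1 / real (Suc n)) \<xi> * exp (- t * \<psi> \<xi>))) \<longlonglongrightarrow> cos (\<xi> \<bullet> x) * (1 * exp (- t * \<psi> \<xi>))"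
      by (intro AE_I2 tendsto_mult tendsto_const gaussian_tendsto_1 lim0)
    show "AE \<xi> in lborel. norm (cos (\<xi> \<bullet> x) * (gaussian (1 / real (Suc n)) \<xi> * exp (- t * \<psi> \<xi>))) \<le> exp (- t * \<psi> \<xi>)" for n
    proof (rule AE_I2)
      fix \<xi> :: 'a
      have "norm (cos (\<xi> \<bullet> x) * (gaussian (1 / real (Suc n)) \<xi> * exp (- t * \<psi> \<xi>))) \<le> 1 * (1 * exp (- t * \<psi> \<xi>))"
        unfolding real_norm_def abs_mult by (intro mult_mono) (auto simp: gaussian_bounds)
      then show "norm (cos (\<xi> \<bullet> x) * (gaussian (1 / real (Suc n)) \<xi> * exp (- t * \<psi> \<xi>))) \<le> exp (- t * \<psi> \<xi>)" by simp
    qed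
  qed measurable
  then have "0 \<le> (LINT \<xi>|lborel. cos (\<xi> \<bullet> x) * (1 * exp (- t * \<psi> \<xi>)))"
    by (rule LIMSEQ_le_const) (use gauss in \<open>auto simp: cos_transform_def\<close>)
  then show ?thesis by (simp add: cos_transform_def)
qed

abbreviation q :: "real \<Rightarrow> 'a \<Rightarrow> real" where "q \<equiv> heat_kernel \<nu>"

lemma heat_kernel_eq:
  assumes t: "t > 0"
  shows "q t x = cos_transform (\<lambda>\<xi>. exp (- t * \<psi> \<xi>)) x / (2 * pi) ^ DIM('a)"
proof -
  let ?f = "\<lambda>\<xi>. exp (- (\<i> * complex_of_real (\<xi> \<bullet> x))) * complex_of_real (exp (- t * \<psi> \<xi>))"
  have I: "integrable lborel ?f"
  proof (rule Bochner_Integration.integrable_bound[OF exp_\<psi>_integrable[OF t]])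
    show "AE \<xi> in lborel. norm (?f \<xi>) \<le> norm (exp (- t * \<psi> \<xi>))"
      by (intro AE_I2) (simp add: norm_mult)
  qed measurable
  have "q t x = Re (LINT \<xi>|lborel. ?f \<xi>) / (2 * pi) ^ DIM('a)"
    unfolding heat_kernel_def by (rule Re_divide_of_real)
  also have "Re (LINT \<xi>|lborel. ?f \<xi>) = (LINT \<xi>|lborel. Re (?f \<xi>))" by (rule integral_Re[OF I, symmetric])
  also have "\<dots> = cos_transform (\<lambda>\<xi>. exp (- t * \<psi> \<xi>)) x"
    unfolding cos_transform_def by (intro Bochner_Integration.integral_cong refl) (simp add: Re_exp)
  finally show ?thesis .
qed

lemma heat_kernel_measurable: "(\<lambda>(t, x). q t x) \<in> borel_measurable (borel \<Otimes>\<^sub>M borel)"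
  unfolding heat_kernel_def by measurable

lemma heat_kernel_measurable_space [measurable]: "q t \<in> borel_measurable borel"
  unfolding heat_kernel_def[abs_def] by measurable

lemma heat_kernel_even: "q t (- x) = q t x"
proof -
  have "(LINT \<xi>|lborel. exp (- (\<i> * complex_of_real (- \<xi> \<bullet> x))) * complex_of_real (exp (- t * \<psi> (- \<xi>)))) =
        (LINT \<xi>|lborel. exp (- (\<i> * complex_of_real (\<xi> \<bullet> x))) * complex_of_real (exp (- t * \<psi> \<xi>)))"
    by (rule lborel_integral_reflect[of "\<lambda>\<xi>. exp (- (\<i> * complex_of_real (\<xi> \<bullet> x))) * complex_of_real (exp (- t * \<psi> \<xi>))"]) measurable
  then show ?thesis unfolding heat_kernel_def by (simp add: \<psi>_even)
qed

lemma heat_kernel_nonneg: "t > 0 \<Longrightarrow> 0 \<le> q t x"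
  unfolding heat_kernel_eq by (intro divide_nonneg_nonneg cos_transform_exp_\<psi>_nonneg) auto

lemma heat_kernel_0: "t > 0 \<Longrightarrow> q t 0 = (LINT \<xi>|lborel. exp (- t * \<psi> \<xi>)) / (2 * pi) ^ DIM('a)"
  by (simp add: heat_kernel_eq cos_transform_def)

lemma heat_kernel_le_0: assumes "t > 0" shows "q t x \<le> q t 0"
proof -
  have "cos_transform (\<lambda>\<xi>. exp (- t * \<psi> \<xi>)) x \<le> (LINT \<xi>|lborel. exp (- t * \<psi> \<xi>))"
    using cos_transform_bound[OF exp_\<psi>_integrable[OF assms], of x] by simp
  then show ?thesis
    unfolding heat_kernel_0[OF assms] heat_kernel_eq[OF assms, of x] by (intro divide_right_mono) auto
qed

lemma heat_kernel_0_mono: assumes "0 < s" "s \<le> t" shows "q t 0 \<le> q s 0"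
proof -
  have t: "t > 0" using assms by simp
  show ?thesis unfolding heat_kernel_0[OF assms(1)] heat_kernel_0[OF t]
    using assms \<psi>_nonneg
    by (intro divide_right_mono integral_mono exp_\<psi>_integrable t) (auto intro: mult_right_mono)
qed

lemma heat_kernel_time_continuous:
  assumes t: "t > 0" and X: "X \<longlonglongrightarrow> t" "\<And>n. t \<le> X n"
  shows "(\<lambda>n. q (X n) x) \<longlonglongrightarrow> q t x"
proof -
  have Xp: "X n > 0" for n using X(2)[of n] t by simp
  have "(\<lambda>n. LINT \<xi>|lborel. cos (\<xi> \<bullet> x) * exp (- X n * \<psi> \<xi>)) \<longlonglongrightarrow> (LINT \<xi>|lborel. cos (\<xi> \<bullet> x) * exp (- t * \<psi> \<xi>))"
  proof (rule integral_dominated_convergence[OF _ _ exp_\<psi>_integrable[OF t]])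
    show "AE \<xi> in lborel. (\<lambda>n. cos (\<xi> \<bullet> x) * exp (- X n * \<psi> \<xi>)) \<longlonglongrightarrow> cos (\<xi> \<bullet> x) * exp (- t * \<psi> \<xi>)"
      by (intro AE_I2 tendsto_mult tendsto_const tendsto_exp tendsto_minus X(1))
    show "AE \<xi> in lborel. norm (cos (\<xi> \<bullet> x) * exp (- X n * \<psi> \<xi>)) \<le> exp (- t * \<psi> \<xi>)" for n
    proof (rule AE_I2)
      fix \<xi> :: 'a
      have "norm (cos (\<xi> \<bullet> x) * exp (- X n * \<psi> \<xi>)) \<le> 1 * exp (- t * \<psi> \<xi>)"
        unfolding real_norm_def abs_mult using X(2)[of n] \<psi>_nonneg[of \<xi>] by (intro mult_mono) (auto intro: mult_right_mono)
      then show "norm (cos (\<xi> \<bullet> x) * exp (- X n * \<psi> \<xi>)) \<le> exp (- t * \<psi> \<xi>)" by simp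
    qed
  qed measurable
  then show ?thesis unfolding heat_kernel_eq[OF t] heat_kernel_eq[OF Xp] cos_transform_def
    by (intro tendsto_divide tendsto_const) auto
qed

lemma heat_kernel_0_long_time: "((\<lambda>t. q t 0) \<longlongrightarrow> 0) at_top"
proof -
  have "((\<lambda>t. LINT \<xi>|lborel. exp (- t * \<psi> \<xi>)) \<longlongrightarrow> (LINT \<xi>::'a|lborel. 0)) at_top"
  proof (rule integral_dominated_convergence_at_top[OF _ _ exp_\<psi>_integrable[of 1]])
    show "\<forall>\<^sub>F t in at_top. AE \<xi> in lborel. norm (exp (- t * \<psi> \<xi>)) \<le> exp (- 1 * \<psi> \<xi>)"
      using eventually_ge_at_top[of 1]
    proof eventually_elim
      case (elim t)
      then show ?case using \<psi>_nonneg mult_right_mono[OF elim] by (auto intro!: AE_I2)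
    qed
    \<comment> \<open>At the origin the exponent vanishes and there is no decay.\<close>
    have "AE \<xi> in lborel. \<xi> \<noteq> (0::'a)" by (rule AE_lborel_singleton)
    then show "AE \<xi> in lborel. ((\<lambda>t. exp (- t * \<psi> \<xi>)) \<longlongrightarrow> 0) at_top"
    proof eventually_elim
      case (elim \<xi>)
      have "filterlim (\<lambda>t. \<psi> \<xi> * t) at_top at_top"
        by (rule filterlim_tendsto_pos_mult_at_top[OF tendsto_const \<psi>_pos[OF elim] filterlim_ident])
      then have "filterlim (\<lambda>t. - t * \<psi> \<xi>) at_bot at_top"
        by (simp add: filterlim_uminus_at_bot mult.commute)
      then show ?case by (rule filterlim_compose[OF exp_at_bot])
    qed
  qed auto
  then have "((\<lambda>t. (LINT \<xi>|lborel. exp (- t * \<psi> \<xi>)) / (2 * pi) ^ DIM('a)) \<longlongrightarrow> 0) at_top"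
    by (auto intro: tendsto_divide_zero)
  then show ?thesis
    by (rule Lim_transform_eventually) (use eventually_gt_at_top[of 0] in \<open>eventually_elim, simp add: heat_kernel_0\<close>)
qed

text \<open>Insert the Fourier integral of the kernel and exchange the integrations. The Gaussian \<open>gaussian s\<close> turns
into a Gaussian of width \<open>s\<close> around \<open>\<eta>\<close>, by which \<open>exp (- t * \<psi>)\<close> is averaged.\<close>

lemma heat_kernel_gaussian_regularization:
  assumes t: "t > 0" and s: "s > 0"
  shows "cos_transform (\<lambda>x. q t x * gaussian s x) \<eta> =
     (LINT \<zeta>::'a|lborel. exp (- t * \<psi> (\<eta> + s *\<^sub>R \<zeta>)) * gaussian 1 \<zeta>) / sqrt (2 * pi) ^ DIM('a)"
proof -
  define \<phi> where "\<phi> \<xi> = exp (- t * \<psi> \<xi>)" for \<xi>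
  define A where "A \<zeta> = (sqrt (2 * pi) / s) ^ DIM('a) * gaussian (1 / s) \<zeta>" for \<zeta> :: 'a
  have [measurable]: "\<phi> \<in> borel_measurable borel" "A \<in> borel_measurable borel"
    unfolding \<phi>_def[abs_def] A_def[abs_def] by measurable
  have \<phi>I: "integrable lborel \<phi>" unfolding \<phi>_def[abs_def] by (rule exp_\<psi>_integrable[OF t])
  have \<phi>_even: "\<phi> (- \<xi>) = \<phi> \<xi>" for \<xi> by (simp add: \<phi>_def \<psi>_even)
  have A_even: "A (- \<zeta>) = A \<zeta>" for \<zeta> by (simp add: A_def gaussian_def)
  have \<phi>_nn: "\<phi> \<xi> \<ge> 0" for \<xi> by (simp add: \<phi>_def)
  note gI = gaussian_char(1)[OF s, where 'a='a]
  have A_char: "(LINT x|lborel. cos (x \<bullet> \<zeta>) * gaussian s x) = A \<zeta>" for \<zeta>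
    using gaussian_char(2)[OF s, of \<zeta>] by (simp add: A_def inner_commute)
  have A_bound: "\<bar>A \<zeta>\<bar> \<le> (sqrt (2 * pi) / s) ^ DIM('a)" for \<zeta>
    using s by (simp add: A_def abs_mult gaussian_bounds mult_left_le)
  have \<phi>A: "integrable lborel (\<lambda>\<xi>. \<phi> \<xi> * A (\<xi> + v))" for v
  proof (rule Bochner_Integration.integrable_bound)
    show "integrable lborel (\<lambda>\<xi>. \<phi> \<xi> * (sqrt (2 * pi) / s) ^ DIM('a))" using \<phi>I by simp
    show "AE \<xi> in lborel. norm (\<phi> \<xi> * A (\<xi> + v)) \<le> norm (\<phi> \<xi> * (sqrt (2 * pi) / s) ^ DIM('a))"
      unfolding real_norm_def abs_mult
      by (intro AE_I2 mult_left_mono order_trans[OF A_bound abs_ge_self]) simp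
  qed measurable
  let ?F = "\<lambda>x \<xi>. (cos (x \<bullet> \<eta>) * gaussian s x) * (cos (\<xi> \<bullet> x) * \<phi> \<xi>)"
  have I: "integrable (lborel \<Otimes>\<^sub>M lborel) (\<lambda>(x, \<xi>). ?F x \<xi>)"
  proof (rule Bochner_Integration.integrable_bound[OF product_integrable_pair[OF gI \<phi>I]])
    show "AE z in lborel \<Otimes>\<^sub>M lborel. norm (case z of (x, \<xi>) \<Rightarrow> ?F x \<xi>) \<le> norm (case z of (x, \<xi>) \<Rightarrow> gaussian s x * \<phi> \<xi>)"
      by (auto simp: abs_mult intro!: AE_I2 mult_mono mult_left_le_one_le)
  qed measurable
  have inner: "(LINT x|lborel. ?F x \<xi>) = \<phi> \<xi> * A (\<xi> + \<eta>) / 2 + \<phi> \<xi> * A (\<xi> + - \<eta>) / 2" for \<xi>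
  proof -
    have "?F x \<xi> = \<phi> \<xi> / 2 * (cos (x \<bullet> (\<xi> + \<eta>)) * gaussian s x + cos (x \<bullet> (\<xi> - \<eta>)) * gaussian s x)" for x
      by (simp add: inner_add_right inner_diff_right cos_add cos_diff inner_commute[of \<xi>] algebra_simps)
    then have "(LINT x|lborel. ?F x \<xi>) = (LINT x|lborel. \<phi> \<xi> / 2 * (cos (x \<bullet> (\<xi> + \<eta>)) * gaussian s x + cos (x \<bullet> (\<xi> - \<eta>)) * gaussian s x))"
      by (simp only:)
    also have "\<dots> = \<phi> \<xi> / 2 * (A (\<xi> + \<eta>) + A (\<xi> - \<eta>))"
      using cos_times_integrable[OF gI] by (simp add: A_char)
    finally show ?thesis by (simp add: algebra_simps add_divide_distrib)
  qed
  have flip: "(LINT \<xi>|lborel. \<phi> \<xi> * A (\<xi> + - \<eta>)) = (LINT \<xi>|lborel. \<phi> \<xi> * A (\<xi> + \<eta>))"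
  proof -
    have "(LINT \<xi>|lborel. \<phi> (- \<xi>) * A (- \<xi> + - \<eta>)) = (LINT \<xi>|lborel. \<phi> \<xi> * A (\<xi> + - \<eta>))"
      by (rule lborel_integral_reflect[of "\<lambda>\<xi>. \<phi> \<xi> * A (\<xi> + - \<eta>)"]) measurable
    moreover have "A (- \<xi> + - \<eta>) = A (\<xi> + \<eta>)" for \<xi> using A_even[of "\<xi> + \<eta>"] by (simp add: add.commute)
    ultimately show ?thesis by (simp add: \<phi>_even)
  qed
  have "(2 * pi) ^ DIM('a) * cos_transform (\<lambda>x. q t x * gaussian s x) \<eta> = (LINT x|lborel. LINT \<xi>|lborel. ?F x \<xi>)"
  proof -
    have qe: "(2 * pi) ^ DIM('a) * q t x = cos_transform \<phi> x" for x
      by (simp add: heat_kernel_eq[OF t] \<phi>_def[abs_def])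
    have e: "(LINT \<xi>|lborel. ?F x \<xi>) = (cos (x \<bullet> \<eta>) * gaussian s x) * cos_transform \<phi> x" for x
      unfolding cos_transform_def by (rule integral_mult_right_zero)
    have "(2 * pi) ^ DIM('a) * (cos (x \<bullet> \<eta>) * (q t x * gaussian s x)) = (LINT \<xi>|lborel. ?F x \<xi>)" for x
      unfolding e qe[symmetric] by (simp only: mult_ac)
    then show ?thesis unfolding cos_transform_def by (simp flip: integral_mult_right_zero)
  qed
  also have "\<dots> = (LINT \<xi>|lborel. LINT x|lborel. ?F x \<xi>)" by (rule lborel_pair.Fubini_integral[OF I, symmetric])
  also have "\<dots> = (LINT \<xi>|lborel. \<phi> \<xi> * A (\<xi> + - \<eta>))"
    unfolding inner using \<phi>A[of \<eta>] \<phi>A[of "- \<eta>"] flip by simp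
  also have "\<dots> = \<bar>s\<bar> ^ DIM('a) *\<^sub>R (LINT \<zeta>|lborel. \<phi> (\<eta> + s *\<^sub>R \<zeta>) * A (\<eta> + s *\<^sub>R \<zeta> + - \<eta>))"
    using s by (intro lborel_integral_affine) auto
  also have "\<dots> = sqrt (2 * pi) ^ DIM('a) * (LINT \<zeta>|lborel. \<phi> (\<eta> + s *\<^sub>R \<zeta>) * gaussian 1 \<zeta>)"
  proof -
    have "\<phi> (\<eta> + s *\<^sub>R \<zeta>) * A (\<eta> + s *\<^sub>R \<zeta> + - \<eta>) = (sqrt (2 * pi) / s) ^ DIM('a) * (\<phi> (\<eta> + s *\<^sub>R \<zeta>) * gaussian 1 \<zeta>)" for \<zeta>
      using s by (simp add: A_def gaussian_def)
    then show ?thesis using s by (simp add: power_divide)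
  qed
  finally have scaled: "(2 * pi) ^ DIM('a) * cos_transform (\<lambda>x. q t x * gaussian s x) \<eta> = sqrt (2 * pi) ^ DIM('a) * (LINT \<zeta>|lborel. \<phi> (\<eta> + s *\<^sub>R \<zeta>) * gaussian 1 \<zeta>)" .
  have cancel: "X = Z / r" if "a * X = r * Z" "a = r * r" "r \<noteq> 0" for a r X Z :: real
    using that by (simp add: field_simps)
  have "(2 * pi) ^ DIM('a) = sqrt (2 * pi) ^ DIM('a) * sqrt (2 * pi) ^ DIM('a)"
    unfolding power_mult_distrib[symmetric] by simp
  then have "cos_transform (\<lambda>x. q t x * gaussian s x) \<eta> = (LINT \<zeta>|lborel. \<phi> (\<eta> + s *\<^sub>R \<zeta>) * gaussian 1 \<zeta>) / sqrt (2 * pi) ^ DIM('a)"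
    by (rule cancel[OF scaled]) simp
  then show ?thesis by (simp add: \<phi>_def)
qed

lemma heat_kernel_regularization_tendsto:
  assumes t: "t > 0"
  shows "(\<lambda>n. cos_transform (\<lambda>x. q t x * gaussian (1 / real (Suc n)) x) \<eta>) \<longlonglongrightarrow> exp (- t * \<psi> \<eta>)"
proof -
  have lim0: "(\<lambda>n. 1 / real (Suc n)) \<longlonglongrightarrow> 0" using LIMSEQ_inverse_real_of_nat by (simp add: inverse_eq_divide)
  have gI: "integrable lborel (gaussian 1 :: 'a \<Rightarrow> real)" by (rule gaussian_char) simp
  have g1: "(LINT \<zeta>::'a|lborel. gaussian 1 \<zeta>) = sqrt (2 * pi) ^ DIM('a)"
    using gaussian_char(2)[of 1 "0::'a"] by (simp add: gaussian_def[of 1 0])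
  have "(\<lambda>n. LINT \<zeta>::'a|lborel. exp (- t * \<psi> (\<eta> + (1 / real (Suc n)) *\<^sub>R \<zeta>)) * gaussian 1 \<zeta>) \<longlonglongrightarrow> (LINT \<zeta>::'a|lborel. exp (- t * \<psi> \<eta>) * gaussian 1 \<zeta>)"
  proof (rule integral_dominated_convergence[OF _ _ gI])
    show "AE \<zeta> in lborel. (\<lambda>n. exp (- t * \<psi> (\<eta> + (1 / real (Suc n)) *\<^sub>R \<zeta>)) * gaussian 1 \<zeta>) \<longlonglongrightarrow> exp (- t * \<psi> \<eta>) * gaussian 1 \<zeta>"
    proof (intro AE_I2 tendsto_mult tendsto_const tendsto_exp \<psi>_continuous)
      fix \<zeta> :: 'a
      have "(\<lambda>n. \<eta> + (1 / real (Suc n)) *\<^sub>R \<zeta>) \<longlonglongrightarrow> \<eta> + 0 *\<^sub>R \<zeta>"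
        by (rule tendsto_add[OF tendsto_const tendsto_scaleR[OF lim0 tendsto_const]])
      then show "(\<lambda>n. \<eta> + (1 / real (Suc n)) *\<^sub>R \<zeta>) \<longlonglongrightarrow> \<eta>" by simp
    qed
    show "AE \<zeta> in lborel. norm (exp (- t * \<psi> (\<eta> + (1 / real (Suc n)) *\<^sub>R \<zeta>)) * gaussian 1 \<zeta>) \<le> gaussian 1 \<zeta>" for n
      using t \<psi>_nonneg by (intro AE_I2) (simp add: abs_mult gaussian_bounds mult_left_le_one_le)
  qed measurable
  then have "(\<lambda>n. (LINT \<zeta>::'a|lborel. exp (- t * \<psi> (\<eta> + (1 / real (Suc n)) *\<^sub>R \<zeta>)) * gaussian 1 \<zeta>) / sqrt (2 * pi) ^ DIM('a))
     \<longlonglongrightarrow> (LINT \<zeta>::'a|lborel. exp (- t * \<psi> \<eta>) * gaussian 1 \<zeta>) / sqrt (2 * pi) ^ DIM('a)"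
    by (intro tendsto_divide tendsto_const) auto
  moreover have "(LINT \<zeta>::'a|lborel. exp (- t * \<psi> \<eta>) * gaussian 1 \<zeta>) / sqrt (2 * pi) ^ DIM('a) = exp (- t * \<psi> \<eta>)"
    using g1 by simp
  ultimately show ?thesis using t by (simp add: heat_kernel_gaussian_regularization)
qed

lemma
  assumes t: "t > 0"
  shows heat_kernel_integrable: "integrable lborel (q t)"
    and heat_kernel_cos_transform: "cos_transform (q t) \<eta> = exp (- t * \<psi> \<eta>)"
    and heat_kernel_mass: "(\<integral>\<^sup>+x. ennreal (q t x) \<partial>lborel) = 1"
proof -
  define s where "s n = 1 / real (Suc n)" for n
  have s: "s n > 0" "s \<longlonglongrightarrow> 0" for n
    using LIMSEQ_inverse_real_of_nat by (simp_all add: s_def[abs_def] inverse_eq_divide)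
  have qg: "integrable lborel (\<lambda>x. q t x * gaussian (s n) x)" for n
  proof (rule Bochner_Integration.integrable_bound)
    show "integrable lborel (\<lambda>x::'a. q t 0 * gaussian (s n) x)" using gaussian_char(1)[OF s(1), where 'a='a] by (rule integrable_mult_right)
    show "AE x in lborel. norm (q t x * gaussian (s n) x) \<le> norm (q t 0 * gaussian (s n) x)"
      using heat_kernel_nonneg[OF t] heat_kernel_le_0[OF t] by (intro AE_I2) (simp add: abs_mult gaussian_bounds mult_right_mono)
  qed measurable
  have lim: "(\<lambda>n. cos_transform (\<lambda>x. q t x * gaussian (s n) x) \<eta>) \<longlonglongrightarrow> exp (- t * \<psi> \<eta>)" for \<eta>
    unfolding s_def by (rule heat_kernel_regularization_tendsto[OF t])
  have \<psi>0: "\<psi> 0 = 0" by (simp add: levy_exponent_def)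
  have pt: "(\<lambda>n. q t x * gaussian (s n) x) \<longlonglongrightarrow> q t x" for x
    using tendsto_mult[OF tendsto_const gaussian_tendsto_1[OF s(2)], of "q t x" x] by simp
  have "(\<integral>\<^sup>+x. ennreal (q t x) \<partial>lborel) = (\<integral>\<^sup>+x. liminf (\<lambda>n. ennreal (q t x * gaussian (s n) x)) \<partial>lborel)"
    by (intro nn_integral_cong) (simp add: lim_imp_Liminf[OF _ tendsto_ennrealI[OF pt]])
  also have "\<dots> \<le> liminf (\<lambda>n. \<integral>\<^sup>+x. ennreal (q t x * gaussian (s n) x) \<partial>lborel)"
    by (rule nn_integral_liminf) measurable
  also have "\<dots> = liminf (\<lambda>n. ennreal (cos_transform (\<lambda>x. q t x * gaussian (s n) x) 0))"
    using qg heat_kernel_nonneg[OF t]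
    by (intro arg_cong[of _ _ liminf] ext) (simp add: cos_transform_def nn_integral_eq_integral gaussian_bounds)
  also have "\<dots> = 1"
    using tendsto_ennrealI[OF lim[of 0]] by (simp add: lim_imp_Liminf \<psi>0)
  finally have le1: "(\<integral>\<^sup>+x. ennreal (q t x) \<partial>lborel) \<le> 1" .
  then show I: "integrable lborel (q t)"
    using heat_kernel_nonneg[OF t] le_less_trans[OF le1 ennreal_one_less_top] by (intro integrableI_nonneg) auto
  have ct: "cos_transform (q t) \<eta> = exp (- t * \<psi> \<eta>)" for \<eta>
  proof (rule LIMSEQ_unique)
    show "(\<lambda>n. cos_transform (\<lambda>x. q t x * gaussian (s n) x) \<eta>) \<longlonglongrightarrow> cos_transform (q t) \<eta>"
      unfolding cos_transform_def
    proof (rule integral_dominated_convergence[OF _ _ I])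
      show "AE x in lborel. (\<lambda>n. cos (x \<bullet> \<eta>) * (q t x * gaussian (s n) x)) \<longlonglongrightarrow> cos (x \<bullet> \<eta>) * q t x"
        by (intro AE_I2 tendsto_mult[OF tendsto_const pt])
      show "AE x in lborel. norm (cos (x \<bullet> \<eta>) * (q t x * gaussian (s n) x)) \<le> q t x" for n
      proof (rule AE_I2)
        fix x
        have "norm (cos (x \<bullet> \<eta>) * (q t x * gaussian (s n) x)) \<le> 1 * (q t x * 1)"
          unfolding real_norm_def abs_mult using heat_kernel_nonneg[OF t, of x] by (intro mult_mono) (auto simp: gaussian_bounds)
        then show "norm (cos (x \<bullet> \<eta>) * (q t x * gaussian (s n) x)) \<le> q t x" by simp
      qed
    qed measurable
  qed (rule lim)
  then show "cos_transform (q t) \<eta> = exp (- t * \<psi> \<eta>)" .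
  have "(LINT x|lborel. q t x) = 1" using ct[of 0] by (simp add: cos_transform_def \<psi>0)
  then show "(\<integral>\<^sup>+x. ennreal (q t x) \<partial>lborel) = 1"
    using heat_kernel_nonneg[OF t] by (subst nn_integral_eq_integral[OF I]) auto
qed

lemma heat_kernel_sin_transform: assumes t: "t > 0" shows "(LINT x|lborel. sin (x \<bullet> \<xi>) * q t x) = 0"
proof -
  have "(LINT x|lborel. sin (- x \<bullet> \<xi>) * q t (- x)) = (LINT x|lborel. sin (x \<bullet> \<xi>) * q t x)"
    by (rule lborel_integral_reflect[of "\<lambda>x. sin (x \<bullet> \<xi>) * q t x"]) measurable
  then show ?thesis by (simp add: heat_kernel_even)
qed

text \<open>Only the factor \<open>q t\<close> is written as a Fourier integral; the integral over \<open>y\<close> is then the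
transform of \<open>q s\<close>, and the exponentials multiply.\<close>

lemma heat_kernel_convolution:
  assumes s: "s > 0" and t: "t > 0"
  shows "(\<integral>\<^sup>+y. ennreal (q s (y - x)) * ennreal (q t (z - y)) \<partial>lborel) = ennreal (q (s + t) (z - x))"
proof -
  have qs: "integrable lborel (\<lambda>y. q s (y - x))" by (intro integrable_lborel_shift heat_kernel_integrable s)
  let ?F = "\<lambda>y \<xi>. q s (y - x) * (cos (\<xi> \<bullet> (z - y)) * exp (- t * \<psi> \<xi>))"
  have I: "integrable (lborel \<Otimes>\<^sub>M lborel) (\<lambda>(y, \<xi>). ?F y \<xi>)"
  proof (rule Bochner_Integration.integrable_bound[OF product_integrable_pair[OF qs exp_\<psi>_integrable[OF t]]])
    show "AE w in lborel \<Otimes>\<^sub>M lborel. norm (case w of (y, \<xi>) \<Rightarrow> ?F y \<xi>) \<le> norm (case w of (y, \<xi>) \<Rightarrow> q s (y - x) * exp (- t * \<psi> \<xi>))"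
      by (auto simp: abs_mult intro!: AE_I2 mult_left_mono mult_left_le_one_le)
  qed measurable
  have inner: "(LINT y|lborel. ?F y \<xi>) = cos (\<xi> \<bullet> (z - x)) * exp (- (s + t) * \<psi> \<xi>)" for \<xi>
  proof -
    note c = cos_times_integrable[OF heat_kernel_integrable[OF s], of \<xi>] and s' = sin_times_integrable[OF heat_kernel_integrable[OF s], of \<xi>]
    have "(LINT y|lborel. ?F y \<xi>) = (LINT w|lborel. ?F (x + 1 *\<^sub>R w) \<xi>)"
      by (subst lborel_integral_affine[where s = 1 and a = x]) auto
    also have "\<dots> = (LINT w|lborel. exp (- t * \<psi> \<xi>) * (cos (\<xi> \<bullet> (z - x)) * (cos (w \<bullet> \<xi>) * q s w) + sin (\<xi> \<bullet> (z - x)) * (sin (w \<bullet> \<xi>) * q s w)))"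
    proof (intro Bochner_Integration.integral_cong refl)
      fix w
      have "\<xi> \<bullet> (z - (x + 1 *\<^sub>R w)) = \<xi> \<bullet> (z - x) - w \<bullet> \<xi>" by (simp add: inner_diff_right inner_add_right inner_commute)
      then have "cos (\<xi> \<bullet> (z - (x + 1 *\<^sub>R w))) = cos (\<xi> \<bullet> (z - x)) * cos (w \<bullet> \<xi>) + sin (\<xi> \<bullet> (z - x)) * sin (w \<bullet> \<xi>)"
        by (simp only: cos_diff)
      then show "?F (x + 1 *\<^sub>R w) \<xi> = exp (- t * \<psi> \<xi>) * (cos (\<xi> \<bullet> (z - x)) * (cos (w \<bullet> \<xi>) * q s w) + sin (\<xi> \<bullet> (z - x)) * (sin (w \<bullet> \<xi>) * q s w))"
        by (simp add: algebra_simps)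
    qed
    also have "\<dots> = exp (- t * \<psi> \<xi>) * (cos (\<xi> \<bullet> (z - x)) * exp (- s * \<psi> \<xi>))"
      using c s' heat_kernel_cos_transform[OF s, of \<xi>] heat_kernel_sin_transform[OF s, of \<xi>] by (simp add: cos_transform_def)
    also have "\<dots> = cos (\<xi> \<bullet> (z - x)) * exp (- (s + t) * \<psi> \<xi>)"
      by (simp add: exp_add[symmetric] algebra_simps)
    finally show ?thesis .
  qed
  have "(LINT y|lborel. LINT \<xi>|lborel. ?F y \<xi>) = (LINT \<xi>|lborel. LINT y|lborel. ?F y \<xi>)"
    by (rule lborel_pair.Fubini_integral[OF I, symmetric])
  also have "\<dots> = (2 * pi) ^ DIM('a) * q (s + t) (z - x)"
    unfolding inner using s t by (simp add: heat_kernel_eq cos_transform_def)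
  also have "(LINT y|lborel. LINT \<xi>|lborel. ?F y \<xi>) = (2 * pi) ^ DIM('a) * (LINT y|lborel. q s (y - x) * q t (z - y))"
  proof -
    have qe: "cos_transform (\<lambda>\<xi>. exp (- t * \<psi> \<xi>)) y = (2 * pi) ^ DIM('a) * q t y" for y
      by (simp add: heat_kernel_eq[OF t])
    have "(LINT \<xi>|lborel. ?F y \<xi>) = q s (y - x) * cos_transform (\<lambda>\<xi>. exp (- t * \<psi> \<xi>)) (z - y)" for y
      unfolding cos_transform_def by (rule integral_mult_right_zero)
    then have "(LINT \<xi>|lborel. ?F y \<xi>) = (2 * pi) ^ DIM('a) * (q s (y - x) * q t (z - y))" for y
      unfolding qe by (simp only: mult_ac)
    then have "(LINT y|lborel. LINT \<xi>|lborel. ?F y \<xi>) = (LINT y|lborel. (2 * pi) ^ DIM('a) * (q s (y - x) * q t (z - y)))"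
      by (simp only:)
    also have "\<dots> = (2 * pi) ^ DIM('a) * (LINT y|lborel. q s (y - x) * q t (z - y))" by (rule integral_mult_right_zero)
    finally show ?thesis .
  qed
  finally have eq: "(LINT y|lborel. q s (y - x) * q t (z - y)) = q (s + t) (z - x)" by simp
  have qq: "integrable lborel (\<lambda>y. q s (y - x) * q t (z - y))"
  proof (rule Bochner_Integration.integrable_bound)
    show "integrable lborel (\<lambda>y. q s (y - x) * q t 0)" using qs by simp
    show "AE y in lborel. norm (q s (y - x) * q t (z - y)) \<le> norm (q s (y - x) * q t 0)"
      using heat_kernel_nonneg[OF t] heat_kernel_nonneg[OF s] heat_kernel_le_0[OF t] by (intro AE_I2) (simp add: abs_mult mult_left_mono)
  qed measurable
  have "(\<integral>\<^sup>+y. ennreal (q s (y - x)) * ennreal (q t (z - y)) \<partial>lborel) = (\<integral>\<^sup>+y. ennreal (q s (y - x) * q t (z - y)) \<partial>lborel)"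
    using heat_kernel_nonneg s t by (intro nn_integral_cong) (simp add: ennreal_mult)
  also have "\<dots> = ennreal (q (s + t) (z - x))"
    using heat_kernel_nonneg s t by (subst nn_integral_eq_integral[OF qq]) (auto simp: eq)
  finally show ?thesis .
qed

lemma heat_kernel_levy_kernel:
  assumes "\<And>t x. t > 0 \<Longrightarrow> x \<noteq> 0 \<Longrightarrow> heat_kernel \<nu> t x / t \<le> c * \<nu> x"
    and "\<And>x. x \<noteq> 0 \<Longrightarrow> ((\<lambda>t. heat_kernel \<nu> t x / t) \<longlongrightarrow> \<nu> x) (at_right 0)"
  shows "levy_kernel (heat_kernel \<nu>) \<nu> c"
proof
  show "0 < t \<Longrightarrow> X \<longlonglongrightarrow> t \<Longrightarrow> (\<And>n. t \<le> X n) \<Longrightarrow> (\<lambda>n. q (X n) x) \<longlonglongrightarrow> q t x" for t X x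
    by (rule heat_kernel_time_continuous)
qed (auto intro: heat_kernel_measurable heat_kernel_nonneg heat_kernel_even heat_kernel_mass heat_kernel_convolution
      heat_kernel_le_0 heat_kernel_0_mono heat_kernel_0_long_time assms)

end

section \<open>The polarized Hardy--Stein identity\<close>

lemma heat_semigroup_eq_kernel_op: "heat_semigroup \<nu> t f = kernel_op (heat_kernel \<nu>) t f"
  by (simp add: heat_semigroup_def kernel_op_def fun_eq_iff)

theorem theorem4p1:
  fixes \<nu> :: "'a::euclidean_space \<Rightarrow> real"
    and f g :: "'a \<Rightarrow> real"
    and \<Phi> :: "'a \<Rightarrow> real \<times> real"
    and p c :: real
  assumes \<nu>_borel: "\<nu> \<in> borel_measurable borel"
    and \<nu>_pos: "\<And>z. z \<noteq> 0 \<Longrightarrow> \<nu> z > 0"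
    and \<nu>_sym: "\<And>z. z \<noteq> 0 \<Longrightarrow> \<nu> (- z) = \<nu> z"
    and \<nu>_levy: "integrable lborel (\<lambda>z. min ((norm z)\<^sup>2) 1 * \<nu> z)"
    and \<psi>_growth: "filterlim (\<lambda>\<xi>. levy_exponent \<nu> \<xi> / ln (norm \<xi>)) at_top at_infinity"
    and kernel_bound: "\<And>t x y. t > 0 \<Longrightarrow> x \<noteq> y \<Longrightarrow> heat_kernel \<nu> t (y - x) / t \<le> c * \<nu> (y - x)"
    and kernel_limit: "\<And>x y. x \<noteq> y \<Longrightarrow>
      ((\<lambda>t. heat_kernel \<nu> t (y - x) / t) \<longlongrightarrow> \<nu> (y - x)) (at_right 0)"
    and p: "2 \<le> p"
    and f: "Lp_fun p f" and g: "Lp_fun p g"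
    and \<Phi>: "\<And>x. \<Phi> x = (f x, g x)"
  shows "(\<integral>\<^sup>+t\<in>{0..}. (\<integral>\<^sup>+y. (\<integral>\<^sup>+x. ennreal
            (\<bar>bregman_codiv p (heat_semigroup_pair \<nu> t \<Phi> x) (heat_semigroup_pair \<nu> t \<Phi> y)\<bar>
              * \<nu> (y - x)) \<partial>lborel) \<partial>lborel) \<partial>lborel) < \<infinity>
    \<and> (LINT x|lborel. f x * signed_pow (g x) (p - 1)) =
         (LINT t:{0..}|lborel. (LINT y|lborel. (LINT x|lborel.
            bregman_codiv p (heat_semigroup_pair \<nu> t \<Phi> x) (heat_semigroup_pair \<nu> t \<Phi> y)
              * \<nu> (y - x))))"
proof -
  interpret levy_growth \<nu>
    by standard (fact \<nu>_borel \<nu>_pos \<nu>_levy \<psi>_growth)+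
  interpret K: levy_kernel "heat_kernel \<nu>" \<nu> c
  proof (rule heat_kernel_levy_kernel)
    show "heat_kernel \<nu> t x / t \<le> c * \<nu> x" if "t > 0" "x \<noteq> 0" for t x
      using kernel_bound[OF that(1), of 0 x] that(2) by simp
    show "((\<lambda>t. heat_kernel \<nu> t x / t) \<longlongrightarrow> \<nu> x) (at_right 0)" if "x \<noteq> 0" for x
      using kernel_limit[of 0 x] that by simp
  qed
  have pair: "heat_semigroup_pair \<nu> t \<Phi> x = (kernel_op (heat_kernel \<nu>) t f x, kernel_op (heat_kernel \<nu>) t g x)" for t x
    by (simp add: heat_semigroup_pair_def \<Phi> heat_semigroup_eq_kernel_op)
  show ?thesis unfolding pair using K.polarized_hardy_stein[OF p f g] by blast
qed

end
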